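(* Let $S\in\mathcal B_T^r(H)$ be self-adjoint ($S^*=S$), and suppose in addition that $|S|_{\rm ord}\ge_h0$. Then $$|S|_{\rm ord}=|S|_*\quad\Longleftrightarrow\quad S^+S^-=0.$$ Equivalently, $|S|_{\rm ord}=|S|_*$ holds if and only if $S^+S^-+S^-S^+=0$.
   Context: Setting. All spaces are real. $E$ is a Dedekind complete Riesz space with weak order unit $e$. $T:E\to E$ is a conditional expectation operator, i.e. a positive order-continuous linear projection whose range is a Dedekind complete Riesz subspace and which maps weak order units to weak order units; it satisfies $Te=e$ and is strictly positive ($x\ge 0$ and $Tx=0$ imply $x=0$). $E^u$ is the universal completion of $E$, with its $f$-algebra multiplication having unit $e$. $L^1(T)\subseteq E^u$ is the natural domain of $T$: the set of differences $f_1-f_2$ with $f_i\in E^u_+$ such that there is a net $(f_\alpha)$ in $E_+$ with $f_\alpha\uparrow f_i$ in $E^u$ and $(Tf_\alpha)$ bounded above in $E^u$; $T$ is extended to $L^1(T)$ by $Tf_i=\sup_\alpha Tf_\alpha$, and the extension, still denoted $T$, is again a strictly positive conditional expectation on $L^1(T)$ with $Te=e$. $A:=R(T)$ is the range of the (extended) $T$; it is a Dedekind complete unital Archimedean $f$-algebra with unit $e$, and $T(az)=aT(z)$ for $a\in A$ whenever the products are defined. $H:=L^2(T)=\{x\in L^1(T):x^2\in L^1(T)\}$ with the inherited order is a Dedekind complete Riesz space and an $A$-module. For $x,y\in H$, $\langle x,y\rangle_T:=T(xy)\in A$ and $\|x\|_{T,2}:=(T(x^2))^{1/2}\in A_+$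 (the positive square root in $A$). Definitions. $\mathcal B_T(H)$ is the set of $A$-linear (additive and $A$-homogeneous) maps $S:H\to H$ that are $T$-strongly bounded: there is $k\in A_+$ with $\|Sx\|_{T,2}\le k\|x\|_{T,2}$ for all $x\in H$. For $S\in\mathcal B_T(H)$, the adjoint $S^*$ is the unique operator in $\mathcal B_T(H)$ with $\langle Sx,y\rangle_T=\langle x,S^*y\rangle_T$ for all $x,y\in H$ (it always exists). An operator $S\in\mathcal B_T(H)$ is order positive if $x\ge0$ implies $Sx\ge0$, and inner-product positive, written $S\ge_h0$, if $\langle Sx,x\rangle_T\ge0$ for all $x\in H$. $\mathcal B_T(H)_+$ is the set of order-positive operators in $\mathcal B_T(H)$, and $\mathcal B_T^r(H):=\mathcal B_T(H)_+-\mathcal B_T(H)_+$ (the $T$-regular operators). For $S\in\mathcal B_T^r(H)$, $|S|_{\rm ord}\in\mathcal B_T(H)$ is the Riesz--Kantorovich modulus, $|S|_{\rm ord}x=\sup\{|Su|:|u|\le x\}$ for $x\in H_+$, and $S^+=\tfrac12(|S|_{\rm ord}+S)$, $S^-=\tfrac12(|S|_{\rm ord}-S)$. The spectral modulus $|S|_*:=(S^*S)^{1/2}$ is the unique self-adjoint inner-product positive $Q\in\mathcal B_T(H)$ with $Q^2=S^*S$ (it exists for every $S\in\mathcal B_T(H)$). *)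

theory Defs
  imports "HOL-Analysis.Analysis" "HOL-Library.Lattice_Algebras"
begin

section \<open>Riesz spaces\<close>

definition lub_in :: "'a::order set \<Rightarrow> 'a set \<Rightarrow> 'a \<Rightarrow> bool" where
  "lub_in V X s \<longleftrightarrow>
     s \<in> V \<and> (\<forall>x\<in>X. x \<le> s) \<and> (\<forall>b\<in>V. (\<forall>x\<in>X. x \<le> b) \<longrightarrow> s \<le> b)"

definition glb_in :: "'a::order set \<Rightarrow> 'a set \<Rightarrow> 'a \<Rightarrow> bool" where
  "glb_in V X s \<longleftrightarrow>
     s \<in> V \<and> (\<forall>x\<in>X. s \<le> x) \<and> (\<forall>b\<in>V. (\<forall>x\<in>X. b \<le> x) \<longrightarrow> b \<le> s)"

definition dedekind_complete_on :: "'a::order set \<Rightarrow> bool" where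
  "dedekind_complete_on V \<longleftrightarrow>
     (\<forall>X. X \<subseteq> V \<longrightarrow> X \<noteq> {} \<longrightarrow> (\<exists>b\<in>V. \<forall>x\<in>X. x \<le> b) \<longrightarrow> (\<exists>s. lub_in V X s))"

text \<open>Monotone nets are represented by their ranges: the range of an increasing net is an
  upward directed set, and an upward directed set is an increasing net indexed by itself.\<close>

definition up_directed :: "'a::order set \<Rightarrow> bool" where
  "up_directed D \<longleftrightarrow> D \<noteq> {} \<and> (\<forall>x\<in>D. \<forall>y\<in>D. \<exists>z\<in>D. x \<le> z \<and> y \<le> z)"

definition down_directed :: "'a::order set \<Rightarrow> bool" where
  "down_directed D \<longleftrightarrow> D \<noteq> {} \<and> (\<forall>x\<in>D. \<forall>y\<in>D. \<exists>z\<in>D. z \<le> x \<and> z \<le> y)"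

definition riesz_subspace :: "'a::{ordered_real_vector, lattice} set \<Rightarrow> bool" where
  "riesz_subspace V \<longleftrightarrow>
     subspace V \<and> (\<forall>x\<in>V. \<forall>y\<in>V. sup x y \<in> V \<and> inf x y \<in> V)"

definition order_dense :: "'a::{ordered_real_vector, lattice} set \<Rightarrow> bool" where
  "order_dense V \<longleftrightarrow> (\<forall>u>0. \<exists>x\<in>V. 0 < x \<and> x \<le> u)"

definition weak_order_unit_on ::
  "'a::{ordered_real_vector, lattice_ab_group_add_abs} set \<Rightarrow> 'a \<Rightarrow> bool" where
  "weak_order_unit_on V w \<longleftrightarrow>
     w \<in> V \<and> 0 \<le> w \<and> (\<forall>x\<in>V. inf \<bar>x\<bar> w = 0 \<longrightarrow> x = 0)"

text \<open>A universally complete Riesz space (Dedekind complete and laterally complete) with an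
  \<open>f\<close>-algebra multiplication whose unit is \<open>1\<close>. Commutativity is automatic
  for Archimedean \<open>f\<close>-algebras. The class \<open>comm_ring_1\<close> is avoided
  because it would exclude the zero space.\<close>

class universally_complete_falgebra =
  lattice_ring + comm_ring + comm_monoid_mult + real_algebra + ordered_real_vector +
  conditionally_complete_lattice +
  assumes f_algebra: "inf x y = 0 \<Longrightarrow> 0 \<le> z \<Longrightarrow> inf (z * x) y = 0"
    and laterally_complete:
      "X \<noteq> {} \<Longrightarrow> (\<And>x. x \<in> X \<Longrightarrow> 0 \<le> x) \<Longrightarrow>
       (\<And>x y. x \<in> X \<Longrightarrow> y \<in> X \<Longrightarrow> x \<noteq> y \<Longrightarrow> inf x y = 0) \<Longrightarrow>
       \<exists>s. (\<forall>x\<in>X. x \<le> s) \<and> (\<forall>b. (\<forall>x\<in>X. x \<le> b) \<longrightarrow> s \<le> b)"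


section \<open>Conditional expectations and their natural domain\<close>

text \<open>The ambient type is \<open>E\<^sup>u\<close>, the space \<open>E\<close> is a subset of it,
  and \<open>e = 1\<close>. The universal completion of \<open>E\<close> is the (up to isomorphism unique)
  universally complete Riesz space containing \<open>E\<close> as an order dense Riesz subspace.
  The map \<open>T\<close> is only relevant on \<open>E\<close>.

  For a positive operator, order continuity means that decreasing nets with infimum
  \<open>0\<close> are mapped to nets with infimum \<open>0\<close>.\<close>

definition conditional_expectation ::
  "'u::universally_complete_falgebra set \<Rightarrow> ('u \<Rightarrow> 'u) \<Rightarrow> bool" where
  "conditional_expectation E T \<longleftrightarrow>
     riesz_subspace E \<and> order_dense E \<and> dedekind_complete_on E \<and> weak_order_unit_on E 1 \<and>
     T \<in> E \<rightarrow> E \<and>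
     (\<forall>x\<in>E. \<forall>y\<in>E. T (x + y) = T x + T y) \<and>
     (\<forall>c. \<forall>x\<in>E. T (c *\<^sub>R x) = c *\<^sub>R T x) \<and>
     (\<forall>x\<in>E. 0 \<le> x \<longrightarrow> 0 \<le> T x) \<and>
     (\<forall>D. D \<subseteq> E \<longrightarrow> down_directed D \<longrightarrow> glb_in E D 0 \<longrightarrow> glb_in E (T ` D) 0) \<and>
     (\<forall>x\<in>E. T (T x) = T x) \<and>
     riesz_subspace (T ` E) \<and> dedekind_complete_on (T ` E) \<and>
     (\<forall>w. weak_order_unit_on E w \<longrightarrow> weak_order_unit_on E (T w)) \<and>
     T 1 = 1 \<and>
     (\<forall>x\<in>E. 0 \<le> x \<longrightarrow> T x = 0 \<longrightarrow> x = 0)"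

definition dom_net ::
  "'u::universally_complete_falgebra set \<Rightarrow> ('u \<Rightarrow> 'u) \<Rightarrow> 'u set \<Rightarrow> 'u \<Rightarrow> bool" where
  "dom_net E T D f \<longleftrightarrow>
     D \<subseteq> {x\<in>E. 0 \<le> x} \<and> up_directed D \<and> lub_in UNIV D f \<and> bdd_above (T ` D)"

definition L1_pos :: "'u::universally_complete_falgebra set \<Rightarrow> ('u \<Rightarrow> 'u) \<Rightarrow> 'u set" where
  "L1_pos E T = {f. 0 \<le> f \<and> (\<exists>D. dom_net E T D f)}"

definition L1 :: "'u::universally_complete_falgebra set \<Rightarrow> ('u \<Rightarrow> 'u) \<Rightarrow> 'u set" where
  "L1 E T = {f - g | f g. f \<in> L1_pos E T \<and> g \<in> L1_pos E T}"

definition ext_pos ::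
  "'u::universally_complete_falgebra set \<Rightarrow> ('u \<Rightarrow> 'u) \<Rightarrow> 'u \<Rightarrow> 'u" where
  "ext_pos E T f = (THE t. \<exists>D. dom_net E T D f \<and> lub_in UNIV (T ` D) t)"

definition ext :: "'u::universally_complete_falgebra set \<Rightarrow> ('u \<Rightarrow> 'u) \<Rightarrow> 'u \<Rightarrow> 'u" where
  "ext E T x =
     (THE t. \<exists>f\<in>L1_pos E T. \<exists>g\<in>L1_pos E T. x = f - g \<and> t = ext_pos E T f - ext_pos E T g)"

definition range_alg :: "'u::universally_complete_falgebra set \<Rightarrow> ('u \<Rightarrow> 'u) \<Rightarrow> 'u set" where
  "range_alg E T = ext E T ` L1 E T"

definition L2 :: "'u::universally_complete_falgebra set \<Rightarrow> ('u \<Rightarrow> 'u) \<Rightarrow> 'u set" where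
  "L2 E T = {x \<in> L1 E T. x * x \<in> L1 E T}"

definition T_inner ::
  "'u::universally_complete_falgebra set \<Rightarrow> ('u \<Rightarrow> 'u) \<Rightarrow> 'u \<Rightarrow> 'u \<Rightarrow> 'u" where
  "T_inner E T x y = ext E T (x * y)"

definition T_norm ::
  "'u::universally_complete_falgebra set \<Rightarrow> ('u \<Rightarrow> 'u) \<Rightarrow> 'u \<Rightarrow> 'u" where
  "T_norm E T x = (THE b. b \<in> range_alg E T \<and> 0 \<le> b \<and> b * b = ext E T (x * x))"


section \<open>Operators on \<open>L\<^sup>2(T)\<close>\<close>

text \<open>Operators on \<open>H = L\<^sup>2(T)\<close> are extensional functions (\<open>undefined\<close>
  outside \<open>H\<close>), so that equality of functions is equality of operators and
  \<open>compose (L2 E T)\<close> is their product.\<close>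

definition B_T :: "'u::universally_complete_falgebra set \<Rightarrow> ('u \<Rightarrow> 'u) \<Rightarrow> ('u \<Rightarrow> 'u) set" where
  "B_T E T = {S \<in> L2 E T \<rightarrow>\<^sub>E L2 E T.
     (\<forall>x\<in>L2 E T. \<forall>y\<in>L2 E T. S (x + y) = S x + S y) \<and>
     (\<forall>a\<in>range_alg E T. \<forall>x\<in>L2 E T. S (a * x) = a * S x) \<and>
     (\<exists>k\<in>range_alg E T. 0 \<le> k \<and> (\<forall>x\<in>L2 E T. T_norm E T (S x) \<le> k * T_norm E T x))}"

definition op_zero ::
  "'u::universally_complete_falgebra set \<Rightarrow> ('u \<Rightarrow> 'u) \<Rightarrow> 'u \<Rightarrow> 'u" where
  "op_zero E T = (\<lambda>x\<in>L2 E T. 0)"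

definition op_add ::
  "'u::universally_complete_falgebra set \<Rightarrow> ('u \<Rightarrow> 'u) \<Rightarrow> ('u \<Rightarrow> 'u) \<Rightarrow> ('u \<Rightarrow> 'u) \<Rightarrow> 'u \<Rightarrow> 'u" where
  "op_add E T S R = (\<lambda>x\<in>L2 E T. S x + R x)"

definition op_diff ::
  "'u::universally_complete_falgebra set \<Rightarrow> ('u \<Rightarrow> 'u) \<Rightarrow> ('u \<Rightarrow> 'u) \<Rightarrow> ('u \<Rightarrow> 'u) \<Rightarrow> 'u \<Rightarrow> 'u" where
  "op_diff E T S R = (\<lambda>x\<in>L2 E T. S x - R x)"

definition op_scale ::
  "'u::universally_complete_falgebra set \<Rightarrow> ('u \<Rightarrow> 'u) \<Rightarrow> real \<Rightarrow> ('u \<Rightarrow> 'u) \<Rightarrow> 'u \<Rightarrow> 'u" where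
  "op_scale E T c S = (\<lambda>x\<in>L2 E T. c *\<^sub>R S x)"

definition is_adjoint ::
  "'u::universally_complete_falgebra set \<Rightarrow> ('u \<Rightarrow> 'u) \<Rightarrow> ('u \<Rightarrow> 'u) \<Rightarrow> ('u \<Rightarrow> 'u) \<Rightarrow> bool" where
  "is_adjoint E T S R \<longleftrightarrow> R \<in> B_T E T \<and>
     (\<forall>x\<in>L2 E T. \<forall>y\<in>L2 E T. T_inner E T (S x) y = T_inner E T x (R y))"

definition adjoint_op ::
  "'u::universally_complete_falgebra set \<Rightarrow> ('u \<Rightarrow> 'u) \<Rightarrow> ('u \<Rightarrow> 'u) \<Rightarrow> 'u \<Rightarrow> 'u" where
  "adjoint_op E T S = (THE R. is_adjoint E T S R)"

text \<open>\<open>S\<^sup>* = S\<close> says that \<open>S\<close> itself has the property defining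
  its (unique) adjoint.\<close>

definition self_adjoint ::
  "'u::universally_complete_falgebra set \<Rightarrow> ('u \<Rightarrow> 'u) \<Rightarrow> ('u \<Rightarrow> 'u) \<Rightarrow> bool" where
  "self_adjoint E T S \<longleftrightarrow> is_adjoint E T S S"

definition inner_positive ::
  "'u::universally_complete_falgebra set \<Rightarrow> ('u \<Rightarrow> 'u) \<Rightarrow> ('u \<Rightarrow> 'u) \<Rightarrow> bool" where
  "inner_positive E T S \<longleftrightarrow> (\<forall>x\<in>L2 E T. 0 \<le> T_inner E T (S x) x)"

definition B_T_pos ::
  "'u::universally_complete_falgebra set \<Rightarrow> ('u \<Rightarrow> 'u) \<Rightarrow> ('u \<Rightarrow> 'u) set" where
  "B_T_pos E T = {S \<in> B_T E T. \<forall>x\<in>L2 E T. 0 \<le> x \<longrightarrow> 0 \<le> S x}"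

definition B_T_regular ::
  "'u::universally_complete_falgebra set \<Rightarrow> ('u \<Rightarrow> 'u) \<Rightarrow> ('u \<Rightarrow> 'u) set" where
  "B_T_regular E T = {op_diff E T U V | U V. U \<in> B_T_pos E T \<and> V \<in> B_T_pos E T}"

text \<open>The Riesz--Kantorovich formula defines the modulus on the positive cone;
  it is extended to \<open>H\<close> by \<open>x = x\<^sup>+ - x\<^sup>-\<close>.\<close>

definition rk_sup ::
  "'u::universally_complete_falgebra set \<Rightarrow> ('u \<Rightarrow> 'u) \<Rightarrow> ('u \<Rightarrow> 'u) \<Rightarrow> 'u \<Rightarrow> 'u" where
  "rk_sup E T S x = (THE s. lub_in (L2 E T) {\<bar>S u\<bar> | u. u \<in> L2 E T \<and> \<bar>u\<bar> \<le> x} s)"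

definition ord_modulus ::
  "'u::universally_complete_falgebra set \<Rightarrow> ('u \<Rightarrow> 'u) \<Rightarrow> ('u \<Rightarrow> 'u) \<Rightarrow> 'u \<Rightarrow> 'u" where
  "ord_modulus E T S = (\<lambda>x\<in>L2 E T. rk_sup E T S (sup x 0) - rk_sup E T S (sup (- x) 0))"

definition pos_part_op ::
  "'u::universally_complete_falgebra set \<Rightarrow> ('u \<Rightarrow> 'u) \<Rightarrow> ('u \<Rightarrow> 'u) \<Rightarrow> 'u \<Rightarrow> 'u" where
  "pos_part_op E T S = op_scale E T (1/2) (op_add E T (ord_modulus E T S) S)"

definition neg_part_op ::
  "'u::universally_complete_falgebra set \<Rightarrow> ('u \<Rightarrow> 'u) \<Rightarrow> ('u \<Rightarrow> 'u) \<Rightarrow> 'u \<Rightarrow> 'u" where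
  "neg_part_op E T S = op_scale E T (1/2) (op_diff E T (ord_modulus E T S) S)"

definition spectral_modulus ::
  "'u::universally_complete_falgebra set \<Rightarrow> ('u \<Rightarrow> 'u) \<Rightarrow> ('u \<Rightarrow> 'u) \<Rightarrow> 'u \<Rightarrow> 'u" where
  "spectral_modulus E T S =
     (THE Q. Q \<in> B_T E T \<and> self_adjoint E T Q \<and> inner_positive E T Q \<and>
        compose (L2 E T) Q Q = compose (L2 E T) (adjoint_op E T S) S)"

end

theory Submission
  imports Defs
begin

text \<open>With \<open>P = S\<^sup>+\<close> and \<open>N = S\<^sup>-\<close> one has \<open>|S|\<^sub>o\<^sub>r\<^sub>d\<^sup>2 - S\<^sup>2 = 2 (P N + N P)\<close>. Since
  \<open>|S|\<^sub>o\<^sub>r\<^sub>d\<close> is self-adjoint and inner-product positive, it is the spectral modulus if and only if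
  \<open>P N + N P = 0\<close>; as both products are order positive, this forces \<open>P N = 0\<close>, and conversely
  \<open>N P\<close> is the adjoint of \<open>P N\<close>.

  The existence of \<open>(S\<^sup>* S)\<^sup>1\<^sup>/\<^sup>2\<close> is obtained, after rescaling by an invertible element of the range
  algebra, from the iteration \<open>Y\<^bsub>n+1\<^esub> = (Z + Y\<^bsub>n\<^esub>\<^sup>2) / 2\<close> for \<open>Z = 1 - S\<^sup>2\<close>; it converges because \<open>L\<^sup>2(T)\<close> is
  complete, and completeness rests on the lateral completeness of \<open>E\<^sup>u\<close>: an increasing sequence with
  bounded expectations is bounded, since it is bounded on components that exhaust the unit. The root
  commutes with everything that commutes with \<open>S\<^sup>2\<close>, which gives uniqueness. The averaging property
  follows from Jensen's inequality and strict positivity.\<close>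

section \<open>Order and multiplication\<close>

text \<open>Norms and bounds take values in \<open>A\<close>, which is neither a field nor totally
  ordered, so small elements cannot be divided by and sizes cannot be compared case by case. Several
  devices stand in for this. A pointwise case distinction becomes a statement about disjoint
  elements or about an idempotent \<open>q\<close> that acts as an indicator. A claim about an
  unbounded factor \<open>a\<close> is tested after multiplication by \<open>(n - a)^+\<close>, and
  the Archimedean property removes the cutoff. Convergence is measured by a real sequence times one
  fixed positive element, so that all rates are real numbers. Norm estimates are kept in the squared
  form \<open>N x = \<tau> (x * x)\<close>; roots in \<open>A\<close> serve only to translate the
  definition of \<open>B_T\<close>.

  Self-adjointness of \<open>|S|_ord\<close> is not formal either: the set of all
  \<open>|S u|\<close> with \<open>|u| \<le> x\<close> need not be visibly directed, so
  \<open>\<tau>\<close> cannot be exchanged with its supremum before that set is enlarged to one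
  closed under finite suprema.\<close>

lemma scaleR_arch:
  fixes w y :: "'u::universally_complete_falgebra"
  assumes "\<And>n::nat. real n *\<^sub>R w \<le> y"
  shows "w \<le> 0"
proof -
  let ?X = "range (\<lambda>n::nat. real n *\<^sub>R w)"
  have bdd: "bdd_above ?X" using assms by (auto simp: bdd_above_def)
  \<comment> \<open>The multiples shifted by one are still below the supremum, so the supremum
    survives subtraction of \<open>w\<close>.\<close>
  have "real n *\<^sub>R w \<le> Sup ?X - w" for n :: nat
  proof -
    have "real (Suc n) *\<^sub>R w \<le> Sup ?X" by (rule cSup_upper[OF _ bdd]) blast
    then show ?thesis by (simp add: algebra_simps)
  qed
  then have "Sup ?X \<le> Sup ?X - w" by (intro cSup_least) auto
  then show ?thesis by simp
qed

lemma le_inverse_nat_arch: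
  fixes w y :: "'u::universally_complete_falgebra"
  assumes "\<And>n::nat. 0 < n \<Longrightarrow> real n *\<^sub>R w \<le> y"
  shows "w \<le> 0"
proof (rule scaleR_arch[of _ "y - w"])
  fix n :: nat
  have "real (Suc n) *\<^sub>R w \<le> y" by (rule assms) simp
  then show "real n *\<^sub>R w \<le> y - w" by (simp add: algebra_simps)
qed

lemma le_eps_arch:
  fixes w y :: "'u::universally_complete_falgebra"
  assumes "\<And>\<epsilon>::real. 0 < \<epsilon> \<Longrightarrow> w \<le> \<epsilon> *\<^sub>R y"
  shows "w \<le> 0"
proof (rule le_inverse_nat_arch[of _ y])
  fix n :: nat assume "0 < n"
  then have "real n *\<^sub>R w \<le> real n *\<^sub>R (1 / real n) *\<^sub>R y"
    by (intro scaleR_left_mono assms) auto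
  then show "real n *\<^sub>R w \<le> y" using \<open>0 < n\<close> by simp
qed

lemma pprt_minus_pprt: "pprt x - pprt (- x) = (x :: 'u::lattice_ab_group_add)"
  using prts[of x] by (simp add: pprt_neg)

lemma pprt_disjoint: "inf (pprt x) (pprt (- x)) = (0 :: 'u::lattice_ab_group_add)"
proof -
  have "inf (pprt x) (pprt (- x)) + nprt x = nprt x"
    by (simp add: add_inf_distrib_right pprt_neg prts[symmetric])
       (simp add: nprt_def)
  then show ?thesis by simp
qed

text \<open>The f-algebra axiom, applied once on each side, makes the product disjoint from
  itself.\<close>

lemma disjoint_mult_zero:
  fixes x y :: "'u::universally_complete_falgebra"
  assumes "inf x y = 0"
  shows "x * y = 0"
proof -
  have pos: "0 \<le> x" "0 \<le> y" using assms by (metis inf_le1, metis inf_le2)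
  have "inf (y * x) y = 0" using f_algebra[OF assms pos(2)] .
  then have "inf (x * y) (y * x) = 0"
    using f_algebra[of y "y * x" x] pos by (simp add: inf_commute)
  then show ?thesis by (simp add: mult.commute)
qed

lemma pprt_mult_pprt_minus [simp]:
  "pprt x * pprt (- x) = (0 :: 'u::universally_complete_falgebra)"
  by (rule disjoint_mult_zero[OF pprt_disjoint])

lemma pprt_mult_self:
  "pprt x * x = pprt x * pprt (x :: 'u::universally_complete_falgebra)"
proof -
  have "pprt x * x = pprt x * (pprt x - pprt (- x))" by (simp add: pprt_minus_pprt)
  also have "\<dots> = pprt x * pprt x" by (simp only: right_diff_distrib pprt_mult_pprt_minus) simp
  finally show ?thesis .
qed

lemma square_decomp:
  "x * x = pprt x * pprt x + pprt (- x) * pprt (- x :: 'u::universally_complete_falgebra)"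
proof -
  have "x * x = pprt x * x + pprt (- x) * (- x)"
    using arg_cong[OF pprt_minus_pprt[of x], of "\<lambda>z. z * x"] by (simp add: left_diff_distrib)
  then show ?thesis by (simp only: pprt_mult_self)
qed

lemma square_nonneg [simp]: "0 \<le> x * (x :: 'u::universally_complete_falgebra)"
  by (simp add: square_decomp[of x])

lemma one_nonneg [simp]: "0 \<le> (1 :: 'u::universally_complete_falgebra)"
  using square_nonneg[of "1::'u"] by simp

text \<open>If \<open>y * y = 0\<close>, then \<open>(1 - 2 n y)^2 = 1 - 4 n y\<close> has no
  quadratic term; its nonnegativity for every \<open>n\<close> gives \<open>y \<le> 0\<close> by the
  Archimedean property, and the same applies to \<open>- y\<close>.\<close>

lemma square_eq_zero:
  fixes x :: "'u::universally_complete_falgebra"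
  assumes "x * x = 0"
  shows "x = 0"
proof -
  have *: "y \<le> 0" if "y * y = 0" for y :: 'u
  proof (rule scaleR_arch[of _ "1"])
    fix n :: nat
    have "0 \<le> (1 - (2 * real n) *\<^sub>R y) * (1 - (2 * real n) *\<^sub>R y)" by simp
    also have "\<dots> = 1 - (4 * real n) *\<^sub>R y"
      using that by (simp add: algebra_simps flip: scaleR_left_distrib)
    finally have "(4 * real n) *\<^sub>R y \<le> 1" by simp
    then have "(1/4) *\<^sub>R (4 * real n) *\<^sub>R y \<le> (1/4) *\<^sub>R 1" by (intro scaleR_left_mono) auto
    also have "\<dots> \<le> 1 *\<^sub>R (1::'u)" by (rule scaleR_right_mono) auto
    finally show "real n *\<^sub>R y \<le> 1" by simp
  qed
  have "x \<le> 0" "- x \<le> 0" using assms *[of x] *[of "- x"] by auto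
  then show ?thesis by simp
qed

text \<open>The square of the infimum is at most the product, and there are no nonzero
  nilpotents.\<close>

lemma mult_zero_disjoint:
  fixes x y :: "'u::universally_complete_falgebra"
  assumes "0 \<le> x" "0 \<le> y" "x * y = 0"
  shows "inf x y = 0"
proof (rule square_eq_zero)
  have "inf x y * inf x y \<le> x * y" using assms by (intro mult_mono) auto
  then show "inf x y * inf x y = 0" using assms by (simp add: antisym)
qed

lemma pprt_le_self: "0 \<le> y \<Longrightarrow> x \<le> y \<Longrightarrow> pprt x \<le> (y :: 'u::lattice_ab_group_add)"
  by (simp add: pprt_def)

text \<open>With \<open>d = (x - y)^+\<close>, multiplying \<open>x^2 - y^2 \<le> 0\<close> by
  \<open>d\<close> gives \<open>d^3 + 2 y d^2 \<le> 0\<close>. Both terms are nonnegative, so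
  \<open>d^3 = 0\<close> and hence \<open>d = 0\<close>; no division by \<open>x + y\<close> is
  involved.\<close>

lemma square_mono_le:
  fixes x y :: "'u::universally_complete_falgebra"
  assumes "0 \<le> y" "x * x \<le> y * y"
  shows "x \<le> y"
proof -
  define d where "d = pprt (x - y)"
  have d0: "0 \<le> d" by (simp add: d_def)
  have "d * (x - y) = d * d" by (simp add: d_def pprt_mult_self)
  moreover have "x * x - y * y = (x - y) * (x - y) + (y + y) * (x - y)" by (simp add: algebra_simps)
  ultimately have "d * (x * x - y * y) = d * d * (x - y) + (y + y) * (d * d)"
    by (metis (no_types, lifting) distrib_left mult.assoc mult.commute)
  also have "d * d * (x - y) = d * (d * d)" using \<open>d * (x - y) = d * d\<close> by (simp add: mult.assoc)
  finally have eq: "d * (x * x - y * y) = d * (d * d) + (y + y) * (d * d)" .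
  have "d * (x * x - y * y) \<le> 0" using assms(2) d0 by (simp add: mult_nonneg_nonpos)
  moreover have "0 \<le> (y + y) * (d * d)" "0 \<le> d * (d * d)" using assms(1) d0 by auto
  ultimately have "d * (d * d) \<le> 0" using eq by (metis add_increasing2 order_refl order_trans)
  then have "d * (d * d) = 0" using \<open>0 \<le> d * (d * d)\<close> by (rule antisym)
  then have "(d * d) * (d * d) = 0" by (simp only: mult.assoc mult_zero_right)
  then have "d = 0" by (rule square_eq_zero[OF square_eq_zero])
  then show ?thesis by (simp add: d_def flip: le_zero_iff_zero_pprt)
qed

lemma abs_eq_pprt: "\<bar>x\<bar> = pprt x + pprt (- x :: 'u::lattice_ab_group_add_abs)"
  using abs_prts[of x] by (simp add: pprt_neg)

lemma abs_mult_abs: "\<bar>x\<bar> * \<bar>x\<bar> = x * (x::'u::universally_complete_falgebra)"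
  using pprt_mult_pprt_minus[of x]
  by (simp add: abs_eq_pprt square_decomp[of x] algebra_simps)

lemma abs_pos_mult:
  fixes a x :: "'u::universally_complete_falgebra"
  assumes "0 \<le> a"
  shows "\<bar>a * x\<bar> = a * \<bar>x\<bar>"
proof -
  have 1: "inf (a * pprt x) (a * pprt (- x)) = 0"
    using f_algebra[OF f_algebra[OF pprt_disjoint[of x] assms, unfolded inf_commute[of "a * _"]] assms]
    by (simp add: inf_commute)
  have "a * x = a * pprt x - a * pprt (- x)" by (simp add: right_diff_distrib[symmetric] pprt_minus_pprt)
  moreover have "\<bar>u - v\<bar> = u + v" if "inf u v = 0" for u v :: 'u
  proof -
    have s: "sup u v = u + v" using add_eq_inf_sup[of u v] that by simp
    have "pprt (u - v) = u" "pprt (- (u - v)) = v"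
      using s add_sup_distrib_right[of u v "- v"] add_sup_distrib_right[of v u "- u"]
      by (simp_all add: pprt_def sup_commute)
    then show ?thesis by (simp only: abs_eq_pprt)
  qed
  ultimately show ?thesis using 1 by (simp add: abs_eq_pprt[of x] distrib_left)
qed

section \<open>Suprema, components and lateral completeness\<close>

lemma lub_ex:
  fixes X :: "'u::universally_complete_falgebra set"
  assumes "X \<noteq> {}" "\<And>x. x \<in> X \<Longrightarrow> x \<le> b"
  shows "\<exists>s. lub_in UNIV X s"
proof
  have "bdd_above X" using assms(2) by (auto simp: bdd_above_def)
  then show "lub_in UNIV X (Sup X)"
    using assms by (auto simp: lub_in_def intro: cSup_upper cSup_least)
qed

lemma lub_upper: "lub_in UNIV X s \<Longrightarrow> x \<in> X \<Longrightarrow> x \<le> s"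
  by (simp add: lub_in_def)

lemma lub_least: "lub_in UNIV X s \<Longrightarrow> (\<And>x. x \<in> X \<Longrightarrow> x \<le> b) \<Longrightarrow> s \<le> b"
  by (simp add: lub_in_def)

lemma lubI: "(\<And>x. x \<in> X \<Longrightarrow> x \<le> s) \<Longrightarrow> (\<And>b. (\<And>x. x \<in> X \<Longrightarrow> x \<le> b) \<Longrightarrow> s \<le> b) \<Longrightarrow> lub_in UNIV X s"
  by (simp add: lub_in_def)

lemma lub_unique: "lub_in V X s \<Longrightarrow> lub_in V X t \<Longrightarrow> s = t"
  by (auto simp: lub_in_def intro: antisym)

text \<open>Infinite distributivity comes from \<open>y + x = sup y x + inf y x\<close>: replacing
  \<open>sup y x\<close> by \<open>sup y s\<close> turns a bound for the infima into a bound for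
  \<open>X\<close>.\<close>

lemma lub_inf:
  fixes s y :: "'u::lattice_ab_group_add"
  assumes "lub_in UNIV X s"
  shows "lub_in UNIV (inf y ` X) (inf y s)"
proof (rule lubI)
  fix b assume b: "\<And>x. x \<in> inf y ` X \<Longrightarrow> x \<le> b"
  have "s \<le> b + sup y s - y"
  proof (rule lub_least[OF assms])
    fix x assume x: "x \<in> X"
    have "y + x = sup y x + inf y x" by (rule add_eq_inf_sup)
    also have "\<dots> \<le> sup y s + b"
      using b x lub_upper[OF assms x] by (intro add_mono sup_mono) auto
    finally show "x \<le> b + sup y s - y" by (simp add: algebra_simps)
  qed
  then show "inf y s \<le> b" using add_eq_inf_sup[of y s] by (simp add: algebra_simps)
qed (use lub_upper[OF assms] in \<open>auto intro: le_infI2\<close>)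

text \<open>The factor \<open>(n - a)\<^sup>+\<close> makes the multiplication by \<open>a\<close> bounded:
  \<open>(n - a)\<^sup>+ a \<le> n\<^sup>2\<close>.\<close>

lemma pprt_cutoff_mult_le:
  fixes a :: "'u::universally_complete_falgebra"
  assumes "0 \<le> a" "0 \<le> r"
  shows "pprt (r *\<^sub>R 1 - a) * a \<le> (r * r) *\<^sub>R 1"
proof -
  let ?p = "pprt (r *\<^sub>R 1 - a)"
  have "?p * a = r *\<^sub>R ?p - ?p * (r *\<^sub>R 1 - a)" by (simp add: right_diff_distrib)
  also have "\<dots> \<le> r *\<^sub>R ?p" by (simp add: pprt_mult_self)
  also have "\<dots> \<le> r *\<^sub>R r *\<^sub>R 1"
    using assms by (intro scaleR_left_mono pprt_le_self scaleR_nonneg_nonneg) auto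
  finally show ?thesis by simp
qed

text \<open>From \<open>(n - a) w \<le> (n - a)^+ w \<le> 0\<close> one reads off
  \<open>n w \<le> a w\<close> for all \<open>n\<close>. This allows an inequality to be checked
  only where \<open>a\<close> is bounded.\<close>

lemma cutoff_arch:
  fixes a w :: "'u::universally_complete_falgebra"
  assumes "\<And>n::nat. 0 < n \<Longrightarrow> pprt (real n *\<^sub>R 1 - a) * w \<le> 0" "0 \<le> w"
  shows "w \<le> 0"
proof (rule le_inverse_nat_arch[of _ "a * w"])
  fix n :: nat assume "0 < n"
  have "(real n *\<^sub>R 1 - a) * w \<le> pprt (real n *\<^sub>R 1 - a) * w"
    using assms(2) by (intro mult_right_mono) (auto simp: pprt_def)
  also have "\<dots> \<le> 0" using assms(1) \<open>0 < n\<close> .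
  finally show "real n *\<^sub>R w \<le> a * w" by (simp add: left_diff_distrib)
qed

text \<open>Order continuity of multiplication. For an upper bound \<open>b\<close> of the products,
  the excess \<open>w = (a s - b)^+\<close> lies below \<open>a (s - x)\<close> for every
  \<open>x\<close>. After the cutoff \<open>p = (n - a)^+\<close> this reads
  \<open>p w \<le> n^2 (s - x)\<close>, so \<open>s - p w / n^2\<close> also bounds
  \<open>X\<close>, which forces \<open>p w \<le> 0\<close>.\<close>

lemma lub_mult:
  fixes a s :: "'u::universally_complete_falgebra"
  assumes "lub_in UNIV X s" "0 \<le> a"
  shows "lub_in UNIV ((*) a ` X) (a * s)"
proof (rule lubI)
  fix b assume b: "\<And>x. x \<in> (*) a ` X \<Longrightarrow> x \<le> b"
  define w where "w = pprt (a * s - b)"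
  have w: "w \<le> a * (s - x)" if "x \<in> X" for x
    unfolding w_def using that b lub_upper[OF assms(1) that] assms(2)
    by (intro pprt_le_self mult_nonneg_nonneg) (auto simp: right_diff_distrib)
  have "w \<le> 0"
  proof (rule cutoff_arch)
    fix n :: nat assume n: "0 < n"
    let ?p = "pprt (real n *\<^sub>R 1 - a)"
    let ?k = "real n * real n"
    have "s \<le> s - (1 / ?k) *\<^sub>R (?p * w)"
    proof (rule lub_least[OF assms(1)])
      fix x assume x: "x \<in> X"
      have "?p * w \<le> (?p * a) * (s - x)"
        using mult_left_mono[OF w[OF x], of ?p] by (simp add: mult.assoc)
      also have "\<dots> \<le> (?k *\<^sub>R 1) * (s - x)"
        using lub_upper[OF assms(1) x] assms(2) by (intro mult_right_mono pprt_cutoff_mult_le) auto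
      finally have "(1 / ?k) *\<^sub>R (?p * w) \<le> (1 / ?k) *\<^sub>R ?k *\<^sub>R (s - x)"
        by (intro scaleR_left_mono) auto
      also have "\<dots> = s - x" using n by simp
      finally show "x \<le> s - (1 / ?k) *\<^sub>R (?p * w)" by (simp add: algebra_simps)
    qed
    then have "?k *\<^sub>R (1 / ?k) *\<^sub>R (?p * w) \<le> ?k *\<^sub>R 0" by (intro scaleR_left_mono) auto
    then show "?p * w \<le> 0" using n by simp
  qed (simp add: w_def)
  then have "a * s - b \<le> 0" unfolding w_def le_zero_iff_zero_pprt by (simp add: antisym)
  then show "a * s \<le> b" by simp
qed (use lub_upper[OF assms(1)] assms(2) in \<open>auto intro: mult_left_mono\<close>)

section \<open>Order limits of increasing sequences\<close>

definition up_to :: "(nat \<Rightarrow> 'u::universally_complete_falgebra) \<Rightarrow> 'u \<Rightarrow> bool" where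
  "up_to f s \<longleftrightarrow> incseq f \<and> lub_in UNIV (range f) s"

lemma up_toI:
  "incseq f \<Longrightarrow> (\<And>n. f n \<le> s) \<Longrightarrow> (\<And>b. (\<And>n. f n \<le> b) \<Longrightarrow> s \<le> b) \<Longrightarrow> up_to f s"
  unfolding up_to_def by (auto intro!: lubI)

lemma up_to_upper: "up_to f s \<Longrightarrow> f n \<le> s"
  by (auto simp: up_to_def lub_in_def)

lemma up_to_least: "up_to f s \<Longrightarrow> (\<And>n. f n \<le> b) \<Longrightarrow> s \<le> b"
  by (auto simp: up_to_def lub_in_def)

lemma up_to_mono: "up_to f s \<Longrightarrow> m \<le> n \<Longrightarrow> f m \<le> f n"
  by (auto simp: up_to_def incseq_def)

lemma up_to_unique: "up_to f s \<Longrightarrow> up_to f t \<Longrightarrow> s = t"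
  by (meson up_to_def lub_unique)

lemma up_to_ex:
  "incseq f \<Longrightarrow> (\<And>n. f n \<le> b) \<Longrightarrow> \<exists>s. up_to f (s :: 'u::universally_complete_falgebra)"
  using lub_ex[of "range f" b] by (auto simp: up_to_def)

lemma up_to_const: "up_to (\<lambda>_. s) s"
  by (rule up_toI) (auto simp: incseq_def)

lemma up_to_add:
  assumes f: "up_to f s" and g: "up_to g t"
  shows "up_to (\<lambda>n. f n + g n) (s + t)"
proof (rule up_toI)
  show "incseq (\<lambda>n. f n + g n)" using f g by (auto simp: up_to_def incseq_def intro: add_mono)
  show "f n + g n \<le> s + t" for n using f g by (intro add_mono up_to_upper)
  fix b assume b: "\<And>n. f n + g n \<le> b"
  have "f m + g n \<le> b" for m n
    using add_mono[OF up_to_mono[OF f, of m "max m n"] up_to_mono[OF g, of n "max m n"]] b[of "max m n"]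
    by auto
  then have "g n \<le> b - f m" for m n by (simp add: algebra_simps)
  then have "t \<le> b - f m" for m by (rule up_to_least[OF g])
  then have "f m \<le> b - t" for m by (simp add: algebra_simps)
  then have "s \<le> b - t" by (rule up_to_least[OF f])
  then show "s + t \<le> b" by (simp add: algebra_simps)
qed

lemma up_to_add_const: "up_to f s \<Longrightarrow> up_to (\<lambda>n. f n + c) (s + c)"
  by (rule up_to_add[OF _ up_to_const])

lemma up_to_mult_const:
  assumes f: "up_to f s" and a: "0 \<le> a"
  shows "up_to (\<lambda>n. a * f n) (a * s)"
proof -
  have "incseq (\<lambda>n. a * f n)" using f a by (auto simp: up_to_def incseq_def intro: mult_left_mono)
  moreover have "lub_in UNIV (range (\<lambda>n. a * f n)) (a * s)"
    using lub_mult[of "range f" s a] f a by (simp add: up_to_def image_image)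
  ultimately show ?thesis by (simp add: up_to_def)
qed

lemma up_to_scaleR: "up_to f s \<Longrightarrow> 0 \<le> c \<Longrightarrow> up_to (\<lambda>n. c *\<^sub>R f n) (c *\<^sub>R s)"
  using up_to_mult_const[of f s "c *\<^sub>R 1"] by (simp add: scaleR_nonneg_nonneg)

lemma up_to_mult:
  assumes f: "up_to f s" and g: "up_to g t" and f0: "\<And>n. 0 \<le> f n" and g0: "\<And>n. 0 \<le> g n"
  shows "up_to (\<lambda>n. f n * g n) (s * t)"
proof (rule up_toI)
  have s0: "0 \<le> s" using order_trans[OF f0 up_to_upper[OF f]] .
  show "incseq (\<lambda>n. f n * g n)" using f g f0 g0 by (auto simp: up_to_def incseq_def intro!: mult_mono)
  show "f n * g n \<le> s * t" for n using up_to_upper[OF f] up_to_upper[OF g] s0 g0 by (intro mult_mono)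
  fix b assume b: "\<And>n. f n * g n \<le> b"
  have "f m * g n \<le> b" for m n
    using mult_mono[OF up_to_mono[OF f, of m "max m n"] up_to_mono[OF g, of n "max m n"] f0 g0] b[of "max m n"]
    by auto
  then have "f m * t \<le> b" for m by (rule up_to_least[OF up_to_mult_const[OF g f0]])
  then show "s * t \<le> b"
    using up_to_least[OF up_to_mult_const[OF f, of t]] order_trans[OF g0 up_to_upper[OF g]]
    by (simp add: mult.commute)
qed

lemma up_to_inf: "up_to f s \<Longrightarrow> up_to (\<lambda>n. inf y (f n)) (inf y s)"
  using lub_inf[of "range f" s y]
  by (auto simp: up_to_def incseq_def image_image intro: le_infI2)

declare diff_inf_eq_sup [simp del] diff_sup_eq_inf [simp del] neg_inf_eq_sup [simp del] neg_sup_eq_inf [simp del]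

lemma minus_inf_eq_pprt: "x - inf x y = pprt (x - y :: 'u::lattice_ab_group_add)"
  by (simp add: diff_inf_eq_sup add_sup_distrib_left pprt_def sup_commute)

text \<open>The unit exhausts \<open>x\<close> with a quantitative error:
  \<open>x - inf x n = (x - n)^+\<close> and \<open>n (x - n)^+ \<le> x^2\<close>.\<close>

lemma up_to_truncate:
  fixes x :: "'u::universally_complete_falgebra"
  assumes "0 \<le> x"
  shows "up_to (\<lambda>n. inf x (real n *\<^sub>R 1)) x"
proof (rule up_toI)
  show "incseq (\<lambda>n. inf x (real n *\<^sub>R 1))"
    by (auto simp: incseq_def intro!: le_infI2 scaleR_right_mono)
  fix b assume b: "\<And>n. inf x (real n *\<^sub>R 1) \<le> b"
  have "x - b \<le> 0"
  proof (rule scaleR_arch[of _ "x * x"])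
    fix n :: nat
    let ?p = "pprt (x - real n *\<^sub>R 1)"
    have "real n *\<^sub>R (x - b) \<le> real n *\<^sub>R ?p"
      using diff_left_mono[OF b[of n], of x]
      by (intro scaleR_left_mono) (simp_all only: minus_inf_eq_pprt of_nat_0_le_iff)
    also have "\<dots> = ?p * x - ?p * (x - real n *\<^sub>R 1)" by (simp add: right_diff_distrib)
    also have "\<dots> \<le> ?p * x" by (simp add: pprt_mult_self)
    also have "\<dots> \<le> x * x"
      using assms by (intro mult_right_mono pprt_le_self) (auto simp: scaleR_nonneg_nonneg)
    finally show "real n *\<^sub>R (x - b) \<le> x * x" .
  qed
  then show "x \<le> b" by simp
qed simp

section \<open>Components of the unit\<close>

lemma idempotent_lub:
  fixes q :: "'u::universally_complete_falgebra"
  assumes c: "up_to c q" and q: "0 \<le> q" "q \<le> 1"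
    and double: "\<And>n. inf 1 (2 *\<^sub>R c n) \<le> q"
  shows "q * q = q"
proof -
  have "inf 1 (2 *\<^sub>R q) \<le> q"
    using up_to_least[OF up_to_inf[OF up_to_scaleR[OF c, of 2]]] double by auto
  then have "inf 1 (2 *\<^sub>R q) - q \<le> 0" by simp
  \<comment> \<open>Subtracting \<open>q\<close> turns saturation under doubling into disjointness
    of \<open>q\<close> from its complement.\<close>
  moreover have "inf 1 (2 *\<^sub>R q) - q = inf (1 - q) q"
    using add_inf_distrib_right[of 1 "2 *\<^sub>R q" "- q"] by (simp add: scaleR_2)
  ultimately have "inf (1 - q) q = 0" using q by (simp add: antisym)
  then show ?thesis using disjoint_mult_zero[of "1 - q" q] by (simp add: left_diff_distrib)
qed

text \<open>In terms of functions, \<open>q\<close> is the indicator of the union of the sets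
  \<open>g n > 0\<close>. It is the supremum of \<open>c n = inf 1 (n (g n)^+)\<close>, where the
  one index \<open>n\<close> both raises the height and runs through \<open>g\<close>. The
  approximants are returned as well because each \<open>c n\<close> vanishes where its own
  \<open>g n\<close> is negative, which is what a Chebyshev estimate needs.\<close>

lemma component_seq:
  fixes g :: "nat \<Rightarrow> 'u::universally_complete_falgebra"
  assumes g: "incseq g"
  obtains q c where "up_to c q" "0 \<le> q" "q \<le> 1" "q * q = q" "\<And>n. (1 - q) * pprt (g n) = 0"
    "\<And>n. 0 \<le> c n" "\<And>n. c n \<le> 1" "\<And>n. c n * pprt (- g n) = 0"
proof -
  let ?c = "\<lambda>n. inf 1 (real n *\<^sub>R pprt (g n))"
  have mono: "real m *\<^sub>R pprt (g m) \<le> real n *\<^sub>R pprt (g n)" if "m \<le> n" for m n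
    using g that by (intro scaleR_mono pprt_mono) (auto simp: incseq_def)
  have inc: "incseq ?c"
    unfolding incseq_def
  proof (intro allI impI)
    fix m n :: nat assume "m \<le> n"
    show "?c m \<le> ?c n" by (rule inf_mono[OF order_refl mono[OF \<open>m \<le> n\<close>]])
  qed
  obtain q where q: "up_to ?c q" using up_to_ex[OF inc, of 1] by auto
  have c0: "0 \<le> ?c n" for n by (simp add: scaleR_nonneg_nonneg)
  have q0: "0 \<le> q" by (rule order_trans[OF c0 up_to_upper[OF q]])
  have q1: "q \<le> 1" by (rule up_to_least[OF q]) simp
  have id: "q * q = q"
  proof (rule idempotent_lub[OF q q0 q1])
    fix n
    have "2 *\<^sub>R ?c n \<le> 2 *\<^sub>R (real n *\<^sub>R pprt (g n))" by (intro scaleR_left_mono) auto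
    also have "\<dots> \<le> real (2 * n) *\<^sub>R pprt (g (2 * n))"
      using scaleR_left_mono[OF pprt_mono[OF incseqD[OF g, of n "2 * n"]], of "real (2 * n)"] by simp
    finally have "inf 1 (2 *\<^sub>R ?c n) \<le> ?c (2 * n)" by (intro inf_mono) auto
    then show "inf 1 (2 *\<^sub>R ?c n) \<le> q" using up_to_upper[OF q] by (rule order_trans)
  qed
  have disj: "inf (1 - q) q = 0" using q0 q1 id by (intro mult_zero_disjoint) (auto simp: left_diff_distrib)
  have 1: "(1 - q) * pprt (g n) = 0" for n
  proof (rule disjoint_mult_zero)
    have "inf (1 - q) (pprt (g n)) \<le> inf (1 - q) q"
    proof (rule le_infI)
      \<comment> \<open>The index \<open>Suc n\<close> is used because the coefficient
        \<open>n\<close> vanishes at \<open>n = 0\<close>.\<close>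
      have "pprt (g n) \<le> real (Suc n) *\<^sub>R pprt (g (Suc n))"
        using scaleR_mono[of 1 "real (Suc n)" "pprt (g n)" "pprt (g (Suc n))"]
          pprt_mono[OF incseqD[OF g, of n "Suc n"]] by simp
      then have "inf (1 - q) (pprt (g n)) \<le> ?c (Suc n)" using q0 by (intro inf_mono) auto
      also have "\<dots> \<le> q" by (rule up_to_upper[OF q])
      finally show "inf (1 - q) (pprt (g n)) \<le> q" .
    qed simp
    then show "inf (1 - q) (pprt (g n)) = 0" using disj q1 by (simp add: antisym)
  qed
  have 2: "?c n * pprt (- g n) = 0" for n
  proof (rule antisym)
    have "?c n * pprt (- g n) \<le> (real n *\<^sub>R pprt (g n)) * pprt (- g n)"
      by (intro mult_right_mono) auto
    then show "?c n * pprt (- g n) \<le> 0" by simp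
    show "0 \<le> ?c n * pprt (- g n)" by (rule mult_nonneg_nonneg[OF c0]) simp
  qed
  show ?thesis by (rule that[OF q q0 q1 id 1 c0 _ 2]) simp
qed

text \<open>A constant sequence yields the indicator of the region \<open>x > 0\<close>; that
  \<open>c n\<close> annihilates the negative part passes to the supremum \<open>q\<close>.\<close>

lemma component_ex:
  fixes x :: "'u::universally_complete_falgebra"
  obtains q where "0 \<le> q" "q \<le> 1" "q * q = q" "q * x = pprt x"
proof -
  obtain q c where q: "up_to c q" "0 \<le> q" "q \<le> 1" "q * q = q" "(1 - q) * pprt x = 0"
    "\<And>n. c n * pprt (- x) = 0"
    by (rule component_seq[of "\<lambda>_. x"]) (auto simp: incseq_def)
  have "up_to (\<lambda>n. pprt (- x) * c n) (pprt (- x) * q)" using q(1) by (rule up_to_mult_const) simp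
  then have "pprt (- x) * q \<le> 0" by (rule up_to_least) (simp add: q(6) mult.commute)
  then have 2: "q * pprt (- x) = 0" using q(2) by (simp add: antisym mult.commute)
  have "q * x = q * pprt x - q * pprt (- x)" by (simp only: pprt_minus_pprt flip: right_diff_distrib)
  also have "\<dots> = pprt x" using q(5) 2 by (simp add: left_diff_distrib)
  finally show ?thesis by (rule that[OF q(2-4)])
qed

section \<open>Squares as suprema of tangents\<close>

text \<open>Pointwise there are three cases: for \<open>u \<ge> d\<close> the third hypothesis is
  the claim, for \<open>0 \<le> u \<le> d\<close> it gives \<open>w \<le> d^2\<close>, and for
  \<open>u < 0\<close> the second one does. Without points, what \<open>w\<close> exceeds the
  claimed bound by is estimated by an element supported on \<open>u < 0\<close> and by one supported
  on \<open>u > 0\<close>; their infimum is \<open>0\<close>.\<close>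

lemma grid_step:
  fixes u w :: "'u::universally_complete_falgebra"
  assumes "0 \<le> d" "w \<le> (d * d) *\<^sub>R 1 + pprt u * pprt u" "w \<le> (u - d *\<^sub>R 1) * (u - d *\<^sub>R 1)"
  shows "w \<le> (d * d) *\<^sub>R 1 + pprt (u - d *\<^sub>R 1) * pprt (u - d *\<^sub>R 1)"
proof -
  let ?P = "pprt (u - d *\<^sub>R 1) * pprt (u - d *\<^sub>R 1)"
  let ?N = "pprt (- (u - d *\<^sub>R 1))"
  let ?v = "pprt (- u)"
  let ?m = "(2 * d) *\<^sub>R ?v + ?v * ?v"
  have d0: "0 \<le> d *\<^sub>R (1::'u)" using assms(1) by (simp add: scaleR_nonneg_nonneg)
  have "- u \<le> ?v" by (simp add: pprt_def)
  then have "- (u - d *\<^sub>R 1) \<le> d *\<^sub>R 1 + ?v"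
    using add_left_mono[of "- u" ?v "d *\<^sub>R 1"] by simp
  then have "?N \<le> d *\<^sub>R 1 + ?v"
    using d0 by (intro pprt_le_self add_nonneg_nonneg) simp_all
  then have "?N * ?N \<le> (d *\<^sub>R 1 + ?v) * (d *\<^sub>R 1 + ?v)"
    using d0 by (intro mult_mono) auto
  also have "\<dots> = (d * d) *\<^sub>R 1 + ?m" by (simp add: algebra_simps scaleR_2[symmetric])
  finally have "?P + ?N * ?N \<le> ?P + ((d * d) *\<^sub>R 1 + ?m)" by (rule add_left_mono)
  moreover have "w \<le> ?P + ?N * ?N" using assms(3) by (simp only: square_decomp[of "u - d *\<^sub>R 1"])
  ultimately have "w \<le> ?P + ((d * d) *\<^sub>R 1 + ?m)" by (rule order_trans[rotated])
  then have 1: "w - ?P - (d * d) *\<^sub>R 1 \<le> ?m" by (simp add: diff_le_eq ac_simps)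
  have "w \<le> ((d * d) *\<^sub>R 1 + pprt u * pprt u) + ?P" using assms(2) by (rule add_increasing2[rotated]) simp
  then have 2: "w - ?P - (d * d) *\<^sub>R 1 \<le> pprt u * pprt u" by (simp add: diff_le_eq ac_simps)
  have "inf ?m (pprt u * pprt u) = 0"
  proof (rule mult_zero_disjoint)
    have "?v * (pprt u * pprt u) = 0" by (metis mult.assoc mult.commute mult_zero_left pprt_mult_pprt_minus)
    then show "?m * (pprt u * pprt u) = 0" by (simp add: distrib_right mult.assoc)
  qed (use assms(1) in \<open>auto intro!: add_nonneg_nonneg scaleR_nonneg_nonneg\<close>)
  with le_infI[OF 1 2] have "w - ?P - (d * d) *\<^sub>R 1 \<le> 0" by simp
  then show ?thesis by (simp add: diff_le_eq ac_simps)
qed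

text \<open>The infimum over \<open>t\<close> of \<open>(y - t)^2\<close> is \<open>0\<close>, since
  every value of \<open>y\<close> lies near some grid point. The grid
  \<open>- c, - c + d, ...\<close> is swept from left to right, the induction recording that
  \<open>w \<le> d^2\<close> up to the part of \<open>y\<close> not yet passed.\<close>

lemma inf_square_shift_le_zero:
  fixes y w :: "'u::universally_complete_falgebra"
  assumes y: "\<bar>y\<bar> \<le> c *\<^sub>R 1" and w: "\<And>t. w \<le> (y - t *\<^sub>R 1) * (y - t *\<^sub>R 1)"
  shows "w \<le> 0"
proof (rule le_eps_arch[of _ 1])
  fix \<epsilon> :: real assume "0 < \<epsilon>"
  define d where "d = sqrt \<epsilon>"
  have d: "0 < d" "d * d = \<epsilon>" using \<open>0 < \<epsilon>\<close> by (auto simp: d_def)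
  have y12: "y \<le> c *\<^sub>R 1" "- y \<le> c *\<^sub>R 1" using y by (auto simp: abs_le_iff)
  have "w \<le> (d * d) *\<^sub>R 1 + pprt (y + (c - real n * d) *\<^sub>R 1) * pprt (y + (c - real n * d) *\<^sub>R 1)" for n
  proof (induction n)
    case 0
    have "w \<le> (y + c *\<^sub>R 1) * (y + c *\<^sub>R 1)" using w[of "- c"] by simp
    moreover have "0 \<le> y + c *\<^sub>R 1" using add_left_mono[OF y12(2), of y] by simp
    moreover have "0 \<le> (d * d) *\<^sub>R (1::'u)" by (simp add: scaleR_nonneg_nonneg)
    ultimately show ?case by (simp add: add_increasing)
  next
    case (Suc n)
    have "y + (c - real n * d) *\<^sub>R 1 - d *\<^sub>R 1 = y + (c - real (Suc n) * d) *\<^sub>R 1"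
      by (simp add: algebra_simps)
    moreover have "w \<le> (y + (c - real (Suc n) * d) *\<^sub>R 1) * (y + (c - real (Suc n) * d) *\<^sub>R 1)"
    proof -
      have "y - (real (Suc n) * d - c) *\<^sub>R 1 = y + (c - real (Suc n) * d) *\<^sub>R 1"
        by (simp add: algebra_simps)
      then show ?thesis using w[of "real (Suc n) * d - c"] by (simp only:)
    qed
    ultimately show ?case using grid_step[OF _ Suc] d(1) by (metis less_imp_le)
  qed
  \<comment> \<open>After \<open>2 c / d\<close> steps the grid has passed \<open>c\<close>, so no
    part of \<open>y\<close> is left and only the error \<open>d^2 = \<epsilon>\<close>
    remains.\<close>
  moreover obtain n :: nat where "2 * c / d \<le> real n" using real_arch_simple by blast
  then have "c + (c - real n * d) \<le> 0" using d(1) by (simp add: field_simps)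
  then have "pprt (y + (c - real n * d) *\<^sub>R 1) = 0"
  proof -
    have "y + (c - real n * d) *\<^sub>R 1 \<le> (c + (c - real n * d)) *\<^sub>R 1"
      by (simp only: scaleR_left_distrib[of c] add_right_mono[OF y12(1)])
    also have "\<dots> \<le> 0" using \<open>c + (c - real n * d) \<le> 0\<close> by (simp add: scaleR_nonpos_nonneg)
    finally show ?thesis by simp
  qed
  ultimately show "w \<le> \<epsilon> *\<^sub>R 1" using d by (metis add.right_neutral mult_zero_left)
qed

text \<open>Completing the square rewrites the hypothesis as \<open>y^2 - z \<le> (y - t)^2\<close>
  for all \<open>t\<close>.\<close>

lemma square_le_if_tangents_le:
  fixes y z :: "'u::universally_complete_falgebra"
  assumes "\<bar>y\<bar> \<le> c *\<^sub>R 1" "\<And>t. (2 * t) *\<^sub>R y - (t * t) *\<^sub>R 1 \<le> z"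
  shows "y * y \<le> z"
proof -
  have "y * y - z \<le> 0"
  proof (rule inf_square_shift_le_zero[OF assms(1)])
    fix t
    show "y * y - z \<le> (y - t *\<^sub>R 1) * (y - t *\<^sub>R 1)"
      using assms(2)[of t] by (simp add: algebra_simps scaleR_2 scaleR_left_distrib flip: scaleR_scaleR)
  qed
  then show ?thesis by simp
qed

text \<open>The idempotents \<open>p k = Q k - Q (Suc k)\<close> cut the space into disjoint pieces,
  on each of which the sequence has a supremum \<open>z k\<close>. Lateral completeness bounds all
  the \<open>z k\<close> by one \<open>s\<close>. Then \<open>(1 - Q k) f n \<le> s\<close> for all
  \<open>k\<close>, and \<open>1 - Q k\<close> increases to \<open>1\<close> because the
  \<open>Q k\<close> decrease to \<open>0\<close>.\<close>

lemma bounded_if_locally_bounded: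
  fixes f Q :: "nat \<Rightarrow> 'u::universally_complete_falgebra"
  assumes f0: "\<And>n. 0 \<le> f n" and finc: "incseq f"
    and Q0: "Q 0 = 1" and idem: "\<And>k. Q k * Q k = Q k" and dec: "\<And>k. Q (Suc k) * Q k = Q (Suc k)"
    and inf0: "\<And>w. (\<And>k. w \<le> Q k) \<Longrightarrow> w \<le> 0"
    and bnd: "\<And>k. \<exists>b. \<forall>n. (1 - Q k) * f n \<le> b"
  shows "\<exists>b. \<forall>n. f n \<le> b"
proof -
  define p where "p k = Q k - Q (Suc k)" for k
  have QQ: "Q k * Q j = Q k" if "j \<le> k" for j k
    using that
  proof (induction k rule: dec_induct)
    case (step k)
    then show ?case by (metis dec mult.assoc)
  qed (simp add: idem)
  have pp: "p k * p k = p k" for k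
    using dec[of k] mult.commute[of "Q k" "Q (Suc k)"] idem
    by (simp add: p_def left_diff_distrib right_diff_distrib)
  have pj: "p k * p j = 0" if "j < k" for j k
    using QQ[of j k] QQ[of j "Suc k"] QQ[of "Suc j" k] QQ[of "Suc j" "Suc k"] that
    by (simp add: p_def left_diff_distrib right_diff_distrib)
  have p0: "0 \<le> p k" for k using pp[of k] square_nonneg[of "p k"] by simp
  have pQ: "p k * (1 - Q (Suc k)) = p k" for k
    using dec[of k] mult.commute[of "Q k" "Q (Suc k)"] idem
    by (simp add: p_def left_diff_distrib right_diff_distrib)
  have "\<exists>z. up_to (\<lambda>n. p k * f n) z" for k
  proof -
    obtain b where b: "\<And>n. (1 - Q (Suc k)) * f n \<le> b" using bnd by blast
    have "p k * f n \<le> p k * b" for n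
      using mult_left_mono[OF b p0, of k n] by (simp add: pQ flip: mult.assoc)
    moreover have "incseq (\<lambda>n. p k * f n)" using finc p0 by (auto simp: incseq_def intro: mult_left_mono)
    ultimately show ?thesis using up_to_ex by blast
  qed
  then obtain z where z: "\<And>k. up_to (\<lambda>n. p k * f n) (z k)" by metis
  have z0: "0 \<le> z k" for k using up_to_upper[OF z, of k 0] f0 p0 by (meson mult_nonneg_nonneg order_trans)
  have pz: "p k * z k = z k" for k
  proof (rule up_to_unique[OF _ z])
    show "up_to (\<lambda>n. p k * f n) (p k * z k)"
      using up_to_mult_const[OF z p0, of k k] by (simp only: pp flip: mult.assoc)
  qed
  have disj: "inf (z k) (z j) = 0" if "j \<noteq> k" for j k
  proof (rule mult_zero_disjoint[OF z0 z0])
    have "z k * z j = (p k * p j) * (z k * z j)" by (metis pz mult.assoc mult.left_commute)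
    then show "z k * z j = 0" using that pj by (metis linorder_neqE_nat mult.commute mult_zero_left)
  qed
  have "\<exists>s. (\<forall>x\<in>range z. x \<le> s) \<and> (\<forall>b. (\<forall>x\<in>range z. x \<le> b) \<longrightarrow> s \<le> b)"
  proof (rule laterally_complete)
    show "inf x y = 0" if "x \<in> range z" "y \<in> range z" "x \<noteq> y" for x y
      using that disj by (metis rangeE)
  qed (use z0 in auto)
  then obtain s where s: "\<And>k. z k \<le> s" by auto
  have s0: "0 \<le> s" using z0 s order_trans by blast
  \<comment> \<open>The pieces telescope: \<open>1 - Q (Suc k) = (1 - Q k) + p k\<close>.\<close>
  have "(1 - Q k) * f n \<le> (1 - Q k) * s" for k n
  proof (induction k)
    case (Suc k)
    have "p k * f n \<le> p k * s"
      using up_to_upper[OF z, of k n] s[of k] pz[of k] p0[of k] by (metis mult.assoc mult_left_mono order_trans pp)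
    with Suc have "(1 - Q k) * f n + p k * f n \<le> (1 - Q k) * s + p k * s" by (rule add_mono)
    then show ?case by (simp add: p_def flip: distrib_right)
  qed (simp add: Q0)
  moreover have "(1 - Q k) * s \<le> s" for k using square_nonneg[of "Q k"] s0 by (simp add: idem left_diff_distrib)
  ultimately have le: "f n * (1 - Q k) \<le> s" for k n by (metis mult.commute order_trans)
  have "Q (Suc k) \<le> Q k" for k using p0[of k] by (simp add: p_def)
  then have "incseq (\<lambda>k. 1 - Q k)" by (intro incseq_SucI) simp
  then have "up_to (\<lambda>k. 1 - Q k) 1"
  proof (rule up_toI)
    show "1 - Q k \<le> 1" for k using square_nonneg[of "Q k"] by (simp add: idem)
    fix b assume "\<And>k. 1 - Q k \<le> b"
    then have "1 - b \<le> 0" by (intro inf0) (simp add: algebra_simps)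
    then show "1 \<le> b" by simp
  qed
  then have "f n \<le> s" for n using up_to_least[OF up_to_mult_const[OF _ f0] le] by force
  then show ?thesis by blast
qed

section \<open>The extension of a conditional expectation\<close>

lemma riesz_decomposition:
  fixes x f g :: "'u::lattice_ab_group_add"
  assumes "0 \<le> x" "x \<le> f + g" "0 \<le> f" "0 \<le> g"
  shows "0 \<le> x - inf x f" "x - inf x f \<le> g"
proof -
  show "0 \<le> x - inf x f" by simp
  show "x - inf x f \<le> g"
    using assms by (simp add: minus_inf_eq_pprt pprt_le_self diff_le_eq add.commute)
qed

locale cond_exp =
  fixes E :: "'u::universally_complete_falgebra set" and T :: "'u \<Rightarrow> 'u"
  assumes cond_exp: "conditional_expectation E T"
begin

lemma
  shows E_subspace: "subspace E"
    and E_sup: "x \<in> E \<Longrightarrow> y \<in> E \<Longrightarrow> sup x y \<in> E"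
    and E_inf: "x \<in> E \<Longrightarrow> y \<in> E \<Longrightarrow> inf x y \<in> E"
    and E_dense: "0 < u \<Longrightarrow> \<exists>x\<in>E. 0 < x \<and> x \<le> u"
    and E_complete: "dedekind_complete_on E"
    and E_one: "1 \<in> E"
    and T_E: "x \<in> E \<Longrightarrow> T x \<in> E"
    and T_add: "x \<in> E \<Longrightarrow> y \<in> E \<Longrightarrow> T (x + y) = T x + T y"
    and T_scaleR: "x \<in> E \<Longrightarrow> T (c *\<^sub>R x) = c *\<^sub>R T x"
    and T_nonneg: "x \<in> E \<Longrightarrow> 0 \<le> x \<Longrightarrow> 0 \<le> T x"
    and T_order_continuous: "D \<subseteq> E \<Longrightarrow> down_directed D \<Longrightarrow> glb_in E D 0 \<Longrightarrow> glb_in E (T ` D) 0"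
    and T_idem: "x \<in> E \<Longrightarrow> T (T x) = T x"
    and T_one: "T 1 = 1"
    and T_strict: "x \<in> E \<Longrightarrow> 0 \<le> x \<Longrightarrow> T x = 0 \<Longrightarrow> x = 0"
proof -
  note c = cond_exp[unfolded conditional_expectation_def riesz_subspace_def weak_order_unit_on_def]
  show "subspace E" using c by (elim conjE)
  show "dedekind_complete_on E" using c by (elim conjE)
  show "1 \<in> E" using c by (elim conjE)
  show "T 1 = 1" using c by (elim conjE)
  have "\<forall>x\<in>E. \<forall>y\<in>E. sup x y \<in> E \<and> inf x y \<in> E" using c by (elim conjE)
  then show "x \<in> E \<Longrightarrow> y \<in> E \<Longrightarrow> sup x y \<in> E" "x \<in> E \<Longrightarrow> y \<in> E \<Longrightarrow> inf x y \<in> E" by auto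
  have "order_dense E" using c by (elim conjE)
  then show "0 < u \<Longrightarrow> \<exists>x\<in>E. 0 < x \<and> x \<le> u" by (simp add: order_dense_def)
  have "T \<in> E \<rightarrow> E" using c by (elim conjE)
  then show "x \<in> E \<Longrightarrow> T x \<in> E" by (rule funcset_mem)
  have "\<forall>x\<in>E. T (T x) = T x" using c by (elim conjE)
  then show "x \<in> E \<Longrightarrow> T (T x) = T x" by simp
  have "\<forall>x\<in>E. \<forall>y\<in>E. T (x + y) = T x + T y" using c by (elim conjE)
  then show "x \<in> E \<Longrightarrow> y \<in> E \<Longrightarrow> T (x + y) = T x + T y" by simp
  have "\<forall>c. \<forall>x\<in>E. T (c *\<^sub>R x) = c *\<^sub>R T x" using c by (elim conjE)
  then show "x \<in> E \<Longrightarrow> T (c *\<^sub>R x) = c *\<^sub>R T x" by simp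
  have "\<forall>x\<in>E. 0 \<le> x \<longrightarrow> 0 \<le> T x" using c by (elim conjE)
  then show "x \<in> E \<Longrightarrow> 0 \<le> x \<Longrightarrow> 0 \<le> T x" by simp
  have "\<forall>D. D \<subseteq> E \<longrightarrow> down_directed D \<longrightarrow> glb_in E D 0 \<longrightarrow> glb_in E (T ` D) 0"
    using c by (elim conjE)
  then show "D \<subseteq> E \<Longrightarrow> down_directed D \<Longrightarrow> glb_in E D 0 \<Longrightarrow> glb_in E (T ` D) 0" by simp
  have "\<forall>x\<in>E. 0 \<le> x \<longrightarrow> T x = 0 \<longrightarrow> x = 0" using c by (elim conjE)
  then show "x \<in> E \<Longrightarrow> 0 \<le> x \<Longrightarrow> T x = 0 \<Longrightarrow> x = 0" by blast
qed

lemmas E_add = subspace_add[OF E_subspace]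
  and E_diff = subspace_diff[OF E_subspace]
  and E_zero = subspace_0[OF E_subspace]
  and E_scaleR = subspace_scale[OF E_subspace]

lemma T_diff: "x \<in> E \<Longrightarrow> y \<in> E \<Longrightarrow> T (x - y) = T x - T y"
  using T_add[of "x - y" y] E_diff[of x y] by (simp add: algebra_simps)

lemma T_mono: "x \<in> E \<Longrightarrow> y \<in> E \<Longrightarrow> x \<le> y \<Longrightarrow> T x \<le> T y"
  using T_nonneg[of "y - x"] by (simp add: E_diff T_diff)

text \<open>For \<open>f \<ge> 0\<close> this is the canonical net for \<open>f\<close>: it is
  directed and contains every set \<open>D\<close> with \<open>dom_net E T D f\<close>.\<close>

definition below :: "'u \<Rightarrow> 'u set" where
  "below f = {x \<in> E. 0 \<le> x \<and> x \<le> f}"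

text \<open>If \<open>b\<close> bounds \<open>below f\<close> but not \<open>f\<close>, order
  density puts some \<open>z > 0\<close> of \<open>E\<close> under \<open>f - inf f b\<close>. Each
  multiple of \<open>z\<close> in \<open>below f\<close> lies under \<open>inf f b\<close>, so the
  next multiple is again in \<open>below f\<close>; this contradicts the Archimedean
  property.\<close>

lemma lub_below:
  assumes "0 \<le> f"
  shows "lub_in UNIV (below f) f"
proof (rule lubI)
  fix b assume b: "\<And>x. x \<in> below f \<Longrightarrow> x \<le> b"
  show "f \<le> b"
  proof (rule ccontr)
    assume "\<not> f \<le> b"
    then have "0 < f - inf f b" by (metis diff_gt_0_iff_gt inf.absorb_iff1 inf_le1 order_le_less)
    then obtain z where z: "z \<in> E" "0 < z" "z \<le> f - inf f b" using E_dense by blast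
    have "real n *\<^sub>R z \<in> below f" for n
    proof (induction n)
      case 0
      then show ?case using assms by (simp add: below_def E_zero)
    next
      case (Suc n)
      then have "real n *\<^sub>R z \<le> inf f b" using b by (auto simp: below_def)
      then have "real n *\<^sub>R z + z \<le> inf f b + (f - inf f b)" using z(3) by (rule add_mono)
      moreover have "real (Suc n) *\<^sub>R z = real n *\<^sub>R z + z" by (simp add: algebra_simps)
      moreover have "inf f b + (f - inf f b) = f" by (simp only: add_diff_cancel_left' add_diff_eq)
      moreover have "0 \<le> real n *\<^sub>R z + z" using z(2) by (simp add: scaleR_nonneg_nonneg)
      ultimately show ?case using Suc z(1) by (simp add: below_def E_add)
    qed
    then have "z \<le> 0" by (intro scaleR_arch[of z f]) (auto simp: below_def)
    with z(2) show False by simp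
  qed
qed (simp add: below_def)

text \<open>A Dedekind complete order dense subspace is an ideal. The supremum \<open>s\<close> of
  \<open>below u\<close> taken inside \<open>E\<close> is at least \<open>u\<close>; if it were
  larger, an element of \<open>E\<close> below \<open>s - u\<close> could be subtracted from
  it.\<close>

lemma E_ideal_nonneg:
  assumes "x \<in> E" "0 \<le> u" "u \<le> x"
  shows "u \<in> E"
proof -
  have "below u \<subseteq> E" "below u \<noteq> {}" "\<forall>y\<in>below u. y \<le> x"
    using assms E_zero by (auto simp: below_def)
  then obtain s where s: "lub_in E (below u) s"
    using E_complete assms(1) unfolding dedekind_complete_on_def by blast
  then have sE: "s \<in> E" and us: "u \<le> s"
    using lub_least[OF lub_below[OF assms(2)]] by (auto simp: lub_in_def)
  have "\<not> u < s"
  proof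
    assume "u < s"
    then obtain z where z: "z \<in> E" "0 < z" "z \<le> s - u" using E_dense[of "s - u"] by auto
    then have "u \<le> s - z" by (simp add: algebra_simps)
    then have "\<forall>y\<in>below u. y \<le> s - z" by (auto simp: below_def)
    then have "s \<le> s - z" using s sE z(1) E_diff[of s z] by (simp add: lub_in_def)
    with z(2) show False by simp
  qed
  then have "u = s" using us by (simp add: order_le_less)
  then show ?thesis using sE by simp
qed

lemma E_bounded: "0 \<le> u \<Longrightarrow> u \<le> r *\<^sub>R 1 \<Longrightarrow> u \<in> E"
  using E_ideal_nonneg[OF E_scaleR[OF E_one]] by blast

text \<open>Order continuity of \<open>T\<close> concerns nets in \<open>E\<close>, while
  \<open>D\<close> may leave \<open>E\<close>. The net \<open>x - inf x d\<close> stays in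
  \<open>E\<close> and decreases to \<open>0\<close>, and \<open>(T x - b)^+\<close> lies below all
  its images.\<close>

lemma T_le_directed:
  assumes x: "x \<in> E" "0 \<le> x" and D: "up_directed D" "\<And>d. d \<in> D \<Longrightarrow> 0 \<le> d"
    and f: "lub_in UNIV D f" "x \<le> f" and b: "\<And>d. d \<in> D \<Longrightarrow> T (inf x d) \<le> b"
  shows "T x \<le> b"
proof -
  let ?G = "(\<lambda>d. x - inf x d) ` D"
  have infE: "inf x d \<in> E" if "d \<in> D" for d using x D(2)[OF that] by (intro E_ideal_nonneg[OF x(1)]) auto
  have GE: "?G \<subseteq> E" using infE x by (auto intro: E_diff)
  have lub: "lub_in UNIV (inf x ` D) x" using lub_inf[OF f(1), of x] f(2) by (simp add: inf_absorb1)
  have "down_directed ?G"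
    unfolding down_directed_def
  proof (intro conjI ballI)
    show "?G \<noteq> {}" using D(1) by (auto simp: up_directed_def)
    fix p q assume "p \<in> ?G" "q \<in> ?G"
    then obtain d e where de: "d \<in> D" "e \<in> D" "p = x - inf x d" "q = x - inf x e" by blast
    obtain c where c: "c \<in> D" "d \<le> c" "e \<le> c" using D(1) de by (auto simp: up_directed_def)
    then have "x - inf x c \<le> p" "x - inf x c \<le> q"
      unfolding de by (auto intro!: diff_left_mono le_infI2)
    then show "\<exists>z\<in>?G. z \<le> p \<and> z \<le> q" using c by blast
  qed
  moreover have "glb_in E ?G 0"
    unfolding glb_in_def
  proof (intro conjI ballI impI)
    fix w assume "\<forall>g\<in>?G. w \<le> g"
    then have "x \<le> x - w" by (intro lub_least[OF lub]) (auto simp: algebra_simps)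
    then show "w \<le> 0" by simp
  qed (use E_zero in auto)
  ultimately have glb: "glb_in E (T ` ?G) 0" using GE T_order_continuous by blast
  let ?w = "pprt (T x - b)"
  have w: "?w \<le> T (x - inf x d)" if "d \<in> D" for d
    using b[OF that] infE[OF that] x T_nonneg[of "x - inf x d"]
    by (intro pprt_le_self) (auto simp: T_diff E_diff)
  obtain d where "d \<in> D" using D(1) by (auto simp: up_directed_def)
  \<comment> \<open>The infimum of the images is known relative to \<open>E\<close> only, so
    \<open>?w\<close> has to be placed in \<open>E\<close> before it can be compared.\<close>
  then have "T (x - inf x d) \<in> E" using infE x by (intro T_E E_diff) auto
  then have "?w \<in> E" by (rule E_ideal_nonneg) (use w[OF \<open>d \<in> D\<close>] in simp_all)
  then have "?w \<le> 0" using glb w by (auto simp: glb_in_def)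
  then show ?thesis by (simp add: pprt_def)
qed

lemma up_directed_below: "0 \<le> f \<Longrightarrow> up_directed (below f)"
  unfolding up_directed_def
proof (intro conjI ballI)
  assume "0 \<le> f"
  then show "below f \<noteq> {}" by (auto simp: below_def E_zero)
  fix x y assume "x \<in> below f" "y \<in> below f"
  then have "sup x y \<in> below f" by (auto simp: below_def E_sup intro: le_supI1)
  then show "\<exists>z\<in>below f. x \<le> z \<and> y \<le> z" by (intro bexI[of _ "sup x y"]) auto
qed

abbreviation "P \<equiv> L1_pos E T"

text \<open>Any admissible net dominates the canonical one in expectation; with the inclusion in
  \<open>below f\<close> this makes \<open>ext_pos\<close> independent of the net.\<close>

lemma dom_net_le:
  assumes "dom_net E T D f" "x \<in> below f" "\<And>d. d \<in> D \<Longrightarrow> T d \<le> b"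
  shows "T x \<le> b"
proof (rule T_le_directed)
  fix d assume d: "d \<in> D"
  then have "T (inf x d) \<le> T d"
    using assms by (intro T_mono E_inf) (auto simp: dom_net_def below_def)
  then show "T (inf x d) \<le> b" using assms(3)[OF d] by simp
qed (use assms in \<open>auto simp: dom_net_def below_def\<close>)

text \<open>The existential over nets reduces to the canonical net.\<close>

lemma P_iff: "f \<in> P \<longleftrightarrow> 0 \<le> f \<and> bdd_above (T ` below f)"
proof
  assume f: "f \<in> P"
  then obtain D where D: "dom_net E T D f" by (auto simp: L1_pos_def)
  then obtain b where "\<And>d. d \<in> D \<Longrightarrow> T d \<le> b" by (auto simp: dom_net_def bdd_above_def)
  then have "bdd_above (T ` below f)" using dom_net_le[OF D] by (auto simp: bdd_above_def)
  with f show "0 \<le> f \<and> bdd_above (T ` below f)" by (simp add: L1_pos_def)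
next
  assume "0 \<le> f \<and> bdd_above (T ` below f)"
  then have "dom_net E T (below f) f"
    using lub_below up_directed_below by (auto simp: dom_net_def below_def)
  with \<open>0 \<le> f \<and> _\<close> show "f \<in> P" by (auto simp: L1_pos_def)
qed

lemma P_nonneg: "f \<in> P \<Longrightarrow> 0 \<le> f"
  by (simp add: P_iff)

lemma PI: "0 \<le> f \<Longrightarrow> (\<And>x. x \<in> below f \<Longrightarrow> T x \<le> b) \<Longrightarrow> f \<in> P"
  by (auto simp: P_iff bdd_above_def)

lemma ext_pos_lub:
  assumes f: "f \<in> P"
  shows "lub_in UNIV (T ` below f) (ext_pos E T f)"
proof -
  have dom: "dom_net E T (below f) f"
    using f lub_below up_directed_below by (auto simp: dom_net_def below_def P_iff)
  have "below f \<noteq> {}" using f by (auto simp: below_def P_iff E_zero)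
  then obtain t where t: "lub_in UNIV (T ` below f) t"
    using f lub_ex[of "T ` below f"] by (auto simp: P_iff bdd_above_def)
  have "ext_pos E T f = t"
    unfolding ext_pos_def
  proof (rule the_equality)
    show "\<exists>D. dom_net E T D f \<and> lub_in UNIV (T ` D) t" using dom t by blast
    fix s assume "\<exists>D. dom_net E T D f \<and> lub_in UNIV (T ` D) s"
    then obtain D where D: "dom_net E T D f" and s: "lub_in UNIV (T ` D) s" by blast
    show "s = t"
    proof (rule antisym)
      have "D \<subseteq> below f" using D by (auto simp: dom_net_def below_def lub_in_def)
      then show "s \<le> t" using lub_least[OF s] lub_upper[OF t] by blast
      have "T x \<le> s" if "x \<in> below f" for x
        using dom_net_le[OF D that] lub_upper[OF s] by blast
      then show "t \<le> s" using lub_least[OF t] by blast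
    qed
  qed
  then show ?thesis using t by simp
qed

lemma ext_pos_upper: "f \<in> P \<Longrightarrow> x \<in> E \<Longrightarrow> 0 \<le> x \<Longrightarrow> x \<le> f \<Longrightarrow> T x \<le> ext_pos E T f"
  using lub_upper[OF ext_pos_lub, of f "T x"] by (auto simp: below_def)

lemma ext_pos_least:
  "f \<in> P \<Longrightarrow> (\<And>x. x \<in> E \<Longrightarrow> 0 \<le> x \<Longrightarrow> x \<le> f \<Longrightarrow> T x \<le> b) \<Longrightarrow> ext_pos E T f \<le> b"
  by (rule lub_least[OF ext_pos_lub]) (auto simp: below_def)

lemma P_ideal: "f \<in> P \<Longrightarrow> 0 \<le> g \<Longrightarrow> g \<le> f \<Longrightarrow> g \<in> P"
  by (rule PI[of _ "ext_pos E T f"]) (auto simp: below_def intro!: ext_pos_upper elim: order_trans)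

lemma P_E: "x \<in> E \<Longrightarrow> 0 \<le> x \<Longrightarrow> x \<in> P"
  by (rule PI[of _ "T x"]) (auto simp: below_def intro: T_mono)

lemma ext_pos_E: "x \<in> E \<Longrightarrow> 0 \<le> x \<Longrightarrow> ext_pos E T x = T x"
  using P_E[of x] T_mono[of _ x] by (auto intro!: antisym ext_pos_least ext_pos_upper)

lemma ext_pos_nonneg: "f \<in> P \<Longrightarrow> 0 \<le> ext_pos E T f"
  using ext_pos_upper[of f 0] T_diff[OF E_zero E_zero] E_zero P_nonneg by simp

lemma T_below_add_le:
  assumes "x \<in> below (f + g)" "f \<in> P" "g \<in> P"
  shows "T x \<le> ext_pos E T f + ext_pos E T g"
proof -
  have x: "x \<in> E" "0 \<le> x" "x \<le> f + g" using assms(1) by (auto simp: below_def)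
  have i: "inf x f \<in> E" "0 \<le> inf x f"
    using E_ideal_nonneg[OF x(1), of "inf x f"] x P_nonneg[OF assms(2)] by auto
  have d: "x - inf x f \<in> E" "0 \<le> x - inf x f" "x - inf x f \<le> g"
    using riesz_decomposition[OF x(2,3) P_nonneg[OF assms(2)] P_nonneg[OF assms(3)]] E_diff[OF x(1) i(1)]
    by auto
  have "T x = T (inf x f) + T (x - inf x f)" using T_add[OF i(1) d(1)] by simp
  also have "\<dots> \<le> ext_pos E T f + ext_pos E T g"
    using i d assms by (intro add_mono ext_pos_upper) auto
  finally show ?thesis .
qed

lemma P_add: "f \<in> P \<Longrightarrow> g \<in> P \<Longrightarrow> f + g \<in> P"
  using T_below_add_le P_nonneg by (intro PI[of _ "ext_pos E T f + ext_pos E T g"]) auto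

lemma ext_pos_add:
  assumes f: "f \<in> P" and g: "g \<in> P"
  shows "ext_pos E T (f + g) = ext_pos E T f + ext_pos E T g"
proof (rule antisym)
  note fg = P_add[OF f g]
  show "ext_pos E T (f + g) \<le> ext_pos E T f + ext_pos E T g"
    using T_below_add_le f g by (intro ext_pos_least[OF fg]) (auto simp: below_def)
  have "ext_pos E T f \<le> ext_pos E T (f + g) - T y" if y: "y \<in> E" "0 \<le> y" "y \<le> g" for y
  proof (rule ext_pos_least[OF f])
    fix x assume x: "x \<in> E" "0 \<le> x" "x \<le> f"
    then have "T (x + y) \<le> ext_pos E T (f + g)"
      using y by (intro ext_pos_upper[OF fg]) (auto intro: E_add add_mono)
    then show "T x \<le> ext_pos E T (f + g) - T y" using x y by (simp add: T_add algebra_simps)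
  qed
  then have "ext_pos E T g \<le> ext_pos E T (f + g) - ext_pos E T f"
    by (intro ext_pos_least[OF g]) (simp add: algebra_simps)
  then show "ext_pos E T f + ext_pos E T g \<le> ext_pos E T (f + g)" by (simp add: algebra_simps)
qed

lemma P_scaleR: "f \<in> P \<Longrightarrow> 0 \<le> c \<Longrightarrow> c *\<^sub>R f \<in> P"
  and ext_pos_scaleR: "f \<in> P \<Longrightarrow> 0 \<le> c \<Longrightarrow> ext_pos E T (c *\<^sub>R f) = c *\<^sub>R ext_pos E T f"
proof -
  have le: "T x \<le> c *\<^sub>R ext_pos E T f" if "f \<in> P" "0 < c" "x \<in> E" "0 \<le> x" "x \<le> c *\<^sub>R f" for x c f
  proof -
    have "(1/c) *\<^sub>R x \<le> (1/c) *\<^sub>R c *\<^sub>R f" using that by (intro scaleR_left_mono) auto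
    then have "T ((1/c) *\<^sub>R x) \<le> ext_pos E T f"
      using that by (intro ext_pos_upper E_scaleR scaleR_nonneg_nonneg) auto
    then have "c *\<^sub>R T ((1/c) *\<^sub>R x) \<le> c *\<^sub>R ext_pos E T f" using that by (intro scaleR_left_mono) auto
    then show ?thesis using that by (simp add: T_scaleR)
  qed
  have P: "c *\<^sub>R f \<in> P" if "f \<in> P" "0 < c" for c f
    using le[OF that] P_nonneg[OF that(1)] that(2)
    by (intro PI[of _ "c *\<^sub>R ext_pos E T f"]) (auto simp: below_def scaleR_nonneg_nonneg)
  have le2: "ext_pos E T (c *\<^sub>R f) \<le> c *\<^sub>R ext_pos E T f" if "f \<in> P" "0 < c" for c f
    using le[OF that] by (intro ext_pos_least P that) auto
  show "f \<in> P \<Longrightarrow> 0 \<le> c \<Longrightarrow> c *\<^sub>R f \<in> P"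
    using P P_E[OF E_zero] by (cases "c = 0") auto
  assume f: "f \<in> P" and c: "0 \<le> c"
  show "ext_pos E T (c *\<^sub>R f) = c *\<^sub>R ext_pos E T f"
  proof (cases "c = 0")
    case True
    then show ?thesis using ext_pos_E[OF E_zero] T_diff[OF E_zero E_zero] by simp
  next
    case False
    then have c: "0 < c" using c by simp
    have "ext_pos E T f \<le> (1/c) *\<^sub>R ext_pos E T (c *\<^sub>R f)"
      using le2[OF P[OF f c], of "1/c"] c by simp
    then have "c *\<^sub>R ext_pos E T f \<le> c *\<^sub>R (1/c) *\<^sub>R ext_pos E T (c *\<^sub>R f)" using c by (intro scaleR_left_mono) auto
    then show ?thesis using le2[OF f c] c by (simp add: antisym)
  qed
qed

abbreviation "L \<equiv> L1 E T"
abbreviation "\<tau> \<equiv> ext E T"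

text \<open>Two decompositions satisfy \<open>f + g' = f' + g\<close>, so additivity on the cone
  makes the value independent of the choice.\<close>

lemma ext_eq:
  assumes "f \<in> P" "g \<in> P"
  shows "\<tau> (f - g) = ext_pos E T f - ext_pos E T g"
  unfolding ext_def
proof (rule the_equality)
  show "\<exists>f'\<in>P. \<exists>g'\<in>P. f - g = f' - g' \<and>
      ext_pos E T f - ext_pos E T g = ext_pos E T f' - ext_pos E T g'" using assms by blast
  fix t assume "\<exists>f'\<in>P. \<exists>g'\<in>P. f - g = f' - g' \<and> t = ext_pos E T f' - ext_pos E T g'"
  then obtain f' g' where fg: "f' \<in> P" "g' \<in> P" "f - g = f' - g'" "t = ext_pos E T f' - ext_pos E T g'"
    by blast
  then have "f + g' = f' + g" by (simp add: algebra_simps)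
  then have "ext_pos E T f + ext_pos E T g' = ext_pos E T f' + ext_pos E T g"
    using ext_pos_add assms fg by metis
  then have "ext_pos E T f' - ext_pos E T g' = ext_pos E T f - ext_pos E T g" by (simp add: algebra_simps)
  then show "t = ext_pos E T f - ext_pos E T g" using fg by simp
qed

lemma L_iff: "x \<in> L \<longleftrightarrow> \<bar>x\<bar> \<in> P"
proof
  assume "x \<in> L"
  then obtain f g where fg: "f \<in> P" "g \<in> P" "x = f - g" by (auto simp: L1_def)
  then have "\<bar>x\<bar> \<le> f + g" using abs_triangle_ineq4[of f g] P_nonneg by simp
  then show "\<bar>x\<bar> \<in> P" using P_ideal[OF P_add[OF fg(1,2)]] by simp
next
  assume "\<bar>x\<bar> \<in> P"
  then have "pprt x \<in> P" "pprt (- x) \<in> P"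
    using P_ideal[of "\<bar>x\<bar>" "pprt x"] P_ideal[of "\<bar>x\<bar>" "pprt (- x)"] by (simp_all add: abs_eq_pprt)
  moreover have "x = pprt x - pprt (- x)" by (simp add: pprt_minus_pprt)
  ultimately show "x \<in> L" unfolding L1_def by blast
qed

lemma L_pprt:
  assumes "x \<in> L"
  shows "pprt x \<in> P" "pprt (- x) \<in> P"
  using assms P_ideal[of "\<bar>x\<bar>" "pprt x"] P_ideal[of "\<bar>x\<bar>" "pprt (- x)"]
  by (simp_all add: L_iff abs_eq_pprt)

lemma P_L: "f \<in> P \<Longrightarrow> f \<in> L"
  using P_nonneg[of f] by (simp add: L_iff)

lemma L_P: "f \<in> L \<Longrightarrow> 0 \<le> f \<Longrightarrow> f \<in> P"
  by (simp add: L_iff)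

lemma L_ideal: "f \<in> L \<Longrightarrow> \<bar>g\<bar> \<le> \<bar>f\<bar> \<Longrightarrow> g \<in> L"
  by (auto simp: L_iff intro: P_ideal)

lemma L_add: "x \<in> L \<Longrightarrow> y \<in> L \<Longrightarrow> x + y \<in> L"
  using P_ideal[OF P_add, of "\<bar>x\<bar>" "\<bar>y\<bar>"] by (simp add: L_iff abs_triangle_ineq)

lemma L_minus: "x \<in> L \<Longrightarrow> - x \<in> L"
  by (simp add: L_iff)

lemma L_diff: "x \<in> L \<Longrightarrow> y \<in> L \<Longrightarrow> x - y \<in> L"
  using L_add[OF _ L_minus, of x y] by simp

lemma abs_scaleR: "\<bar>c *\<^sub>R x\<bar> = \<bar>c\<bar> *\<^sub>R \<bar>x :: 'u\<bar>"
proof -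
  have *: "\<bar>c *\<^sub>R x\<bar> = c *\<^sub>R \<bar>x\<bar>" if "0 \<le> c" for c and x :: 'u
    using abs_pos_mult[of "c *\<^sub>R 1" x] that by (simp add: scaleR_nonneg_nonneg)
  show ?thesis using *[of c x] *[of "- c" x] by (cases "0 \<le> c") auto
qed

lemma L_scaleR: "x \<in> L \<Longrightarrow> c *\<^sub>R x \<in> L"
  by (simp add: L_iff abs_scaleR P_scaleR)

lemma L_zero: "0 \<in> L"
  using P_E[OF E_zero] by (simp add: L_iff)

lemma ext_P: "f \<in> P \<Longrightarrow> \<tau> f = ext_pos E T f"
  using ext_eq[OF _ P_E[OF E_zero], of f] ext_pos_E[OF E_zero] T_diff[OF E_zero E_zero] by simp

lemma ext_split: "x \<in> L \<Longrightarrow> \<tau> x = \<tau> (pprt x) - \<tau> (pprt (- x))"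
  using ext_eq[of "pprt x" "pprt (- x)"] L_pprt by (simp add: pprt_minus_pprt ext_P)

lemma ext_add:
  assumes "x \<in> L" "y \<in> L"
  shows "\<tau> (x + y) = \<tau> x + \<tau> y"
proof -
  note P = L_pprt[OF assms(1)] L_pprt[OF assms(2)]
  have "x + y = (pprt x + pprt y) - (pprt (- x) + pprt (- y))"
    using pprt_minus_pprt[of x] pprt_minus_pprt[of y] by (simp add: algebra_simps)
  then have "\<tau> (x + y) = ext_pos E T (pprt x + pprt y) - ext_pos E T (pprt (- x) + pprt (- y))"
    using P by (simp only: ext_eq P_add)
  also have "\<dots> = \<tau> x + \<tau> y" using P by (simp add: ext_split assms ext_P ext_pos_add)
  finally show ?thesis .
qed

lemma ext_nonneg: "x \<in> L \<Longrightarrow> 0 \<le> x \<Longrightarrow> 0 \<le> \<tau> x"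
  using L_P ext_P ext_pos_nonneg by simp

lemma ext_zero: "\<tau> 0 = 0"
  using ext_add[OF L_zero L_zero] by simp

lemma ext_minus: "x \<in> L \<Longrightarrow> \<tau> (- x) = - \<tau> x"
  using ext_add[OF _ L_minus, of x x] by (simp add: ext_zero eq_neg_iff_add_eq_0 add.commute)

lemma ext_diff: "x \<in> L \<Longrightarrow> y \<in> L \<Longrightarrow> \<tau> (x - y) = \<tau> x - \<tau> y"
  using ext_add[OF _ L_minus, of x y] by (simp add: ext_minus)

lemma ext_mono: "x \<in> L \<Longrightarrow> y \<in> L \<Longrightarrow> x \<le> y \<Longrightarrow> \<tau> x \<le> \<tau> y"
  using ext_nonneg[OF L_diff, of y x] by (simp add: ext_diff)

lemma ext_scaleR:
  assumes "x \<in> L"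
  shows "\<tau> (c *\<^sub>R x) = c *\<^sub>R \<tau> x"
proof -
  have *: "\<tau> (c *\<^sub>R x) = c *\<^sub>R \<tau> x" if "x \<in> L" "0 \<le> c" for c x
  proof -
    have "c *\<^sub>R x = c *\<^sub>R pprt x - c *\<^sub>R pprt (- x)" by (simp add: pprt_minus_pprt flip: scaleR_right_diff_distrib)
    then show ?thesis
      using L_pprt[OF that(1)] that by (simp add: ext_eq P_scaleR ext_pos_scaleR ext_split ext_P scaleR_right_diff_distrib)
  qed
  show ?thesis using *[OF assms, of c] *[OF L_minus[OF assms], of "- c"]
    by (cases "0 \<le> c") (auto simp: ext_minus assms)
qed

lemma ext_T: "x \<in> E \<Longrightarrow> 0 \<le> x \<Longrightarrow> \<tau> x = T x"
  by (simp add: ext_P P_E ext_pos_E)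

lemma ext_strict:
  assumes "x \<in> L" "0 \<le> x" "\<tau> x = 0"
  shows "x = 0"
proof -
  have "x \<in> P" using assms by (simp add: L_P)
  have "z = 0" if "z \<in> below x" for z
  proof (rule T_strict)
    show "z \<in> E" "0 \<le> z" using that by (auto simp: below_def)
    then show "T z = 0"
      using ext_pos_upper[OF \<open>x \<in> P\<close>, of z] that assms ext_P[OF \<open>x \<in> P\<close>] T_nonneg[of z]
      by (auto simp: below_def intro: antisym)
  qed
  then have "x \<le> 0" by (intro lub_least[OF lub_below[OF assms(2)]]) auto
  with assms(2) show ?thesis by simp
qed

text \<open>Monotone convergence for the extension. Membership of the supremum in the domain is a
  conclusion: it follows from the bound on the expectations once the supremum exists in the
  universal completion.\<close>

lemma ext_directed:
  assumes D: "up_directed D" "\<And>d. d \<in> D \<Longrightarrow> d \<in> P" and f: "lub_in UNIV D f"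
    and b: "\<And>d. d \<in> D \<Longrightarrow> \<tau> d \<le> b"
  shows "f \<in> P" "\<tau> f \<le> b"
proof -
  have f0: "0 \<le> f"
  proof -
    obtain d where "d \<in> D" using D(1) by (auto simp: up_directed_def)
    then show ?thesis using P_nonneg[OF D(2)] lub_upper[OF f] order_trans by blast
  qed
  have le: "T x \<le> b" if x: "x \<in> E" "0 \<le> x" "x \<le> f" for x
  proof (rule T_le_directed[OF x(1,2) D(1) _ f x(3)])
    fix d assume d: "d \<in> D"
    show "0 \<le> d" using D(2) d P_nonneg by blast
    have "T (inf x d) \<le> ext_pos E T d"
      using x \<open>0 \<le> d\<close> D(2) d by (intro ext_pos_upper E_ideal_nonneg[OF x(1), of "inf x d"]) auto
    then show "T (inf x d) \<le> b" using b[OF d] D(2)[OF d] by (simp add: ext_P)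
  qed
  show fP: "f \<in> P" using le f0 by (intro PI[of _ b]) (auto simp: below_def)
  show "\<tau> f \<le> b" using le fP by (auto simp: ext_P intro: ext_pos_least)
qed

lemma ext_up_to:
  assumes f: "up_to f s" and P: "\<And>n. f n \<in> P" and b: "\<And>n. \<tau> (f n) \<le> b"
  shows "s \<in> P" "up_to (\<lambda>n. \<tau> (f n)) (\<tau> s)"
proof -
  have "up_directed (range f)"
    unfolding up_directed_def
  proof (intro conjI ballI)
    fix x y assume "x \<in> range f" "y \<in> range f"
    then obtain m n where "x = f m" "y = f n" by blast
    then have "x \<le> f (max m n)" "y \<le> f (max m n)" using up_to_mono[OF f] by auto
    then show "\<exists>z\<in>range f. x \<le> z \<and> y \<le> z" by blast
  qed simp
  note dir = ext_directed[OF this _ conjunct2[OF f[unfolded up_to_def]]]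
  show s: "s \<in> P" using dir[of b] P b by auto
  show "up_to (\<lambda>n. \<tau> (f n)) (\<tau> s)"
  proof (rule up_toI)
    show "incseq (\<lambda>n. \<tau> (f n))"
      using f P by (auto simp: up_to_def incseq_def intro!: ext_mono P_L)
    show "\<tau> (f n) \<le> \<tau> s" for n using P s up_to_upper[OF f] by (intro ext_mono P_L)
    show "\<tau> s \<le> b" if "\<And>n. \<tau> (f n) \<le> b" for b using dir[of b] P that by auto
  qed
qed

end

section \<open>The range algebra and the module of square integrable elements\<close>

lemma le_one_add_square: "x \<le> 1 + x * (x :: 'u::universally_complete_falgebra)"
proof -
  have "0 \<le> (1 - x) * (1 - x) + (1 + x * x)" by simp
  then have "2 *\<^sub>R x \<le> 2 *\<^sub>R (1 + x * x)" by (simp add: algebra_simps scaleR_2)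
  then have "(1/2) *\<^sub>R 2 *\<^sub>R x \<le> (1/2) *\<^sub>R 2 *\<^sub>R (1 + x * x)" by (rule scaleR_left_mono) simp
  then show ?thesis by simp
qed

lemma abs_mult_le_squares: "\<bar>x * y\<bar> \<le> x * x + y * (y :: 'u::universally_complete_falgebra)"
proof -
  have "0 \<le> (\<bar>x\<bar> - \<bar>y\<bar>) * (\<bar>x\<bar> - \<bar>y\<bar>) + \<bar>x\<bar> * \<bar>y\<bar>" by simp
  also have "\<dots> = x * x + y * y - \<bar>x\<bar> * \<bar>y\<bar>" by (simp add: algebra_simps abs_mult_abs)
  finally show ?thesis using abs_le_mult[of x y] by simp
qed

context cond_exp
begin

abbreviation "A \<equiv> range_alg E T"

text \<open>The elements \<open>T x\<close> with \<open>x\<close> in \<open>below f\<close> are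
  fixed by \<open>T\<close> and increase to \<open>\<tau> f\<close>, so monotone convergence
  evaluates \<open>\<tau> (\<tau> f)\<close>.\<close>

lemma ext_idem_P:
  assumes f: "f \<in> P"
  shows "\<tau> f \<in> P" "\<tau> (\<tau> f) = \<tau> f"
proof -
  let ?D = "T ` below f"
  have D: "up_directed ?D"
    unfolding up_directed_def
  proof (intro conjI ballI)
    show "?D \<noteq> {}" using P_nonneg[OF f] by (auto simp: below_def E_zero)
    fix p q assume "p \<in> ?D" "q \<in> ?D"
    then obtain x y where xy: "p = T x" "q = T y" "x \<in> below f" "y \<in> below f" by blast
    obtain z where "z \<in> below f" "x \<le> z" "y \<le> z"
      using up_directed_below[OF P_nonneg[OF f]] xy unfolding up_directed_def by blast
    then show "\<exists>z\<in>?D. p \<le> z \<and> q \<le> z"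
      using xy by (intro bexI[of _ "T z"]) (auto simp: below_def intro: T_mono)
  qed
  have DP: "d \<in> P" "\<tau> d = d" if "d \<in> ?D" for d
    using that by (auto simp: below_def ext_T T_E T_nonneg T_idem intro!: P_E)
  note lub = ext_pos_lub[OF f, folded ext_P[OF f]]
  note dir = ext_directed[OF D DP(1) lub, of "\<tau> f"]
  show P: "\<tau> f \<in> P" using dir(1) DP lub_upper[OF lub] by simp
  show "\<tau> (\<tau> f) = \<tau> f"
  proof (rule antisym)
    show "\<tau> (\<tau> f) \<le> \<tau> f" using dir(2) DP lub_upper[OF lub] by simp
    have "d \<le> \<tau> (\<tau> f)" if "d \<in> ?D" for d
      using ext_mono[OF P_L[OF DP(1)[OF that]] P_L[OF P] lub_upper[OF lub that]] DP(2)[OF that] by simp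
    then show "\<tau> f \<le> \<tau> (\<tau> f)" by (rule lub_least[OF lub])
  qed
qed

lemma
  assumes "x \<in> L"
  shows ext_L: "\<tau> x \<in> L" and ext_idem: "\<tau> (\<tau> x) = \<tau> x"
proof -
  note P = ext_idem_P[OF L_pprt(1)[OF assms]] ext_idem_P[OF L_pprt(2)[OF assms]]
  show "\<tau> x \<in> L" unfolding ext_split[OF assms] using P by (intro L_diff P_L)
  show "\<tau> (\<tau> x) = \<tau> x" unfolding ext_split[OF assms] using P by (simp add: ext_diff P_L)
qed

lemma A_iff: "a \<in> A \<longleftrightarrow> a \<in> L \<and> \<tau> a = a"
  unfolding range_alg_def using ext_L ext_idem by force

lemma A_add: "a \<in> A \<Longrightarrow> b \<in> A \<Longrightarrow> a + b \<in> A"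
  and A_diff: "a \<in> A \<Longrightarrow> b \<in> A \<Longrightarrow> a - b \<in> A"
  and A_minus: "a \<in> A \<Longrightarrow> - a \<in> A"
  and A_scaleR: "a \<in> A \<Longrightarrow> c *\<^sub>R a \<in> A"
  and A_L: "a \<in> A \<Longrightarrow> a \<in> L"
  and A_fixed: "a \<in> A \<Longrightarrow> \<tau> a = a"
  by (simp_all add: A_iff L_add ext_add L_diff ext_diff L_minus ext_minus L_scaleR ext_scaleR)

lemma A_one: "1 \<in> A"
  using P_L[OF P_E[OF E_one]] by (simp add: A_iff ext_T E_one T_one)

lemma A_zero: "0 \<in> A"
  by (simp add: A_iff L_zero ext_zero)

lemma ext_A: "x \<in> L \<Longrightarrow> \<tau> x \<in> A"
  by (simp add: A_iff ext_L ext_idem)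

text \<open>The difference \<open>\<tau> x - x\<close> is positive with expectation
  \<open>0\<close>, so strict positivity makes it vanish. One inequality thus suffices for
  membership in \<open>A\<close>; moduli, suprema and squares are handled this way.\<close>

lemma A_if_le_ext:
  assumes "x \<in> L" "x \<le> \<tau> x"
  shows "x \<in> A"
proof -
  have "\<tau> x - x = 0"
    by (rule ext_strict[of "\<tau> x - x"]) (use assms in \<open>auto simp: L_diff ext_L ext_diff ext_idem\<close>)
  then show ?thesis using assms by (simp add: A_iff)
qed

lemma A_abs:
  assumes a: "a \<in> A"
  shows "\<bar>a\<bar> \<in> A"
proof (rule A_if_le_ext)
  have L: "a \<in> L" "\<bar>a\<bar> \<in> L" using A_L[OF a] by (auto simp: L_iff)
  then show "\<bar>a\<bar> \<in> L" by simp
  have "a \<le> \<tau> \<bar>a\<bar>" using ext_mono[OF L abs_ge_self] A_fixed[OF a] by simp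
  moreover have "- a \<le> \<tau> \<bar>a\<bar>" using ext_mono[OF L_minus[OF L(1)] L(2) abs_ge_minus_self] A_fixed[OF a] L(1) by (simp add: ext_minus)
  ultimately show "\<bar>a\<bar> \<le> \<tau> \<bar>a\<bar>" by (simp add: abs_le_iff)
qed

lemma pprt_eq_abs: "pprt x = (1/2) *\<^sub>R (\<bar>x\<bar> + x :: 'u)"
proof -
  have "\<bar>x\<bar> + x = 2 *\<^sub>R pprt x"
    using pprt_minus_pprt[of x] by (simp add: abs_eq_pprt scaleR_2 algebra_simps)
  then show ?thesis by simp
qed

lemma A_pprt: "a \<in> A \<Longrightarrow> pprt a \<in> A"
  by (simp only: pprt_eq_abs A_scaleR A_add A_abs)

lemma A_inf: "a \<in> A \<Longrightarrow> b \<in> A \<Longrightarrow> inf a b \<in> A"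
  using A_diff[OF _ A_pprt[OF A_diff], of a a b] by (simp flip: minus_inf_eq_pprt)

lemma A_lub:
  assumes "X \<subseteq> A" "lub_in UNIV X s" "s \<in> L"
  shows "s \<in> A"
proof (rule A_if_le_ext[OF assms(3)])
  have "x \<le> \<tau> s" if "x \<in> X" for x
    using ext_mono[OF A_L[of x] assms(3) lub_upper[OF assms(2) that]] A_fixed[of x] assms(1) that by auto
  then show "s \<le> \<tau> s" by (rule lub_least[OF assms(2)])
qed

lemma P_bounded: "0 \<le> x \<Longrightarrow> x \<le> c *\<^sub>R 1 \<Longrightarrow> x \<in> P"
  by (intro P_E E_bounded)

lemma L_bounded: "\<bar>x\<bar> \<le> c *\<^sub>R 1 \<Longrightarrow> x \<in> L"
  by (simp add: L_iff P_bounded)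

lemma ext_bounded:
  assumes "\<bar>x\<bar> \<le> c *\<^sub>R 1"
  shows "\<bar>\<tau> x\<bar> \<le> c *\<^sub>R 1"
proof -
  have c: "c *\<^sub>R 1 \<in> L" "\<tau> (c *\<^sub>R 1) = c *\<^sub>R 1" using A_scaleR[OF A_one, of c] by (auto simp: A_iff)
  have x: "x \<in> L" using L_bounded[OF assms] .
  have "\<tau> x \<le> c *\<^sub>R 1" using ext_mono[OF x c(1)] c(2) assms by (simp add: abs_le_iff)
  moreover have "- \<tau> x \<le> c *\<^sub>R 1" using ext_mono[OF L_minus[OF x] c(1)] c(2) assms x by (simp add: abs_le_iff ext_minus)
  ultimately show ?thesis by (simp add: abs_le_iff)
qed

lemma mult_bounded:
  assumes "\<bar>x\<bar> \<le> c *\<^sub>R 1" "\<bar>y\<bar> \<le> d *\<^sub>R (1::'u)"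
  shows "\<bar>x * y\<bar> \<le> (c * d) *\<^sub>R 1"
proof -
  have "\<bar>x * y\<bar> \<le> \<bar>x\<bar> * \<bar>y\<bar>" by (rule abs_le_mult)
  also have "\<dots> \<le> (c *\<^sub>R 1) * (d *\<^sub>R 1)"
    using assms order_trans[OF abs_ge_zero assms(1)] by (intro mult_mono) auto
  finally show ?thesis by (simp add: mult.commute)
qed

lemma tangent_le_square: "(2 * t) *\<^sub>R x - (t * t) *\<^sub>R 1 \<le> x * (x :: 'u)"
proof -
  have "0 \<le> (x - t *\<^sub>R 1) * (x - t *\<^sub>R 1)" by simp
  also have "\<dots> = x * x - ((2 * t) *\<^sub>R x - (t * t) *\<^sub>R 1)"
    using scaleR_left_distrib[of t t x] by (simp add: algebra_simps)
  finally show ?thesis by simp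
qed

text \<open>A square is the supremum of its tangents, which reduces Jensen's inequality to linearity.\<close>

lemma ext_jensen:
  assumes "\<bar>x\<bar> \<le> c *\<^sub>R 1"
  shows "\<tau> x * \<tau> x \<le> \<tau> (x * x)"
proof (rule square_le_if_tangents_le[OF ext_bounded[OF assms]])
  fix t
  have L: "x \<in> L" "x * x \<in> L" "1 \<in> L" "\<tau> 1 = 1"
    using L_bounded assms mult_bounded[OF assms assms] A_one by (auto simp: A_iff)
  have "\<tau> ((2 * t) *\<^sub>R x - (t * t) *\<^sub>R 1) \<le> \<tau> (x * x)"
    using L by (intro ext_mono L_diff L_scaleR tangent_le_square)
  then show "(2 * t) *\<^sub>R \<tau> x - (t * t) *\<^sub>R 1 \<le> \<tau> (x * x)"
    using L by (simp add: ext_diff ext_scaleR L_scaleR)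
qed

lemma A_square_bounded:
  assumes "a \<in> A" "\<bar>a\<bar> \<le> c *\<^sub>R 1"
  shows "a * a \<in> A"
  using ext_jensen[OF assms(2)] A_fixed[OF assms(1)] L_bounded[OF mult_bounded[OF assms(2,2)]]
  by (intro A_if_le_ext) auto

text \<open>Equality in Jensen's inequality at \<open>a\<close> makes \<open>s = 0\<close> a minimum of
  \<open>\<tau> ((a + s x)\<^sup>2) - (\<tau> (a + s x))\<^sup>2\<close>, so the linear term in \<open>s\<close> vanishes.\<close>

lemma averaging_bounded:
  assumes a: "a \<in> A" "\<bar>a\<bar> \<le> c *\<^sub>R 1" and x: "\<bar>x\<bar> \<le> d *\<^sub>R 1"
  shows "\<tau> (a * x) = a * \<tau> x"
proof -
  let ?K = "\<tau> (x * x) - \<tau> x * \<tau> x"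
  let ?D = "\<tau> (a * x) - a * \<tau> x"
  have L: "a \<in> L" "x \<in> L" "a * a \<in> L" "a * x \<in> L" "x * x \<in> L"
    using L_bounded a x mult_bounded[OF a(2,2)] mult_bounded[OF a(2) x] mult_bounded[OF x x] by blast+
  have D: "(2 * s) *\<^sub>R ?D + (s * s) *\<^sub>R ?K \<ge> 0" for s
  proof -
    have "\<bar>a + s *\<^sub>R x\<bar> \<le> \<bar>a\<bar> + \<bar>s *\<^sub>R x\<bar>" by (rule abs_triangle_ineq)
    also have "\<dots> \<le> c *\<^sub>R 1 + \<bar>s\<bar> *\<^sub>R d *\<^sub>R 1"
      unfolding abs_scaleR by (intro add_mono a(2) scaleR_left_mono x) simp
    finally have bd: "\<bar>a + s *\<^sub>R x\<bar> \<le> (c + \<bar>s\<bar> * d) *\<^sub>R 1" by (simp add: scaleR_left_distrib)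
    have sq: "(p + s *\<^sub>R q) * (p + s *\<^sub>R q) = p * p + (2 * s) *\<^sub>R (p * q) + (s * s) *\<^sub>R (q * q)" for p q :: 'u
      using scaleR_left_distrib[of s s "p * q"] by (simp add: algebra_simps)
    have "\<tau> (a + s *\<^sub>R x) = a + s *\<^sub>R \<tau> x" using L A_fixed[OF a(1)] by (simp add: ext_add L_scaleR ext_scaleR)
    moreover have "\<tau> ((a + s *\<^sub>R x) * (a + s *\<^sub>R x)) = a * a + (2 * s) *\<^sub>R \<tau> (a * x) + (s * s) *\<^sub>R \<tau> (x * x)"
      unfolding sq using L A_fixed[OF A_square_bounded[OF a]] by (simp add: ext_add L_scaleR ext_scaleR L_add)
    ultimately have "a * a + (2 * s) *\<^sub>R (a * \<tau> x) + (s * s) *\<^sub>R (\<tau> x * \<tau> x)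
        \<le> a * a + (2 * s) *\<^sub>R \<tau> (a * x) + (s * s) *\<^sub>R \<tau> (x * x)"
      using ext_jensen[OF bd] by (simp add: sq)
    then show ?thesis by (simp add: algebra_simps)
  qed
  have half: "y \<le> 0" if y: "\<And>s. s > 0 \<Longrightarrow> (2 * s) *\<^sub>R y \<le> (s * s) *\<^sub>R ?K" for y
  proof (rule le_eps_arch[of _ ?K])
    fix \<epsilon> :: real assume "0 < \<epsilon>"
    \<comment> \<open>The value \<open>s = 2 \<epsilon>\<close> is chosen so that division by
      \<open>2 s\<close> leaves \<open>\<epsilon>\<close> in front of \<open>?K\<close>.\<close>
    then have "(1 / (4 * \<epsilon>)) *\<^sub>R (2 * (2 * \<epsilon>)) *\<^sub>R y \<le> (1 / (4 * \<epsilon>)) *\<^sub>R (2 * \<epsilon> * (2 * \<epsilon>)) *\<^sub>R ?K"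
      using y[of "2 * \<epsilon>"] by (intro scaleR_left_mono) auto
    then show "y \<le> \<epsilon> *\<^sub>R ?K" using \<open>0 < \<epsilon>\<close> by simp
  qed
  have "- ?D \<le> 0"
  proof (rule half)
    fix s :: real assume "0 < s"
    show "(2 * s) *\<^sub>R - ?D \<le> (s * s) *\<^sub>R ?K" using add_left_mono[OF D[of s], of "- ((2 * s) *\<^sub>R ?D)"] by (simp only: scaleR_minus_right add_0_right add.assoc[symmetric] left_minus add_0_left)
  qed
  moreover have "?D \<le> 0"
  proof (rule half)
    fix s :: real assume "0 < s"
    show "(2 * s) *\<^sub>R ?D \<le> (s * s) *\<^sub>R ?K"
      using add_left_mono[OF D[of "- s"], of "(2 * s) *\<^sub>R ?D"]
      by (simp only: mult_minus_left mult_minus_right minus_minus scaleR_minus_left add_0_right add.assoc[symmetric] right_minus add_0_left)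
  qed
  ultimately have "?D = 0" by (intro antisym) simp_all
  then show ?thesis by simp
qed

text \<open>Both factors are truncated at \<open>n\<close>, where the bounded case applies, and both
  sides converge monotonically. The right-hand limit exists in the universal completion and bounds
  the expectations, which yields membership in the domain.\<close>

lemma averaging_P:
  assumes a: "a \<in> A" "0 \<le> a" and x: "x \<in> P"
  shows "a * x \<in> P" "\<tau> (a * x) = a * \<tau> x"
proof -
  let ?a = "\<lambda>n. inf a (real n *\<^sub>R 1)"
  let ?x = "\<lambda>n. inf x (real n *\<^sub>R 1)"
  have n1: "0 \<le> real n *\<^sub>R (1::'u)" for n by (simp add: scaleR_nonneg_nonneg)
  note x0 = P_nonneg[OF x]
  have a0: "0 \<le> ?a n" and ab: "\<bar>?a n\<bar> \<le> real n *\<^sub>R 1" and aA: "?a n \<in> A" for n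
    using a n1 by (auto simp: abs_of_nonneg intro!: A_inf A_scaleR A_one)
  have x0: "0 \<le> ?x n" and xb: "\<bar>?x n\<bar> \<le> real n *\<^sub>R 1" for n
    using x0 n1 by (auto simp: abs_of_nonneg)
  have a_up: "up_to ?a a" by (rule up_to_truncate[OF a(2)])
  have x_up: "up_to ?x x" by (rule up_to_truncate[OF P_nonneg[OF x]])
  have xP: "?x n \<in> P" for n using P_ideal[OF x x0] by simp
  have tx: "\<tau> (?x n) \<le> \<tau> x" for n using xP x by (intro ext_mono P_L) auto
  have tx_up: "up_to (\<lambda>n. \<tau> (?x n)) (\<tau> x)" by (rule ext_up_to(2)[OF x_up xP tx])
  have prod: "\<tau> (?a n * ?x n) = ?a n * \<tau> (?x n)" for n by (rule averaging_bounded[OF aA ab xb])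
  have pP: "?a n * ?x n \<in> P" for n
    using mult_bounded[OF ab xb, of n n] a0[of n] x0[of n] by (intro L_P L_bounded) auto
  have tau0: "0 \<le> \<tau> (?x n)" for n using xP x0 by (intro ext_nonneg P_L) auto
  have up: "up_to (\<lambda>n. \<tau> (?a n * ?x n)) (a * \<tau> x)"
    unfolding prod by (rule up_to_mult[OF a_up tx_up a0 tau0])
  note res = ext_up_to[OF up_to_mult[OF a_up x_up a0 x0] pP up_to_upper[OF up]]
  show "a * x \<in> P" by (rule res(1))
  show "\<tau> (a * x) = a * \<tau> x" by (rule up_to_unique[OF res(2) up])
qed

lemma
  assumes a: "a \<in> A" and x: "x \<in> L"
  shows A_mult_L: "a * x \<in> L" and averaging: "\<tau> (a * x) = a * \<tau> x"
proof -
  have *: "a * x \<in> L \<and> \<tau> (a * x) = a * \<tau> x" if "a \<in> A" "0 \<le> a" for a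
  proof -
    note P = averaging_P[OF that L_pprt(1)[OF x]] averaging_P[OF that L_pprt(2)[OF x]]
    have e: "a * x = a * pprt x - a * pprt (- x)" by (simp add: pprt_minus_pprt flip: right_diff_distrib)
    show ?thesis unfolding e using P by (simp add: L_diff P_L ext_diff ext_split[OF x] right_diff_distrib)
  qed
  have e: "a = pprt a - pprt (- a)" by (simp add: pprt_minus_pprt)
  have 1: "pprt a * x \<in> L \<and> \<tau> (pprt a * x) = pprt a * \<tau> x"
    by (rule *) (simp_all add: A_pprt a)
  have 2: "pprt (- a) * x \<in> L \<and> \<tau> (pprt (- a) * x) = pprt (- a) * \<tau> x"
    by (rule *) (simp_all add: A_pprt A_minus a)
  have 3: "a * y = pprt a * y - pprt (- a) * y" for y using e by (metis left_diff_distrib)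
  show "a * x \<in> L" "\<tau> (a * x) = a * \<tau> x"
    unfolding 3 using 1 2 by (simp_all add: L_diff ext_diff)
qed

lemma A_mult: "a \<in> A \<Longrightarrow> b \<in> A \<Longrightarrow> a * b \<in> A"
  using A_mult_L[of a b] averaging[of a b] by (simp add: A_iff)

lemma A_le_L: "0 \<le> x \<Longrightarrow> x \<le> a \<Longrightarrow> a \<in> A \<Longrightarrow> x \<in> L"
  using L_ideal[OF A_L, of a x] order_trans[of 0 x a] by (simp add: abs_of_nonneg)

text \<open>The inverse is the supremum \<open>s\<close> of all positive \<open>v\<close> in
  \<open>A\<close> with \<open>u v \<le> 1\<close>. If the defect \<open>r = 1 - u s\<close> did not
  vanish, a part of it could be added to \<open>s\<close>.\<close>

lemma A_inverse:
  assumes u: "u \<in> A" "1 \<le> u"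
  shows "\<exists>v\<in>A. 0 \<le> v \<and> v \<le> 1 \<and> u * v = 1"
proof -
  let ?V = "{v \<in> A. 0 \<le> v \<and> u * v \<le> 1}"
  have u0: "0 \<le> u" using u(2) one_nonneg by (rule order_trans[rotated])
  have V1: "v \<le> 1" if "v \<in> ?V" for v using that mult_right_mono[OF u(2), of v] by auto
  have zero: "0 \<in> ?V" using A_zero by simp
  then have "?V \<noteq> {}" by blast
  from lub_ex[OF this V1] obtain s where s: "lub_in UNIV ?V s" by blast
  have s0: "0 \<le> s" by (rule lub_upper[OF s zero])
  have s1: "s \<le> 1" using lub_least[OF s V1] .
  have us: "u * s \<le> 1" by (rule lub_least[OF lub_mult[OF s u0]]) auto
  have sA: "s \<in> A" using A_lub[OF _ s A_le_L[OF s0 s1 A_one]] by auto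
  define r where "r = 1 - u * s"
  have r: "0 \<le> r" "r \<in> A" using us u sA by (auto simp: r_def intro: A_diff A_one A_mult)
  have "r \<le> 0"
  proof (rule cutoff_arch[OF _ r(1)])
    fix n :: nat assume n: "0 < n"
    let ?p = "pprt (real n *\<^sub>R 1 - u)"
    let ?k = "real n * real n"
    \<comment> \<open>The factor \<open>1 / n^2\<close> compensates
      \<open>(n - u)^+ u \<le> n^2\<close>, so \<open>u ?z \<le> r\<close> and \<open>s + ?z\<close>
      is still admissible.\<close>
    let ?z = "(1 / ?k) *\<^sub>R (?p * r)"
    have zA: "?z \<in> A" using u r by (intro A_scaleR A_mult A_pprt A_diff A_one)
    have z0: "0 \<le> ?z" using r by (simp add: scaleR_nonneg_nonneg)
    have "(?p * u) * r \<le> (?k *\<^sub>R 1) * r" using r u0 by (intro mult_right_mono pprt_cutoff_mult_le) auto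
    then have "(1 / ?k) *\<^sub>R ((?p * u) * r) \<le> (1 / ?k) *\<^sub>R ((?k *\<^sub>R 1) * r)" by (intro scaleR_left_mono) auto
    then have "u * ?z \<le> r" using n by (simp add: ac_simps)
    then have "u * (s + ?z) \<le> 1" by (simp add: r_def distrib_left algebra_simps)
    then have "s + ?z \<le> s" using sA zA s0 z0 by (intro lub_upper[OF s]) (auto intro: A_add)
    then have "?k *\<^sub>R ?z \<le> ?k *\<^sub>R 0" by (intro scaleR_left_mono) auto
    then show "?p * r \<le> 0" using n by simp
  qed
  then have "u * s = 1" using us by (intro antisym) (simp_all add: r_def)
  then show ?thesis using sA s0 s1 by blast
qed

lemma A_sqrt:
  assumes a: "a \<in> A" "0 \<le> a"
  shows "\<exists>b\<in>A. 0 \<le> b \<and> b * b = a"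
proof -
  let ?X = "{c \<in> A. 0 \<le> c \<and> c * c \<le> a}"
  have X1: "c \<le> 1 + a" if "c \<in> ?X" for c
    using that order_trans[OF le_one_add_square[of c]] by auto
  have zero: "0 \<in> ?X" using A_zero a by simp
  then have "?X \<noteq> {}" by blast
  from lub_ex[OF this X1] obtain s where s: "lub_in UNIV ?X s" by blast
  have s0: "0 \<le> s" by (rule lub_upper[OF s zero])
  have s1: "s \<le> 1 + a" using lub_least[OF s X1] .
  have sA: "s \<in> A" using A_lub[OF _ s A_le_L[OF s0 s1]] a A_one by (auto intro: A_add)
  \<comment> \<open>The supremum can be inserted into one factor of \<open>s * s\<close> at a time,
    so mixed products have to be bounded as well.\<close>
  have "c * d \<le> a" if "c \<in> ?X" "d \<in> ?X" for c d
  proof (rule square_mono_le[OF a(2)])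
    have "(c * c) * (d * d) \<le> a * a" using that a by (intro mult_mono) auto
    then show "c * d * (c * d) \<le> a * a" by (simp add: ac_simps)
  qed
  then have "c * s \<le> a" if "c \<in> ?X" for c
    using that by (intro lub_least[OF lub_mult[OF s, of c]]) auto
  then have ss: "s * s \<le> a"
    by (intro lub_least[OF lub_mult[OF s s0]]) (auto simp: mult.commute)
  define r where "r = a - s * s"
  have r: "0 \<le> r" "r \<in> A" using ss a sA by (auto simp: r_def intro: A_diff A_mult)
  \<comment> \<open>The correction \<open>z = r / w\<close> satisfies \<open>z \<le> r\<close>,
    hence \<open>z (2 s + z) \<le> z w = r\<close>; that is, \<open>(s + z)^2 \<le> a\<close>. The
    summand \<open>1\<close> makes \<open>w\<close> invertible in \<open>A\<close>.\<close>
  define w where "w = 1 + (s + s + r)"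
  have w: "w \<in> A" "1 \<le> w" using r sA s0 by (auto simp: w_def intro!: A_add A_one)
  then obtain v where v: "v \<in> A" "0 \<le> v" "v \<le> 1" "w * v = 1" using A_inverse by blast
  define z where "z = r * v"
  have z: "z \<in> A" "0 \<le> z" using r v by (auto simp: z_def intro: A_mult)
  have "z \<le> r * 1" unfolding z_def using v r by (intro mult_left_mono) auto
  then have "s + s + z \<le> 1 + (s + s + r)" by (simp add: add_increasing)
  then have "z * (s + s + z) \<le> z * w" unfolding w_def using z(2) by (rule mult_left_mono)
  also have "\<dots> = r" using v(4) by (simp add: z_def ac_simps)
  finally have "(s + z) * (s + z) \<le> a" by (simp add: r_def algebra_simps)
  then have "s + z \<le> s" using sA s0 z by (intro lub_upper[OF s]) (auto intro: A_add)
  then have "z = 0" using z by (simp add: antisym)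
  moreover have "r = w * z" using v(4) by (simp add: z_def ac_simps)
  ultimately have "r = 0" by simp
  then show ?thesis using sA s0 by (auto simp: r_def)
qed

section \<open>The module of square integrable elements\<close>

abbreviation "H \<equiv> L2 E T"
abbreviation ip :: "'u \<Rightarrow> 'u \<Rightarrow> 'u" where "ip x y \<equiv> \<tau> (x * y)"
abbreviation N :: "'u \<Rightarrow> 'u" where "N x \<equiv> \<tau> (x * x)"

text \<open>Integrability of \<open>x\<close> is automatic from
  \<open>|x| \<le> 1 + x^2\<close>.\<close>

lemma H_iff: "x \<in> H \<longleftrightarrow> x * x \<in> L"
proof -
  have "x \<in> L" if "x * x \<in> L"
  proof (rule L_ideal[OF L_add[OF A_L[OF A_one] that]])
    have "\<bar>x\<bar> \<le> 1 + x * x" using le_one_add_square[of "\<bar>x\<bar>"] by (simp add: abs_mult_abs)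
    then show "\<bar>x\<bar> \<le> \<bar>1 + x * x\<bar>" using abs_ge_self order_trans by blast
  qed
  then show ?thesis by (auto simp: L2_def)
qed

lemma H_square: "x \<in> H \<Longrightarrow> x * x \<in> L"
  by (simp add: H_iff)

lemma H_square_P: "x \<in> H \<Longrightarrow> x * x \<in> P"
  by (simp add: H_iff L_P)

lemma H_mult:
  assumes "x \<in> H" "y \<in> H"
  shows "x * y \<in> L"
proof (rule L_ideal[OF L_add[OF H_square[OF assms(1)] H_square[OF assms(2)]]])
  show "\<bar>x * y\<bar> \<le> \<bar>x * x + y * y\<bar>"
    using abs_mult_le_squares[of x y] abs_ge_self order_trans by blast
qed

lemma H_zero: "0 \<in> H"
  by (simp add: H_iff L_zero)

lemma H_add:
  assumes "x \<in> H" "y \<in> H"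
  shows "x + y \<in> H"
proof -
  have "(x + y) * (x + y) = x * x + x * y + (x * y + y * y)" by (simp add: algebra_simps)
  then show ?thesis using assms by (simp add: H_iff[of "x + y"] L_add H_mult)
qed

lemma H_scaleR: "x \<in> H \<Longrightarrow> c *\<^sub>R x \<in> H"
  by (simp add: H_iff L_scaleR)

lemma H_minus: "x \<in> H \<Longrightarrow> - x \<in> H"
  by (simp add: H_iff)

lemma H_diff: "x \<in> H \<Longrightarrow> y \<in> H \<Longrightarrow> x - y \<in> H"
  using H_add[OF _ H_minus, of x y] by simp

lemma H_A:
  assumes "a \<in> A" "x \<in> H"
  shows "a * x \<in> H"
proof -
  have "(a * x) * (a * x) = (a * a) * (x * x)" by (simp add: ac_simps)
  then show ?thesis using assms by (simp add: H_iff[of "a * x"] A_mult_L A_mult H_square)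
qed

lemma H_ideal:
  assumes "x \<in> H" "\<bar>y\<bar> \<le> \<bar>x\<bar>"
  shows "y \<in> H"
proof -
  have "\<bar>y\<bar> * \<bar>y\<bar> \<le> \<bar>x\<bar> * \<bar>x\<bar>" using assms by (intro mult_mono) auto
  then show ?thesis
    unfolding H_iff by (intro L_ideal[OF H_square[OF assms(1)]]) (simp add: abs_mult_abs abs_of_nonneg)
qed

lemma H_abs: "x \<in> H \<Longrightarrow> \<bar>x\<bar> \<in> H"
  by (simp add: H_iff abs_mult_abs)

lemma H_pprt: "x \<in> H \<Longrightarrow> pprt x \<in> H"
  by (rule H_ideal) (auto simp: abs_of_nonneg abs_eq_pprt[of x])

lemma N_A: "x \<in> H \<Longrightarrow> N x \<in> A"
  by (simp add: ext_A H_square)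

lemma N_nonneg: "x \<in> H \<Longrightarrow> 0 \<le> N x"
  by (simp add: ext_nonneg H_square)

lemma N_eq_zero: "x \<in> H \<Longrightarrow> N x = 0 \<Longrightarrow> x = 0"
  using ext_strict[OF H_square, of x] square_eq_zero[of x] by simp

lemma ip_add: "x \<in> H \<Longrightarrow> y \<in> H \<Longrightarrow> z \<in> H \<Longrightarrow> ip (x + y) z = ip x z + ip y z"
  by (simp add: distrib_right ext_add H_mult)

lemma ip_diff: "x \<in> H \<Longrightarrow> y \<in> H \<Longrightarrow> z \<in> H \<Longrightarrow> ip (x - y) z = ip x z - ip y z"
  by (simp add: left_diff_distrib ext_diff H_mult)

lemma ip_A: "a \<in> A \<Longrightarrow> x \<in> H \<Longrightarrow> z \<in> H \<Longrightarrow> ip (a * x) z = a * ip x z"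
  by (simp add: mult.assoc averaging H_mult)

lemma ip_commute: "ip x y = ip y x"
  by (simp add: mult.commute)

lemma N_A_mult: "a \<in> A \<Longrightarrow> x \<in> H \<Longrightarrow> N (a * x) = (a * a) * N x"
  using averaging[OF A_mult[of a a] H_square[of x]] by (simp add: ac_simps)

lemma N_scaleR: "x \<in> H \<Longrightarrow> N (c *\<^sub>R x) = (c * c) *\<^sub>R N x"
  by (simp add: ext_scaleR H_square)

lemma N_mono:
  assumes "x \<in> H" "\<bar>y\<bar> \<le> \<bar>x\<bar>"
  shows "N y \<le> N x"
proof (rule ext_mono)
  have "\<bar>y\<bar> * \<bar>y\<bar> \<le> \<bar>x\<bar> * \<bar>x\<bar>" using assms by (intro mult_mono) auto
  then show "y * y \<le> x * x" by (simp add: abs_mult_abs)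
qed (use assms H_ideal H_square in auto)

lemma T_norm:
  assumes "x \<in> H"
  shows "T_norm E T x \<in> A" "0 \<le> T_norm E T x" "T_norm E T x * T_norm E T x = N x"
proof -
  obtain b where b: "b \<in> A" "0 \<le> b" "b * b = N x" using A_sqrt[OF N_A N_nonneg] assms by blast
  have "T_norm E T x = b"
    unfolding T_norm_def
  proof (rule the_equality)
    fix c assume c: "c \<in> A \<and> 0 \<le> c \<and> c * c = N x"
    show "c = b" by (rule antisym; rule square_mono_le) (use b c in simp_all)
  qed (use b in simp)
  then show "T_norm E T x \<in> A" "0 \<le> T_norm E T x" "T_norm E T x * T_norm E T x = N x" using b by auto
qed

text \<open>This removes the root from operator bounds; afterwards only \<open>N\<close> is
  estimated.\<close>

lemma T_norm_le_iff:
  assumes "x \<in> H" "y \<in> H" "0 \<le> k"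
  shows "T_norm E T y \<le> k * T_norm E T x \<longleftrightarrow> N y \<le> (k * k) * N x"
proof -
  have e: "(k * T_norm E T x) * (k * T_norm E T x) = (k * k) * N x"
    by (simp add: ac_simps T_norm(3)[OF assms(1), symmetric])
  show ?thesis
  proof
    assume "T_norm E T y \<le> k * T_norm E T x"
    then have "T_norm E T y * T_norm E T y \<le> (k * T_norm E T x) * (k * T_norm E T x)"
      using T_norm assms by (intro mult_mono) auto
    then show "N y \<le> (k * k) * N x" by (simp only: e T_norm assms)
  next
    assume "N y \<le> (k * k) * N x"
    then have "T_norm E T y * T_norm E T y \<le> (k * T_norm E T x) * (k * T_norm E T x)"
      by (simp only: e T_norm assms)
    then show "T_norm E T y \<le> k * T_norm E T x"
      by (rule square_mono_le[rotated]) (use T_norm assms in \<open>auto simp: e\<close>)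
  qed
qed

end

section \<open>Completeness\<close>

context cond_exp
begin

text \<open>For each height \<open>k\<close> an idempotent \<open>q\<close> marks where some
  \<open>f n\<close> exceeds \<open>k\<close>. Off \<open>q\<close> the sequence is bounded by
  \<open>k\<close>, and Chebyshev's inequality gives \<open>k \<tau> q \<le> b\<close>. These
  idempotents therefore have infimum \<open>0\<close> by strict positivity, and local bounds become
  a global one by lateral completeness.\<close>

lemma levi:
  assumes fP: "\<And>n. f n \<in> P" and inc: "incseq f" and b: "\<And>n. \<tau> (f n) \<le> b"
  shows "\<exists>s. up_to f s"
proof -
  have "\<exists>q. 0 \<le> q \<and> q \<le> 1 \<and> q * q = q \<and> (\<forall>n. (1 - q) * f n \<le> real k *\<^sub>R 1) \<and> real k *\<^sub>R \<tau> q \<le> b"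
    if k: "0 < k" for k :: nat
  proof -
    let ?g = "\<lambda>n. f n - real k *\<^sub>R 1"
    have "incseq ?g" using inc by (auto simp: incseq_def)
    then obtain q c where c: "up_to c q" and q: "0 \<le> q" "q \<le> 1" "q * q = q" "\<And>n. (1 - q) * pprt (?g n) = 0"
      and c': "\<And>n. 0 \<le> c n" "\<And>n. c n \<le> 1" "\<And>n. c n * pprt (- ?g n) = 0"
      by (rule component_seq) blast
    have "(1 - q) * f n \<le> real k *\<^sub>R 1" for n
    proof -
      have "(1 - q) * ?g n \<le> (1 - q) * pprt (?g n)" using q by (intro mult_left_mono) (auto simp: pprt_def)
      then have "(1 - q) * f n \<le> real k *\<^sub>R (1 - q)" using q(4)[of n] by (simp add: right_diff_distrib)
      also have "\<dots> \<le> real k *\<^sub>R 1" using q by (intro scaleR_left_mono) auto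
      finally show ?thesis .
    qed
    moreover have cP: "c n \<in> P" for n using P_bounded[of "c n" 1] c' by simp
    have "real k *\<^sub>R \<tau> (c n) \<le> b" for n
    proof -
      \<comment> \<open>Chebyshev: \<open>c n\<close> lives where \<open>f n \<ge> k\<close>, so
        \<open>k c n \<le> c n f n \<le> f n\<close>.\<close>
      have "c n * (- ?g n) \<le> c n * pprt (- ?g n)" using c' by (intro mult_left_mono) (auto simp: pprt_def)
      then have "real k *\<^sub>R c n \<le> c n * f n" using c'(3)[of n] by (simp add: right_diff_distrib)
      also have "\<dots> \<le> 1 * f n" using c' P_nonneg[OF fP] by (intro mult_right_mono) auto
      finally have "\<tau> (real k *\<^sub>R c n) \<le> \<tau> (f n)" using cP fP by (intro ext_mono L_scaleR P_L) auto
      then show ?thesis using b[of n] cP[of n] by (simp add: ext_scaleR P_L)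
    qed
    then have le: "\<tau> (c n) \<le> (1 / real k) *\<^sub>R b" for n
      using scaleR_left_mono[of "real k *\<^sub>R \<tau> (c n)" b "1 / real k"] k by simp
    have "\<tau> q \<le> (1 / real k) *\<^sub>R b" by (rule up_to_least[OF ext_up_to(2)[OF c cP le] le])
    then have "real k *\<^sub>R \<tau> q \<le> b" using scaleR_left_mono[of "\<tau> q" "(1 / real k) *\<^sub>R b" "real k"] k by simp
    ultimately show ?thesis using q by blast
  qed
  then have "\<forall>k. \<exists>q. 0 \<le> q \<and> q \<le> 1 \<and> q * q = q \<and> (\<forall>n. (1 - q) * f n \<le> real (Suc k) *\<^sub>R 1)
      \<and> real (Suc k) *\<^sub>R \<tau> q \<le> b" by blast
  then obtain q where q: "\<And>k. 0 \<le> q k" "\<And>k. q k \<le> 1" "\<And>k. q k * q k = q k"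
    "\<And>k n. (1 - q k) * f n \<le> real (Suc k) *\<^sub>R 1" "\<And>k. real (Suc k) *\<^sub>R \<tau> (q k) \<le> b"
    by metis
  \<comment> \<open>The \<open>q k\<close> come from independent choices and are not known to
    decrease; their partial products do.\<close>
  define Q where "Q k = (\<Prod>i<k. q i)" for k
  have Q0: "Q 0 = 1" and QS: "Q (Suc k) = Q k * q k" for k by (simp_all add: Q_def)
  have Q01: "0 \<le> Q k \<and> Q k \<le> 1 \<and> Q k * Q k = Q k" for k
  proof (induction k)
    case (Suc k)
    have "Q k * q k \<le> 1 * 1" using Suc q by (intro mult_mono) auto
    moreover have "Q k * q k * (Q k * q k) = (Q k * Q k) * (q k * q k)" by (simp add: ac_simps)
    ultimately show ?case using Suc q by (simp add: QS)
  qed (simp add: Q0)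
  have "\<exists>B. \<forall>n. f n \<le> B"
  proof (rule bounded_if_locally_bounded[where f = f and Q = Q, OF P_nonneg[OF fP] inc Q0])
    show "Q k * Q k = Q k" for k using Q01 by blast
    have "Q k * q k * Q k = (Q k * Q k) * q k" for k by (simp add: ac_simps)
    then show "Q (Suc k) * Q k = Q (Suc k)" for k using Q01[of k] by (simp add: QS)
    show "\<exists>B. \<forall>n. (1 - Q k) * f n \<le> B" for k
    proof (induction k)
      case (Suc k)
      then obtain B where B: "\<And>n. (1 - Q k) * f n \<le> B" by blast
      have "(1 - Q (Suc k)) * f n \<le> B + real (Suc k) *\<^sub>R 1" for n
      proof -
        have "(1 - Q (Suc k)) * f n = (1 - Q k) * f n + Q k * ((1 - q k) * f n)" by (simp add: QS algebra_simps)
        also have "\<dots> \<le> B + Q k * (real (Suc k) *\<^sub>R 1)" using B q Q01 by (intro add_mono mult_left_mono) auto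
        also have "\<dots> \<le> B + real (Suc k) *\<^sub>R 1"
          using scaleR_left_mono[of "Q k" 1 "real (Suc k)"] Q01[of k] by (intro add_left_mono) (simp del: of_nat_Suc)
        finally show ?thesis .
      qed
      then show ?case by blast
    qed (simp add: Q0 exI[of _ 0])
  next
    \<comment> \<open>The positive part of a common lower bound lies under every \<open>q k\<close>,
      so all multiples of its expectation stay below \<open>b\<close>; the expectation is
      \<open>0\<close>, and so is the positive part.\<close>
    fix w assume w: "\<And>k. w \<le> Q k"
    let ?w = "pprt w"
    have wq: "?w \<le> q k" for k
    proof (rule pprt_le_self[OF q(1)])
      have "Q k * q k \<le> 1 * q k" using q Q01 by (intro mult_right_mono) auto
      then show "w \<le> q k" using w[of "Suc k"] by (simp add: QS)
    qed
    have w0: "0 \<le> ?w" by simp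
    have qP: "q k \<in> P" for k using P_bounded[of "q k" 1] q by simp
    then have wP: "?w \<in> P" using P_ideal[OF qP w0 wq] by blast
    have "\<tau> ?w \<le> 0"
    proof (rule le_inverse_nat_arch[of _ b])
      fix n :: nat assume "0 < n"
      then obtain k where k: "n = Suc k" by (cases n) auto
      have "real n *\<^sub>R \<tau> ?w \<le> real n *\<^sub>R \<tau> (q k)" using wP qP wq by (intro scaleR_left_mono ext_mono P_L) auto
      also have "\<dots> \<le> b" using q(5) k by blast
      finally show "real n *\<^sub>R \<tau> ?w \<le> b" .
    qed
    then have "\<tau> ?w = 0" using ext_nonneg[OF P_L[OF wP] w0] by (rule antisym)
    then have "?w = 0" by (rule ext_strict[OF P_L[OF wP] w0])
    then show "w \<le> 0" by (simp add: le_zero_iff_zero_pprt)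
  qed
  then obtain B where "\<And>n. f n \<le> B" by blast
  then show ?thesis by (rule up_to_ex[OF inc])
qed

text \<open>The triangle inequality for real multiples of a common bound \<open>b\<close>, without
  roots in \<open>A\<close>. It rests on
  \<open>(x + y)^2 \<le> ((r + s)/r) x^2 + ((r + s)/s) y^2\<close>, which is
  \<open>(s x - r y)^2 \<ge> 0\<close> divided by \<open>r s\<close>; the cases \<open>r = 0\<close>
  and \<open>s = 0\<close> are treated apart because of this division.\<close>

lemma N_triangle:
  assumes x: "x \<in> H" and y: "y \<in> H" and r: "0 \<le> r" and s: "0 \<le> s"
    and Nx: "N x \<le> (r * r) *\<^sub>R b" and Ny: "N y \<le> (s * s) *\<^sub>R b"
  shows "N (x + y) \<le> ((r + s) * (r + s)) *\<^sub>R b"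
proof -
  consider "r = 0" | "s = 0" | "0 < r" "0 < s" using r s by fastforce
  then show ?thesis
  proof cases
    case 1
    then have "x = 0" using N_nonneg[OF x] Nx by (intro N_eq_zero[OF x] antisym) auto
    then show ?thesis using Ny 1 by simp
  next
    case 2
    then have "y = 0" using N_nonneg[OF y] Ny by (intro N_eq_zero[OF y] antisym) auto
    then show ?thesis using Nx 2 by simp
  next
    case 3
    have "0 \<le> (1 / (r * s)) *\<^sub>R ((s *\<^sub>R x - r *\<^sub>R y) * (s *\<^sub>R x - r *\<^sub>R y))"
      using 3 by (intro scaleR_nonneg_nonneg) auto
    also have "\<dots> = (s / r) *\<^sub>R (x * x) + (r / s) *\<^sub>R (y * y) - 2 *\<^sub>R (x * y)"
      using 3 by (simp add: algebra_simps scaleR_2)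
    also have "\<dots> = ((s / r) *\<^sub>R (x * x) + x * x) + ((r / s) *\<^sub>R (y * y) + y * y) - (x + y) * (x + y)"
      by (simp add: algebra_simps scaleR_2)
    also have "(s / r) *\<^sub>R (x * x) + x * x = ((r + s) / r) *\<^sub>R (x * x)"
      using 3 scaleR_left_distrib[of "s / r" 1 "x * x"] by (simp add: add_divide_distrib add.commute)
    also have "(r / s) *\<^sub>R (y * y) + y * y = ((r + s) / s) *\<^sub>R (y * y)"
      using 3 scaleR_left_distrib[of "r / s" 1 "y * y"] by (simp add: add_divide_distrib)
    finally have "(x + y) * (x + y) \<le> ((r + s) / r) *\<^sub>R (x * x) + ((r + s) / s) *\<^sub>R (y * y)" by simp
    then have "N (x + y) \<le> \<tau> (((r + s) / r) *\<^sub>R (x * x) + ((r + s) / s) *\<^sub>R (y * y))"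
      by (intro ext_mono L_add L_scaleR H_square x y H_add)
    also have "\<dots> = ((r + s) / r) *\<^sub>R N x + ((r + s) / s) *\<^sub>R N y"
      using x y by (simp add: ext_add ext_scaleR L_scaleR H_square)
    also have "\<dots> \<le> ((r + s) / r) *\<^sub>R (r * r) *\<^sub>R b + ((r + s) / s) *\<^sub>R (s * s) *\<^sub>R b"
      using Nx Ny 3 by (intro add_mono scaleR_left_mono) auto
    also have "\<dots> = ((r + s) * (r + s)) *\<^sub>R b"
    proof -
      have "(r + s) / r * (r * r) + (r + s) / s * (s * s) = (r + s) * (r + s)" using 3 by (simp add: field_simps)
      then show ?thesis by (simp only: scaleR_scaleR flip: scaleR_left_distrib)
    qed
    finally show ?thesis .
  qed
qed

lemma N_abs: "N \<bar>x\<bar> = N x"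
  by (simp add: abs_mult_abs)

lemma add_abs_nonneg: "0 \<le> x + \<bar>x :: 'u\<bar>"
  using abs_ge_minus_self[of x] by (simp add: minus_le_iff add.commute flip: diff_le_eq)

text \<open>A Riesz-Fischer argument. The accumulated variation \<open>g n\<close> has squared norms
  controlled by \<open>r\<close>, so Levi's theorem gives it a limit \<open>G\<close> in
  \<open>H\<close>. Adding \<open>g n\<close> to \<open>x n\<close> makes the sequence increasing,
  and subtracting \<open>G\<close> from the supremum gives the limit, with
  \<open>|s - x m| \<le> G - g m\<close>.\<close>

lemma L2_complete:
  fixes r :: "nat \<Rightarrow> real"
  assumes xH: "\<And>n. x n \<in> H" and r: "incseq r" "\<And>n. r n \<le> 1"
    and step: "\<And>n. N (x (Suc n) - x n) \<le> ((r (Suc n) - r n) * (r (Suc n) - r n)) *\<^sub>R b" and b0: "0 \<le> b"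
  shows "\<exists>s\<in>H. \<forall>n. N (s - x n) \<le> ((1 - r n) * (1 - r n)) *\<^sub>R b"
proof -
  define g where "g n = (\<Sum>i<n. \<bar>x (Suc i) - x i\<bar>)" for n
  have gS: "g (Suc n) = g n + \<bar>x (Suc n) - x n\<bar>" for n by (simp add: g_def)
  have g0: "0 \<le> g n" for n by (simp add: g_def sum_nonneg)
  have gH: "g n \<in> H" for n by (induction n) (auto simp: g_def H_zero intro!: H_add H_abs H_diff xH)
  have ginc: "incseq g" by (rule incseq_SucI) (simp add: gS)
  have N_scale: "N y \<le> (t * t) *\<^sub>R b" if "N y \<le> (s * s) *\<^sub>R b" "0 \<le> s" "s \<le> t" for y s t
    using that(1) scaleR_right_mono[OF mult_mono[of s t s t] b0] that by auto
  have gap: "N (g n - g m) \<le> ((r n - r m) * (r n - r m)) *\<^sub>R b" if "m \<le> n" for m n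
    using that
  proof (induction n rule: dec_induct)
    case base
    then show ?case by (simp add: ext_zero)
  next
    case (step n)
    have "N ((g n - g m) + \<bar>x (Suc n) - x n\<bar>)
        \<le> ((r n - r m + (r (Suc n) - r n)) * (r n - r m + (r (Suc n) - r n))) *\<^sub>R b"
    proof (rule N_triangle)
      show "0 \<le> r n - r m" "0 \<le> r (Suc n) - r n" using r(1) step(1) by (auto simp: incseq_def)
      show "N \<bar>x (Suc n) - x n\<bar> \<le> ((r (Suc n) - r n) * (r (Suc n) - r n)) *\<^sub>R b"
        unfolding N_abs by (rule assms(4))
    qed (use step gH xH in \<open>auto intro: H_diff H_abs\<close>)
    then show ?case by (simp add: gS algebra_simps)
  qed
  then have gap1: "N (g n - g m) \<le> ((1 - r m) * (1 - r m)) *\<^sub>R b" if "m \<le> n" for m n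
    by (rule N_scale) (use that r in \<open>auto simp: incseq_def\<close>)
  have "incseq (\<lambda>n. g n * g n)" using ginc g0 by (auto simp: incseq_def intro!: mult_mono)
  moreover have "N (g n) \<le> ((1 - r 0) * (1 - r 0)) *\<^sub>R b" for n using gap1[of 0 n] by (simp add: g_def)
  ultimately obtain S where S: "up_to (\<lambda>n. g n * g n) S" using levi[of "\<lambda>n. g n * g n"] H_square_P[OF gH] by blast
  \<comment> \<open>Levi's theorem bounds only the squares; \<open>t \<le> 1 + t^2\<close> transfers
    the bound to \<open>g\<close> itself.\<close>
  have "g n \<le> 1 + S" for n using le_one_add_square[of "g n"] up_to_upper[OF S, of n] by (metis add_left_mono order_trans)
  then obtain G where G: "up_to g G" using up_to_ex[OF ginc] by blast
  have "G * G \<in> P" using ext_up_to(1)[OF up_to_mult[OF G G g0 g0] H_square_P[OF gH] gap1[of 0, simplified g_def, simplified, folded g_def]]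
    by simp
  then have GH: "G \<in> H" by (simp add: H_iff P_L)
  define y where "y n = x n + g n" for n
  have yinc: "incseq y"
  proof (rule incseq_SucI)
    fix n
    have "y (Suc n) - y n = (x (Suc n) - x n) + \<bar>x (Suc n) - x n\<bar>" by (simp add: y_def gS)
    then show "y n \<le> y (Suc n)" using add_abs_nonneg[of "x (Suc n) - x n"] by (metis diff_ge_0_iff_ge)
  qed
  \<comment> \<open>Since \<open>x - g\<close> decreases, \<open>y = (x - g) + 2 g\<close> is
    bounded by \<open>x m - g m + 2 G\<close>.\<close>
  have xg: "x n - g n \<le> x m - g m" if "m \<le> n" for m n
    using that
  proof (induction n rule: dec_induct)
    case (step n)
    have "x (Suc n) - g (Suc n) = (x n - g n) - (\<bar>x (Suc n) - x n\<bar> - (x (Suc n) - x n))" by (simp add: gS)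
    also have "\<dots> \<le> x n - g n - 0" by (rule diff_left_mono) (simp only: diff_ge_0_iff_ge abs_ge_self)
    finally show ?case using step.IH by simp
  qed simp
  have yb: "y n \<le> x m - g m + (G + G)" for m n
  proof (cases "m \<le> n")
    case True
    have "y n = (x n - g n) + (g n + g n)" by (simp add: y_def)
    also have "\<dots> \<le> x m - g m + (G + G)" using xg[OF True] up_to_upper[OF G] by (intro add_mono)
    finally show ?thesis .
  next
    case False
    then have "y n \<le> y m" using yinc by (auto simp: incseq_def)
    also have "\<dots> = (x m - g m) + (g m + g m)" by (simp add: y_def)
    also have "\<dots> \<le> x m - g m + (G + G)" using up_to_upper[OF G] by (intro add_mono) auto
    finally show ?thesis .
  qed
  obtain Y where Y: "up_to y Y" using up_to_ex[OF yinc yb[of _ 0]] by blast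
  define s where "s = Y - G"
  have diff: "\<bar>s - x m\<bar> \<le> G - g m" for m
  proof -
    have "Y \<le> x m - g m + (G + G)" by (rule up_to_least[OF Y yb])
    moreover have "x m + g m \<le> Y" using up_to_upper[OF Y, of m] by (simp add: y_def)
    ultimately show ?thesis by (intro abs_leI) (simp_all add: s_def algebra_simps)
  qed
  have GgH: "G - g m \<in> H" for m using GH gH by (rule H_diff)
  have Gg0: "0 \<le> G - g m" for m using up_to_upper[OF G, of m] by simp
  have diff': "\<bar>s - x m\<bar> \<le> \<bar>G - g m\<bar>" for m using diff[of m] Gg0[of m] by (simp add: abs_of_nonneg)
  have "s - x 0 \<in> H" by (rule H_ideal[OF GgH diff'])
  from H_add[OF this xH[of 0]] have "s \<in> H" by simp
  moreover have "N (s - x m) \<le> ((1 - r m) * (1 - r m)) *\<^sub>R b" for m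
  proof -
    \<comment> \<open>Starting at \<open>m\<close> keeps the terms nonnegative, so their squares
      increase to \<open>(G - g m)^2\<close> and monotone convergence carries the estimate to the
      limit.\<close>
    let ?h = "\<lambda>n. g (n + m) - g m"
    have "up_to (\<lambda>n. g (n + m)) G"
    proof (rule up_toI)
      show "incseq (\<lambda>n. g (n + m))" using ginc by (auto simp: incseq_def)
      show "g (n + m) \<le> G" for n using up_to_upper[OF G] .
      fix c assume c: "\<And>n. g (n + m) \<le> c"
      show "G \<le> c" by (rule up_to_least[OF G]) (use c up_to_mono[OF G] le_add1 order_trans in blast)
    qed
    then have h: "up_to ?h (G - g m)" using up_to_add_const[of "\<lambda>n. g (n + m)" G "- g m"] by simp
    have h0: "0 \<le> ?h n" for n using up_to_mono[OF G, of m "n + m"] by simp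
    have hb: "N (?h n) \<le> ((1 - r m) * (1 - r m)) *\<^sub>R b" for n by (rule gap1) simp
    have hP: "?h n * ?h n \<in> P" for n by (intro H_square_P H_diff gH)
    have "N (s - x m) \<le> N (G - g m)" by (rule N_mono[OF GgH diff'])
    also have "\<dots> \<le> ((1 - r m) * (1 - r m)) *\<^sub>R b"
      by (rule up_to_least[OF ext_up_to(2)[OF up_to_mult[OF h h h0 h0] hP hb] hb])
    finally show ?thesis .
  qed
  ultimately show ?thesis by blast
qed

end

section \<open>Square roots of operators\<close>

text \<open>The operator iteration with \<open>Z\<close> replaced by the number \<open>1\<close>. It
  is the majorant of both the iterates and their increments; its limit \<open>1\<close> is the
  double root of \<open>t = (1 + t^2) / 2\<close>.\<close>

primrec sqrt_rate :: "nat \<Rightarrow> real" where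
  "sqrt_rate 0 = 0"
| "sqrt_rate (Suc n) = (1 + sqrt_rate n * sqrt_rate n) / 2"

lemma sqrt_rate_bounds: "0 \<le> sqrt_rate n \<and> sqrt_rate n < 1"
proof (induction n)
  case (Suc n)
  then have "sqrt_rate n * sqrt_rate n < 1 * 1" by (intro mult_strict_mono') auto
  then show ?case using Suc by simp
qed simp

lemma incseq_sqrt_rate: "incseq sqrt_rate"
proof (rule incseq_SucI)
  fix n
  have "0 \<le> (1 - sqrt_rate n) * (1 - sqrt_rate n)" by simp
  then show "sqrt_rate n \<le> sqrt_rate (Suc n)" by (simp add: algebra_simps)
qed

lemma sqrt_rate_tendsto: "sqrt_rate \<longlonglongrightarrow> 1"
proof -
  obtain l where l: "sqrt_rate \<longlonglongrightarrow> l"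
    using incseq_convergent[OF incseq_sqrt_rate, of 1] sqrt_rate_bounds by (meson less_imp_le)
  have "(\<lambda>n. sqrt_rate (Suc n)) \<longlonglongrightarrow> (1 + l * l) / 2"
    unfolding sqrt_rate.simps by (intro tendsto_intros l) simp
  then have "l = (1 + l * l) / 2" using LIMSEQ_unique[OF LIMSEQ_Suc[OF l]] by blast
  then have "(1 - l) * (1 - l) = 0" by (simp add: field_simps)
  then show ?thesis using l by simp
qed

text \<open>A fixed point satisfies \<open>2 W = Z + W^2\<close>, equivalently
  \<open>(1 - W)^2 = 1 - Z\<close>. With \<open>Z = 1 - S^2\<close> this makes \<open>1 - W\<close>
  a square root of \<open>S^2\<close>.\<close>

primrec sqrt_iter :: "('a::{real_vector} \<Rightarrow> 'a) \<Rightarrow> nat \<Rightarrow> 'a \<Rightarrow> 'a" where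
  "sqrt_iter Z 0 x = 0"
| "sqrt_iter Z (Suc n) x = (1/2) *\<^sub>R (Z x + sqrt_iter Z n (sqrt_iter Z n x))"

context cond_exp
begin

lemma ip_add_right: "x \<in> H \<Longrightarrow> y \<in> H \<Longrightarrow> z \<in> H \<Longrightarrow> ip x (y + z) = ip x y + ip x z"
  by (simp add: distrib_left ext_add H_mult)

lemma ip_diff_right: "x \<in> H \<Longrightarrow> y \<in> H \<Longrightarrow> z \<in> H \<Longrightarrow> ip x (y - z) = ip x y - ip x z"
  by (simp add: right_diff_distrib ext_diff H_mult)

text \<open>These predicates look at values on \<open>H\<close> only and do not ask for
  extensionality, so operators can be written as plain lambda terms; restriction to \<open>H\<close>
  is applied at the end.\<close>

definition A_linear :: "('u \<Rightarrow> 'u) \<Rightarrow> bool" where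
  "A_linear S \<longleftrightarrow> (\<forall>x\<in>H. S x \<in> H) \<and> (\<forall>x\<in>H. \<forall>y\<in>H. S (x + y) = S x + S y) \<and>
     (\<forall>a\<in>A. \<forall>x\<in>H. S (a * x) = a * S x)"

definition strongly_bounded :: "('u \<Rightarrow> 'u) \<Rightarrow> bool" where
  "strongly_bounded S \<longleftrightarrow> (\<exists>k\<in>A. 0 \<le> k \<and> (\<forall>x\<in>H. N (S x) \<le> (k * k) * N x))"

definition symmetric :: "('u \<Rightarrow> 'u) \<Rightarrow> bool" where
  "symmetric S \<longleftrightarrow> (\<forall>x\<in>H. \<forall>y\<in>H. ip (S x) y = ip x (S y))"

definition positive :: "('u \<Rightarrow> 'u) \<Rightarrow> bool" where
  "positive S \<longleftrightarrow> (\<forall>x\<in>H. 0 \<le> ip (S x) x)"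

lemma
  assumes "A_linear S"
  shows A_linear_H: "x \<in> H \<Longrightarrow> S x \<in> H"
    and A_linear_add: "x \<in> H \<Longrightarrow> y \<in> H \<Longrightarrow> S (x + y) = S x + S y"
    and A_linear_mult: "a \<in> A \<Longrightarrow> x \<in> H \<Longrightarrow> S (a * x) = a * S x"
  using assms by (auto simp: A_linear_def)

lemma A_linear_scaleR:
  assumes "A_linear S" "x \<in> H"
  shows "S (c *\<^sub>R x) = c *\<^sub>R S x"
  using A_linear_mult[OF assms(1) A_scaleR[OF A_one] assms(2), of c] by simp

lemma A_linear_zero: "A_linear S \<Longrightarrow> S 0 = 0"
  using A_linear_scaleR[OF _ H_zero, of S 0] by simp

lemma A_linear_minus: "A_linear S \<Longrightarrow> x \<in> H \<Longrightarrow> S (- x) = - S x"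
  using A_linear_scaleR[of S x "- 1"] by simp

lemma A_linear_diff: "A_linear S \<Longrightarrow> x \<in> H \<Longrightarrow> y \<in> H \<Longrightarrow> S (x - y) = S x - S y"
  using A_linear_add[of S x "- y"] by (simp add: H_minus A_linear_minus)

lemma A_scaled_linear:
  assumes "A_linear S" "a \<in> A"
  shows "A_linear (\<lambda>x. a * S x)"
  using assms unfolding A_linear_def by (auto simp: H_A distrib_left mult.left_commute)

lemma N_add_le:
  assumes "x \<in> H" "y \<in> H"
  shows "N (x + y) \<le> 2 *\<^sub>R (N x + N y)"
proof -
  have "(x + y) * (x + y) + (x - y) * (x - y) = 2 *\<^sub>R (x * x + y * y)"
    by (simp add: algebra_simps scaleR_2)
  then have "(x + y) * (x + y) \<le> 2 *\<^sub>R (x * x + y * y)" by (metis le_add_same_cancel1 square_nonneg)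
  then have "N (x + y) \<le> \<tau> (2 *\<^sub>R (x * x + y * y))"
    by (intro ext_mono H_square H_add L_scaleR L_add assms)
  then show ?thesis using assms by (simp add: ext_scaleR ext_add L_add H_square)
qed

section \<open>Convergence at a fixed rate\<close>

text \<open>Only the factor \<open>b\<close> depends on the sequence; the real rate is always that
  of \<open>sqrt_rate\<close>. Sums and images under bounded operators then just change
  \<open>b\<close>, and no epsilon has to be shared between sequences.\<close>

definition lims :: "(nat \<Rightarrow> 'u) \<Rightarrow> 'u \<Rightarrow> bool" where
  "lims f s \<longleftrightarrow> s \<in> H \<and> (\<forall>n. f n \<in> H) \<and>
     (\<exists>b. 0 \<le> b \<and> (\<forall>n. N (s - f n) \<le> ((1 - sqrt_rate n) * (1 - sqrt_rate n)) *\<^sub>R b))"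

lemma limsI:
  "s \<in> H \<Longrightarrow> (\<And>n. f n \<in> H) \<Longrightarrow> 0 \<le> b \<Longrightarrow>
    (\<And>n. N (s - f n) \<le> ((1 - sqrt_rate n) * (1 - sqrt_rate n)) *\<^sub>R b) \<Longrightarrow> lims f s"
  by (auto simp: lims_def)

lemma rate_arch:
  assumes w: "\<And>n. w \<le> (1 - sqrt_rate n) *\<^sub>R b" and b: "0 \<le> (b :: 'u)"
  shows "w \<le> 0"
proof (rule le_eps_arch[of _ b])
  fix \<epsilon> :: real assume "0 < \<epsilon>"
  then have "eventually (\<lambda>n. 1 - \<epsilon> < sqrt_rate n) sequentially"
    by (intro order_tendstoD[OF sqrt_rate_tendsto]) simp
  then obtain n where "1 - \<epsilon> < sqrt_rate n" by (auto simp: eventually_sequentially)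
  then have "(1 - sqrt_rate n) *\<^sub>R b \<le> \<epsilon> *\<^sub>R b" using b by (intro scaleR_right_mono) auto
  with w show "w \<le> \<epsilon> *\<^sub>R b" by (rule order_trans)
qed

lemma rate_square_le:
  assumes "0 \<le> (b :: 'u)"
  shows "((1 - sqrt_rate n) * (1 - sqrt_rate n)) *\<^sub>R b \<le> (1 - sqrt_rate n) *\<^sub>R b"
proof (rule scaleR_right_mono[OF _ assms])
  show "(1 - sqrt_rate n) * (1 - sqrt_rate n) \<le> 1 - sqrt_rate n"
    using mult_left_mono[of "1 - sqrt_rate n" 1 "1 - sqrt_rate n"] sqrt_rate_bounds[of n] by simp
qed

lemma lims_add:
  assumes "lims f s" "lims g t"
  shows "lims (\<lambda>n. f n + g n) (s + t)"
proof -
  obtain b where b: "0 \<le> b" "\<And>n. N (s - f n) \<le> ((1 - sqrt_rate n) * (1 - sqrt_rate n)) *\<^sub>R b"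
    and f: "s \<in> H" "\<And>n. f n \<in> H" using assms(1) by (auto simp: lims_def)
  obtain c where c: "0 \<le> c" "\<And>n. N (t - g n) \<le> ((1 - sqrt_rate n) * (1 - sqrt_rate n)) *\<^sub>R c"
    and g: "t \<in> H" "\<And>n. g n \<in> H" using assms(2) by (auto simp: lims_def)
  show ?thesis
  proof (rule limsI)
    show "0 \<le> 2 *\<^sub>R (b + c)" using b c by (simp add: scaleR_nonneg_nonneg)
    fix n
    have "s + t - (f n + g n) = (s - f n) + (t - g n)" by simp
    then have "N (s + t - (f n + g n)) \<le> 2 *\<^sub>R (N (s - f n) + N (t - g n))"
      using N_add_le[of "s - f n" "t - g n"] f g by (simp only: H_diff)
    also have "\<dots> \<le> 2 *\<^sub>R (((1 - sqrt_rate n) * (1 - sqrt_rate n)) *\<^sub>R b + ((1 - sqrt_rate n) * (1 - sqrt_rate n)) *\<^sub>R c)"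
      by (intro scaleR_left_mono add_mono b c) simp
    finally show "N (s + t - (f n + g n)) \<le> ((1 - sqrt_rate n) * (1 - sqrt_rate n)) *\<^sub>R (2 *\<^sub>R (b + c))"
      by (simp add: scaleR_right_distrib mult.commute)
  qed (use f g in \<open>auto intro: H_add\<close>)
qed

lemma lims_bounded_op:
  assumes "lims f s" "A_linear Q" "strongly_bounded Q"
  shows "lims (\<lambda>n. Q (f n)) (Q s)"
proof -
  obtain b where b: "0 \<le> b" "\<And>n. N (s - f n) \<le> ((1 - sqrt_rate n) * (1 - sqrt_rate n)) *\<^sub>R b"
    and f: "s \<in> H" "\<And>n. f n \<in> H" using assms(1) by (auto simp: lims_def)
  obtain k where k: "k \<in> A" "0 \<le> k" "\<And>x. x \<in> H \<Longrightarrow> N (Q x) \<le> (k * k) * N x"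
    using assms(3) by (auto simp: strongly_bounded_def)
  show ?thesis
  proof (rule limsI)
    show "0 \<le> (k * k) * b" using b by simp
    fix n
    have "N (Q s - Q (f n)) \<le> (k * k) * N (s - f n)"
      using k(3)[of "s - f n"] f by (simp add: H_diff A_linear_diff[OF assms(2)])
    also have "\<dots> \<le> (k * k) * (((1 - sqrt_rate n) * (1 - sqrt_rate n)) *\<^sub>R b)"
      by (intro mult_left_mono b) simp
    finally show "N (Q s - Q (f n)) \<le> ((1 - sqrt_rate n) * (1 - sqrt_rate n)) *\<^sub>R ((k * k) * b)" by simp
  qed (use f A_linear_H[OF assms(2)] in auto)
qed

lemma scaled_bounded:
  assumes "a \<in> A"
  shows "A_linear (\<lambda>x. a * x)" "strongly_bounded (\<lambda>x. a * x)"
proof -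
  show "A_linear (\<lambda>x. a * x)"
    using assms by (auto simp: A_linear_def H_A distrib_left mult.left_commute)
  have "N (a * x) \<le> (\<bar>a\<bar> * \<bar>a\<bar>) * N x" if "x \<in> H" for x
    by (simp add: N_A_mult assms that abs_mult_abs)
  then show "strongly_bounded (\<lambda>x. a * x)"
    unfolding strongly_bounded_def using A_abs[OF assms] by (intro bexI[of _ "\<bar>a\<bar>"]) auto
qed

lemma lims_A: "lims f s \<Longrightarrow> a \<in> A \<Longrightarrow> lims (\<lambda>n. a * f n) (a * s)"
  by (rule lims_bounded_op) (auto intro: scaled_bounded)

lemma lims_scaleR: "lims f s \<Longrightarrow> lims (\<lambda>n. c *\<^sub>R f n) (c *\<^sub>R s)"
  using lims_A[of f s "c *\<^sub>R 1"] by (simp add: A_scaleR A_one)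

lemma lims_const: "x \<in> H \<Longrightarrow> lims (\<lambda>_. x) x"
  by (rule limsI[of _ _ 0]) (auto simp: ext_zero)

lemma lims_zero:
  assumes "lims (\<lambda>_. 0) s"
  shows "s = 0"
proof -
  obtain b where b: "0 \<le> b" "\<And>n. N s \<le> ((1 - sqrt_rate n) * (1 - sqrt_rate n)) *\<^sub>R b" "s \<in> H"
    using assms by (auto simp: lims_def)
  have "N s \<le> 0" by (rule rate_arch[OF order_trans[OF b(2) rate_square_le[OF b(1)]] b(1)])
  then show ?thesis using b(3) N_nonneg[of s] by (intro N_eq_zero[OF b(3)] antisym)
qed

lemma lims_unique:
  assumes "lims f s" "lims f t"
  shows "s = t"
proof -
  have "lims (\<lambda>n. f n + (- 1) *\<^sub>R f n) (s + (- 1) *\<^sub>R t)"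
    by (rule lims_add[OF assms(1) lims_scaleR[OF assms(2)]])
  then have "s + (- 1) *\<^sub>R t = 0" by (intro lims_zero) simp
  then show ?thesis by simp
qed

text \<open>Instead of Cauchy-Schwarz, \<open>|d y| \<le> d^2 / e + e y^2\<close> is used with the
  weight \<open>e = 1 - sqrt_rate n > 0\<close>. As \<open>N d\<close> is of order
  \<open>e^2\<close>, both terms are of order \<open>e\<close>.\<close>

lemma lims_ip:
  assumes "lims f s" "y \<in> H"
  shows "\<exists>b. 0 \<le> b \<and> (\<forall>n. \<bar>ip (s - f n) y\<bar> \<le> (1 - sqrt_rate n) *\<^sub>R b)"
proof -
  obtain b where b: "0 \<le> b" "\<And>n. N (s - f n) \<le> ((1 - sqrt_rate n) * (1 - sqrt_rate n)) *\<^sub>R b"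
    and f: "s \<in> H" "\<And>n. f n \<in> H" using assms(1) by (auto simp: lims_def)
  have "\<bar>ip (s - f n) y\<bar> \<le> (1 - sqrt_rate n) *\<^sub>R (b + N y)" for n
  proof -
    let ?e = "1 - sqrt_rate n"
    let ?d = "s - f n"
    have e: "0 < ?e" using sqrt_rate_bounds[of n] by simp
    have d: "?d \<in> H" using f by (intro H_diff)
    let ?q = "(1 / ?e) *\<^sub>R (?d * ?d) + ?e *\<^sub>R (y * y)"
    have "\<bar>?d * y\<bar> = ?e *\<^sub>R \<bar>((1 / ?e) *\<^sub>R ?d) * y\<bar>" using e by (simp add: abs_scaleR)
    also have "\<dots> \<le> ?e *\<^sub>R (((1 / ?e) *\<^sub>R ?d) * ((1 / ?e) *\<^sub>R ?d) + y * y)"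
      using e by (intro scaleR_left_mono abs_mult_le_squares) simp
    also have "\<dots> = ?q" using e by (simp add: scaleR_right_distrib)
    finally have le: "\<bar>?d * y\<bar> \<le> ?q" .
    have L: "?d * y \<in> L" "?q \<in> L" using d assms(2) by (auto intro!: H_mult L_add L_scaleR H_square)
    have "\<tau> (?d * y) \<le> \<tau> ?q" using le by (intro ext_mono L) (simp add: abs_le_iff)
    moreover have "- \<tau> (?d * y) \<le> \<tau> ?q"
      using ext_mono[OF L_minus[OF L(1)] L(2)] le L by (simp add: abs_le_iff ext_minus)
    ultimately have "\<bar>ip ?d y\<bar> \<le> \<tau> ?q" by (rule abs_leI)
    also have "\<dots> = (1 / ?e) *\<^sub>R N ?d + ?e *\<^sub>R N y"
      using d assms(2) by (simp add: ext_add ext_scaleR L_scaleR H_square)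
    also have "\<dots> \<le> (1 / ?e) *\<^sub>R (?e * ?e) *\<^sub>R b + ?e *\<^sub>R N y"
      using b e by (intro add_right_mono scaleR_left_mono) auto
    also have "\<dots> = ?e *\<^sub>R (b + N y)" using e by (simp add: scaleR_right_distrib)
    finally show ?thesis .
  qed
  moreover have "0 \<le> b + N y" using b N_nonneg[OF assms(2)] by simp
  ultimately show ?thesis by blast
qed

lemma ip_lims_eq:
  assumes f: "lims f s" and g: "lims g t" and xy: "x \<in> H" "y \<in> H"
    and eq: "\<And>n. ip (f n) y = ip x (g n)"
  shows "ip s y = ip x t"
proof -
  obtain b where b: "0 \<le> b" "\<And>n. \<bar>ip (s - f n) y\<bar> \<le> (1 - sqrt_rate n) *\<^sub>R b"
    using lims_ip[OF f xy(2)] by blast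
  obtain c where c: "0 \<le> c" "\<And>n. \<bar>ip (t - g n) x\<bar> \<le> (1 - sqrt_rate n) *\<^sub>R c"
    using lims_ip[OF g xy(1)] by blast
  have H: "s \<in> H" "t \<in> H" "f n \<in> H" "g n \<in> H" for n using f g by (auto simp: lims_def)
  have "\<bar>ip s y - ip x t\<bar> \<le> (1 - sqrt_rate n) *\<^sub>R (b + c)" for n
  proof -
    have "ip s y - ip x t = ip (s - f n) y - ip (t - g n) x"
      using H xy eq[of n] by (simp add: ip_diff ip_commute[of x])
    also have "\<bar>\<dots>\<bar> \<le> \<bar>ip (s - f n) y\<bar> + \<bar>ip (t - g n) x\<bar>" by (rule abs_triangle_ineq4)
    also have "\<dots> \<le> (1 - sqrt_rate n) *\<^sub>R (b + c)"
      unfolding scaleR_right_distrib by (rule add_mono[OF b(2) c(2)])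
    finally show ?thesis .
  qed
  then have "\<bar>ip s y - ip x t\<bar> \<le> 0" by (rule rate_arch) (use b c in simp)
  then show ?thesis by simp
qed

section \<open>The iteration for a contraction\<close>

context
  fixes Z :: "'u \<Rightarrow> 'u"
  assumes Z: "A_linear Z" and Z1: "\<And>x. x \<in> H \<Longrightarrow> N (Z x) \<le> N x"
begin

abbreviation "Y \<equiv> sqrt_iter Z"
abbreviation "r \<equiv> sqrt_rate"

lemma Y_linear: "A_linear (Y n)"
proof (induction n)
  case 0
  then show ?case by (simp add: A_linear_def H_zero)
next
  case (Suc n)
  note l = A_linear_H[OF Z] A_linear_H[OF Suc] A_linear_add[OF Z] A_linear_add[OF Suc] A_linear_mult[OF Z] A_linear_mult[OF Suc]
  show ?case by (auto simp: A_linear_def l H_scaleR H_add algebra_simps)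
qed

lemmas Y_H = A_linear_H[OF Y_linear]

lemma Y_bound: "x \<in> H \<Longrightarrow> N (Y n x) \<le> (r n * r n) *\<^sub>R N x"
proof (induction n arbitrary: x)
  case 0
  then show ?case by (simp add: ext_zero)
next
  case (Suc n)
  have "N (Z x + Y n (Y n x)) \<le> ((1 + r n * r n) * (1 + r n * r n)) *\<^sub>R N x"
  proof (rule N_triangle)
    show "N (Z x) \<le> (1 * 1) *\<^sub>R N x" using Z1[OF Suc.prems] by simp
    have "N (Y n (Y n x)) \<le> (r n * r n) *\<^sub>R N (Y n x)" by (intro Suc.IH Y_H Suc.prems)
    also have "\<dots> \<le> (r n * r n) *\<^sub>R (r n * r n) *\<^sub>R N x" by (intro scaleR_left_mono Suc) simp
    finally show "N (Y n (Y n x)) \<le> (r n * r n * (r n * r n)) *\<^sub>R N x" by simp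
  qed (use Suc.prems in \<open>auto intro: Y_H A_linear_H[OF Z]\<close>)
  then have "(1 / 2 * (1 / 2)) *\<^sub>R N (Z x + Y n (Y n x))
      \<le> (1 / 2 * (1 / 2)) *\<^sub>R ((1 + r n * r n) * (1 + r n * r n)) *\<^sub>R N x"
    by (rule scaleR_left_mono) simp
  moreover have "N (Y (Suc n) x) = (1 / 2 * (1 / 2)) *\<^sub>R N (Z x + Y n (Y n x))"
    unfolding sqrt_iter.simps by (rule N_scaleR) (intro H_add Y_H A_linear_H[OF Z] Suc.prems)
  ultimately show ?case by simp
qed

text \<open>Each iterate is a polynomial in \<open>Z\<close>.\<close>

lemma Y_commute:
  assumes Q: "A_linear Q" and QZ: "\<And>x. x \<in> H \<Longrightarrow> Q (Z x) = Z (Q x)" and x: "x \<in> H"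
  shows "Q (Y n x) = Y n (Q x)"
  using x
proof (induction n arbitrary: x)
  case 0
  then show ?case by (simp add: A_linear_zero[OF Q])
next
  case (Suc n)
  then show ?case
    by (simp add: A_linear_scaleR[OF Q] A_linear_add[OF Q] H_add Y_H A_linear_H[OF Z] QZ)
qed

lemma YY_commute: "x \<in> H \<Longrightarrow> Y m (Y n x) = Y n (Y m x)"
  by (intro Y_commute Y_linear) (simp_all add: Y_commute[OF Z])

text \<open>Commuting iterates satisfy
  \<open>Y_{n+2} - Y_{n+1} = (1/2) (Y_{n+1} + Y_n) (Y_{n+1} - Y_n)\<close>. The rates obey the same
  identity, so the bound propagates with no loss.\<close>

lemma Y_step: "x \<in> H \<Longrightarrow> N (Y (Suc n) x - Y n x) \<le> ((r (Suc n) - r n) * (r (Suc n) - r n)) *\<^sub>R N x"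
proof (induction n arbitrary: x)
  case 0
  then show ?case using Y_bound[of x 1] by simp
next
  case (Suc n)
  let ?h = "Y (Suc n) x - Y n x"
  have h: "?h \<in> H" by (intro H_diff Y_H Suc.prems)
  let ?g = "Y (Suc n) ?h + Y n ?h"
  have "?g = Y (Suc n) (Y (Suc n) x) - Y n (Y n x)"
    using YY_commute[OF Suc.prems, of n "Suc n"] Suc.prems
    by (simp add: A_linear_diff[OF Y_linear] Y_H del: sqrt_iter.simps)
  then have "Y (Suc (Suc n)) x - Y (Suc n) x = (1 / 2) *\<^sub>R ?g"
    by (simp only: sqrt_iter.simps(2)[of Z "Suc n"] sqrt_iter.simps(2)[of Z n x])
       (simp add: scaleR_right_diff_distrib[symmetric] del: sqrt_iter.simps)
  then have "N (Y (Suc (Suc n)) x - Y (Suc n) x) = (1 / 2 * (1 / 2)) *\<^sub>R N ?g"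
    using N_scaleR[of ?g "1 / 2"] h by (simp only: H_add Y_H)
  also have "\<dots> \<le> (1 / 2 * (1 / 2)) *\<^sub>R ((r (Suc n) + r n) * (r (Suc n) + r n)) *\<^sub>R N ?h"
    using sqrt_rate_bounds by (intro scaleR_left_mono N_triangle Y_bound Y_H h) (auto simp del: sqrt_rate.simps)
  also have "\<dots> \<le> (1 / 2 * (1 / 2)) *\<^sub>R ((r (Suc n) + r n) * (r (Suc n) + r n)) *\<^sub>R
      ((r (Suc n) - r n) * (r (Suc n) - r n)) *\<^sub>R N x"
    by (intro scaleR_left_mono Suc) simp_all
  also have "\<dots> = ((1/2 * (r (Suc n) + r n) * (r (Suc n) - r n)) * (1/2 * (r (Suc n) + r n) * (r (Suc n) - r n))) *\<^sub>R N x"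
    by (simp only: scaleR_scaleR) (simp only: ac_simps)
  also have "1/2 * (r (Suc n) + r n) * (r (Suc n) - r n) = r (Suc (Suc n)) - r (Suc n)"
    unfolding sqrt_rate.simps(2)[of "Suc n"] by (subst (5) sqrt_rate.simps(2)) (simp add: field_simps del: sqrt_rate.simps)
  finally show ?case .
qed

lemma Y_lim_ex: "\<exists>W. \<forall>x\<in>H. lims (\<lambda>n. Y n x) (W x) \<and>
    (\<forall>n. N (W x - Y n x) \<le> ((1 - r n) * (1 - r n)) *\<^sub>R N x)"
proof (intro bchoice ballI)
  fix x assume x: "x \<in> H"
  obtain s where s: "s \<in> H" "\<And>n. N (s - Y n x) \<le> ((1 - r n) * (1 - r n)) *\<^sub>R N x"
    using L2_complete[of "\<lambda>n. Y n x" r "N x"] Y_H[OF x] incseq_sqrt_rate sqrt_rate_bounds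
      Y_step[OF x] N_nonneg[OF x] by (auto simp: less_imp_le)
  then have "lims (\<lambda>n. Y n x) s" using Y_H[OF x] N_nonneg[OF x] by (intro limsI) auto
  with s show "\<exists>s. lims (\<lambda>n. Y n x) s \<and> (\<forall>n. N (s - Y n x) \<le> ((1 - r n) * (1 - r n)) *\<^sub>R N x)" by blast
qed

lemma fixed_point_ex:
  "\<exists>W. A_linear W \<and> (\<forall>x\<in>H. N (W x) \<le> N x) \<and> (\<forall>x\<in>H. 2 *\<^sub>R W x = Z x + W (W x)) \<and>
    (symmetric Z \<longrightarrow> symmetric W) \<and>
    (\<forall>Q. A_linear Q \<longrightarrow> strongly_bounded Q \<longrightarrow> (\<forall>x\<in>H. Q (Z x) = Z (Q x)) \<longrightarrow> (\<forall>x\<in>H. Q (W x) = W (Q x)))"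
proof -
  obtain W where W: "\<And>x. x \<in> H \<Longrightarrow> lims (\<lambda>n. Y n x) (W x)"
    and Wn: "\<And>x n. x \<in> H \<Longrightarrow> N (W x - Y n x) \<le> ((1 - r n) * (1 - r n)) *\<^sub>R N x"
    using Y_lim_ex by blast
  have WH: "W x \<in> H" if "x \<in> H" for x using W[OF that] by (simp add: lims_def)
  have "W (x + y) = W x + W y" if "x \<in> H" "y \<in> H" for x y
  proof (rule lims_unique)
    show "lims (\<lambda>n. Y n (x + y)) (W (x + y))" using that by (intro W H_add)
    show "lims (\<lambda>n. Y n (x + y)) (W x + W y)"
      using lims_add[OF W[OF that(1)] W[OF that(2)]] that by (simp add: A_linear_add[OF Y_linear])
  qed
  moreover have "W (a * x) = a * W x" if "a \<in> A" "x \<in> H" for a x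
  proof (rule lims_unique)
    show "lims (\<lambda>n. Y n (a * x)) (W (a * x))" using that by (intro W H_A)
    show "lims (\<lambda>n. Y n (a * x)) (a * W x)"
      using lims_A[OF W[OF that(2)] that(1)] that by (simp add: A_linear_mult[OF Y_linear])
  qed
  ultimately have lin: "A_linear W" using WH by (simp add: A_linear_def)
  have contr: "N (W x) \<le> N x" if "x \<in> H" for x using Wn[OF that, of 0] by simp
  have fixp: "2 *\<^sub>R W x = Z x + W (W x)" if x: "x \<in> H" for x
  proof -
    let ?b = "2 *\<^sub>R (N (W x) + N x)"
    have b0: "0 \<le> ?b" using x by (intro scaleR_nonneg_nonneg add_nonneg_nonneg N_nonneg WH) simp_all
    have YY: "lims (\<lambda>n. Y n (Y n x)) (W (W x))"
    proof (rule limsI[OF _ _ b0])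
      fix n
      let ?e = "(1 - r n) * (1 - r n)"
      have d: "W x - Y n x \<in> H" "W (W x) - Y n (W x) \<in> H" using x by (auto intro!: H_diff WH Y_H)
      \<comment> \<open>The split needs convergence at the two points \<open>W x\<close> and
        \<open>x\<close> only, since \<open>Y n\<close> is itself a contraction.\<close>
      have e: "W (W x) - Y n (Y n x) = (W (W x) - Y n (W x)) + Y n (W x - Y n x)"
        using x by (simp add: A_linear_diff[OF Y_linear] WH Y_H)
      have "N (W (W x) - Y n (Y n x)) \<le> 2 *\<^sub>R (N (W (W x) - Y n (W x)) + N (Y n (W x - Y n x)))"
        unfolding e by (rule N_add_le[OF d(2) Y_H[OF d(1)]])
      also have "\<dots> \<le> 2 *\<^sub>R (?e *\<^sub>R N (W x) + ?e *\<^sub>R N x)"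
      proof (intro scaleR_left_mono add_mono)
        show "N (W (W x) - Y n (W x)) \<le> ?e *\<^sub>R N (W x)" using x by (intro Wn WH)
        have "r n * r n \<le> 1 * 1" using sqrt_rate_bounds[of n] by (intro mult_mono) auto
        then have "(r n * r n) *\<^sub>R N (W x - Y n x) \<le> 1 *\<^sub>R N (W x - Y n x)"
          using N_nonneg[OF d(1)] by (intro scaleR_right_mono) auto
        also have "\<dots> \<le> ?e *\<^sub>R N x" using Wn[OF x] by simp
        finally show "N (Y n (W x - Y n x)) \<le> ?e *\<^sub>R N x" using Y_bound[OF d(1)] by (rule order_trans[rotated])
      qed simp
      finally show "N (W (W x) - Y n (Y n x)) \<le> ?e *\<^sub>R ?b" by (simp add: scaleR_right_distrib mult.commute)
    qed (use x in \<open>auto intro: WH Y_H\<close>)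
    have "lims (\<lambda>n. Y (Suc n) x) ((1/2) *\<^sub>R (Z x + W (W x)))"
      unfolding sqrt_iter.simps using x by (intro lims_scaleR lims_add YY lims_const A_linear_H[OF Z])
    \<comment> \<open>\<open>lims\<close> ties the rate to the index; the shifted sequence is one
      step better than required.\<close>
    moreover have "lims (\<lambda>n. Y (Suc n) x) (W x)"
    proof (rule limsI[OF WH[OF x] Y_H[OF x] N_nonneg[OF x]])
      fix n
      have rn: "0 \<le> 1 - r (Suc n)" "1 - r (Suc n) \<le> 1 - r n"
        using sqrt_rate_bounds[of "Suc n"] incseq_SucD[OF incseq_sqrt_rate, of n] by linarith+
      show "N (W x - Y (Suc n) x) \<le> ((1 - r n) * (1 - r n)) *\<^sub>R N x"
        by (rule order_trans[OF Wn[OF x] scaleR_right_mono[OF mult_mono[OF rn(2) rn(2)] N_nonneg[OF x]]])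
           (use rn in auto)
    qed
    ultimately have "W x = (1/2) *\<^sub>R (Z x + W (W x))" by (rule lims_unique[rotated])
    then have "2 *\<^sub>R W x = 2 *\<^sub>R (1/2) *\<^sub>R (Z x + W (W x))" by (rule arg_cong)
    then show ?thesis by simp
  qed
  have symm: "symmetric W" if Zs: "symmetric Z"
  proof -
    have "ip (Y n x) y = ip x (Y n y)" if "x \<in> H" "y \<in> H" for n x y
      using that
    proof (induction n arbitrary: x y)
      case (Suc n)
      have "ip (Z x) y = ip x (Z y)" using Zs Suc.prems by (simp add: symmetric_def)
      moreover have "ip (Y n (Y n x)) y = ip x (Y n (Y n y))" using Suc by (simp add: Y_H)
      ultimately have "ip (Z x + Y n (Y n x)) y = ip x (Z y + Y n (Y n y))"
        using Suc.prems by (simp add: ip_add ip_add_right Y_H A_linear_H[OF Z])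
      then show ?case
        using Suc.prems by (simp add: ext_scaleR H_mult H_add Y_H A_linear_H[OF Z])
    qed simp
    then show ?thesis unfolding symmetric_def using ip_lims_eq[OF W W] by blast
  qed
  have comm: "Q (W x) = W (Q x)" if "A_linear Q" "strongly_bounded Q" "\<forall>x\<in>H. Q (Z x) = Z (Q x)" "x \<in> H" for Q x
  proof (rule lims_unique)
    show "lims (\<lambda>n. Q (Y n x)) (Q (W x))" by (rule lims_bounded_op[OF W[OF that(4)] that(1,2)])
    have "Q (Y n x) = Y n (Q x)" for n using that by (intro Y_commute) auto
    then show "lims (\<lambda>n. Q (Y n x)) (W (Q x))" using W[OF A_linear_H[OF that(1,4)]] by simp
  qed
  show ?thesis using lin contr fixp symm comm by blast
qed

end

section \<open>Existence and uniqueness of positive roots\<close>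

lemma A_linear_comp: "A_linear S \<Longrightarrow> A_linear R \<Longrightarrow> A_linear (\<lambda>x. S (R x))"
  by (simp add: A_linear_def)

lemma A_linear_diff_op:
  assumes "A_linear S" "A_linear R"
  shows "A_linear (\<lambda>x. S x - R x)"
  using assms unfolding A_linear_def by (auto simp: H_diff right_diff_distrib)

lemma A_linear_id: "A_linear (\<lambda>x. x)"
  by (simp add: A_linear_def)

text \<open>The root is \<open>C = 1 - W\<close>. Its positivity is that of a contraction subtracted
  from the identity: \<open>0 \<le> N (x - W x) \<le> 2 \<langle>C x, x\<rangle>\<close>. Bounded
  operators that commute with \<open>S^2\<close> commute with \<open>Z\<close>, hence with the limit
  \<open>W\<close>.\<close>

lemma contraction_sqrt_ex:
  assumes S: "A_linear S" "symmetric S" and S1: "\<And>x. x \<in> H \<Longrightarrow> N (S x) \<le> N x"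
  shows "\<exists>C. A_linear C \<and> strongly_bounded C \<and> symmetric C \<and> positive C \<and> (\<forall>x\<in>H. C (C x) = S (S x)) \<and>
    (\<forall>Q. A_linear Q \<longrightarrow> strongly_bounded Q \<longrightarrow> (\<forall>x\<in>H. Q (S (S x)) = S (S (Q x))) \<longrightarrow>
      (\<forall>x\<in>H. Q (C x) = C (Q x)))"
proof -
  note SH = A_linear_H[OF S(1)]
  have ipS: "ip (S x) y = ip x (S y)" if "x \<in> H" "y \<in> H" for x y using S(2) that by (simp add: symmetric_def)
  define Z where "Z x = x - S (S x)" for x
  have Z: "A_linear Z" unfolding Z_def by (rule A_linear_diff_op[OF A_linear_id A_linear_comp[OF S(1) S(1)]])
  have Z1: "N (Z x) \<le> N x" if x: "x \<in> H" for x
  proof -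
    have "N (Z x) = N x - N (S x) - (N (S x) - N (S (S x)))"
      using x ipS[of "S x" x] ipS[of x "S x"]
      by (simp add: Z_def ip_diff ip_diff_right H_diff SH)
    also have "\<dots> \<le> N x - 0 - 0" using N_nonneg[OF SH[OF x]] S1[OF SH[OF x]] by (intro diff_mono) auto
    finally show ?thesis by simp
  qed
  have Zs: "symmetric Z"
    unfolding symmetric_def Z_def by (simp add: ip_diff ip_diff_right SH ipS)
  obtain W where W: "A_linear W" "\<And>x. x \<in> H \<Longrightarrow> N (W x) \<le> N x" "\<And>x. x \<in> H \<Longrightarrow> 2 *\<^sub>R W x = Z x + W (W x)"
    "symmetric W" "\<And>Q x. A_linear Q \<Longrightarrow> strongly_bounded Q \<Longrightarrow> (\<And>x. x \<in> H \<Longrightarrow> Q (Z x) = Z (Q x)) \<Longrightarrow> x \<in> H \<Longrightarrow> Q (W x) = W (Q x)"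
    using fixed_point_ex[OF Z Z1] Zs by blast
  note WH = A_linear_H[OF W(1)]
  define C where "C x = x - W x" for x
  have C: "A_linear C" unfolding C_def by (rule A_linear_diff_op[OF A_linear_id W(1)])
  have "strongly_bounded C"
    unfolding strongly_bounded_def
  proof (intro bexI conjI ballI)
    fix x assume x: "x \<in> H"
    have "N (x + (- 1) *\<^sub>R W x) \<le> ((1 + 1) * (1 + 1)) *\<^sub>R N x"
      using x W(2)[OF x] by (intro N_triangle) (auto simp: WH H_minus)
    then show "N (C x) \<le> ((2 *\<^sub>R 1) * (2 *\<^sub>R 1)) * N x" by (simp add: C_def)
  qed (auto simp: scaleR_nonneg_nonneg intro: A_scaleR A_one)
  moreover have "symmetric C"
    using W(4) unfolding symmetric_def C_def by (simp add: ip_diff ip_diff_right WH)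
  moreover have "positive C"
    unfolding positive_def
  proof
    fix x assume x: "x \<in> H"
    have "0 \<le> N (x - W x)" using x by (intro N_nonneg H_diff WH)
    also have "\<dots> = N x + N (W x) - 2 *\<^sub>R ip (W x) x"
      using x ip_commute[of "W x" x] by (simp add: ip_diff ip_diff_right H_diff WH scaleR_2)
    also have "\<dots> \<le> N x + N x - 2 *\<^sub>R ip (W x) x" using W(2)[OF x] by simp
    also have "\<dots> = 2 *\<^sub>R ip (C x) x" using x by (simp add: C_def ip_diff WH scaleR_2)
    finally have "(1/2) *\<^sub>R 0 \<le> (1/2) *\<^sub>R 2 *\<^sub>R ip (C x) x" by (intro scaleR_left_mono) auto
    then show "0 \<le> ip (C x) x" by simp
  qed
  moreover have "C (C x) = S (S x)" if x: "x \<in> H" for x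
  proof -
    have "C (C x) = x - 2 *\<^sub>R W x + W (W x)" using x by (simp add: C_def A_linear_diff[OF W(1)] WH scaleR_2)
    also have "\<dots> = S (S x)" by (simp add: W(3)[OF x] Z_def)
    finally show ?thesis .
  qed
  moreover have "Q (C x) = C (Q x)" if Q: "A_linear Q" "strongly_bounded Q" "\<forall>x\<in>H. Q (S (S x)) = S (S (Q x))"
    and x: "x \<in> H" for Q x
  proof -
    have "Q (Z x) = Z (Q x)" if "x \<in> H" for x using that Q by (simp add: Z_def A_linear_diff[OF Q(1)] SH)
    then have "Q (W x) = W (Q x)" by (rule W(5)[OF Q(1,2) _ x])
    then show ?thesis by (simp add: C_def A_linear_diff[OF Q(1)] x WH)
  qed
  ultimately show ?thesis using C by blast
qed

lemma sqrt_ex: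
  assumes S: "A_linear S" "symmetric S" "strongly_bounded S"
  shows "\<exists>C. A_linear C \<and> strongly_bounded C \<and> symmetric C \<and> positive C \<and> (\<forall>x\<in>H. C (C x) = S (S x)) \<and>
    (\<forall>Q. A_linear Q \<longrightarrow> strongly_bounded Q \<longrightarrow> (\<forall>x\<in>H. Q (S (S x)) = S (S (Q x))) \<longrightarrow>
      (\<forall>x\<in>H. Q (C x) = C (Q x)))"
proof -
  note SH = A_linear_H[OF S(1)]
  obtain k where k: "k \<in> A" "0 \<le> k" "\<And>x. x \<in> H \<Longrightarrow> N (S x) \<le> (k * k) * N x"
    using S(3) by (auto simp: strongly_bounded_def)
  \<comment> \<open>The bound \<open>k\<close> need not be invertible in \<open>A\<close>, but
    \<open>1 + k \<ge> 1\<close> is; its inverse \<open>v\<close> satisfies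
    \<open>v k = 1 - v \<le> 1\<close>, so \<open>v S\<close> is a contraction.\<close>
  define u where "u = 1 + k"
  have u: "u \<in> A" "1 \<le> u" using k by (auto simp: u_def intro: A_add A_one)
  have u0: "0 \<le> u" using u(2) one_nonneg by (rule order_trans[rotated])
  obtain v where v: "v \<in> A" "0 \<le> v" "u * v = 1" using A_inverse[OF u] by blast
  define R where "R x = v * S x" for x
  have R: "A_linear R" unfolding R_def by (rule A_scaled_linear[OF S(1) v(1)])
  have RR: "R (R x) = (v * v) * S (S x)" if "x \<in> H" for x
    using that by (simp add: R_def A_linear_mult[OF S(1)] v SH mult.assoc)
  have "symmetric R"
    using S(2) unfolding symmetric_def R_def
    by (simp add: mult.assoc mult.left_commute[of _ v] averaging v H_mult SH)
  moreover have "N (R x) \<le> N x" if x: "x \<in> H" for x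
  proof -
    have "v * k = 1 - v" using v(3) by (simp add: u_def distrib_right mult.commute[of v] eq_diff_eq add.commute)
    then have vk: "v * k \<le> 1" using v(2) by simp
    have "N (R x) = (v * v) * N (S x)" unfolding R_def by (rule N_A_mult[OF v(1) SH[OF x]])
    also have "\<dots> \<le> (v * v) * ((k * k) * N x)" by (intro mult_left_mono k x) simp
    also have "\<dots> = ((v * k) * (v * k)) * N x" by (simp add: ac_simps)
    also have "\<dots> \<le> (1 * 1) * N x"
      using vk v k by (intro mult_right_mono mult_mono N_nonneg x) auto
    finally show ?thesis by simp
  qed
  ultimately obtain C where C: "A_linear C" "strongly_bounded C" "symmetric C" "positive C"
    "\<And>x. x \<in> H \<Longrightarrow> C (C x) = R (R x)"
    "\<And>Q. A_linear Q \<Longrightarrow> strongly_bounded Q \<Longrightarrow> (\<And>x. x \<in> H \<Longrightarrow> Q (R (R x)) = R (R (Q x))) \<Longrightarrow> (\<forall>x\<in>H. Q (C x) = C (Q x))"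
    using contraction_sqrt_ex[OF R] by blast
  note CH = A_linear_H[OF C(1)]
  define D where "D x = u * C x" for x
  have D: "A_linear D" unfolding D_def by (rule A_scaled_linear[OF C(1) u(1)])
  obtain c where c: "c \<in> A" "0 \<le> c" "\<And>x. x \<in> H \<Longrightarrow> N (C x) \<le> (c * c) * N x"
    using C(2) by (auto simp: strongly_bounded_def)
  have "strongly_bounded D"
    unfolding strongly_bounded_def
  proof (intro bexI conjI ballI)
    fix x assume x: "x \<in> H"
    have "N (D x) = (u * u) * N (C x)" unfolding D_def by (rule N_A_mult[OF u(1) CH[OF x]])
    also have "\<dots> \<le> (u * u) * ((c * c) * N x)" by (intro mult_left_mono c x) simp
    finally show "N (D x) \<le> ((u * c) * (u * c)) * N x" by (simp add: ac_simps)
  qed (use u u0 c in \<open>auto intro: A_mult\<close>)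
  moreover have "symmetric D"
    using C(3) unfolding symmetric_def D_def
    by (simp add: mult.assoc mult.left_commute[of _ u] averaging u H_mult CH)
  moreover have "positive D"
    using C(4) u0 unfolding positive_def D_def by (simp add: ip_A[OF u(1)] CH)
  moreover have "D (D x) = S (S x)" if x: "x \<in> H" for x
  proof -
    have "D (D x) = (u * u) * C (C x)" using x by (simp add: D_def A_linear_mult[OF C(1)] u CH mult.assoc)
    also have "\<dots> = ((u * v) * (u * v)) * S (S x)" by (simp add: C(5)[OF x] RR[OF x] ac_simps)
    finally show ?thesis by (simp add: v)
  qed
  moreover have "Q (D x) = D (Q x)" if Q: "A_linear Q" "strongly_bounded Q" "\<forall>x\<in>H. Q (S (S x)) = S (S (Q x))"
    and x: "x \<in> H" for Q x
  proof -
    have "Q (R (R x)) = R (R (Q x))" if "x \<in> H" for x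
      using that Q by (simp add: RR A_linear_mult[OF Q(1)] A_mult v SH A_linear_H[OF Q(1)])
    then have "Q (C x) = C (Q x)" using C(6)[OF Q(1,2)] x by blast
    then show ?thesis by (simp add: D_def A_linear_mult[OF Q(1) u(1)] x CH)
  qed
  ultimately show ?thesis using D by blast
qed

text \<open>Positivity at \<open>y - 2 \<epsilon> z\<close> with \<open>z = Q y\<close> is a
  quadratic in \<open>\<epsilon>\<close> whose constant term is \<open>0\<close>; it yields
  \<open>N z \<le> \<epsilon> \<langle>Q z, z\<rangle>\<close> for every
  \<open>\<epsilon> > 0\<close>.\<close>

lemma positive_ip_zero:
  assumes Q: "A_linear Q" "symmetric Q" "positive Q" and y: "y \<in> H" "ip (Q y) y = 0"
  shows "Q y = 0"
proof (rule N_eq_zero)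
  note QH = A_linear_H[OF Q(1)]
  let ?z = "Q y"
  show z: "?z \<in> H" using y QH by simp
  have "N ?z \<le> 0"
  proof (rule le_eps_arch[of _ "ip (Q ?z) ?z"])
    fix \<epsilon> :: real assume e: "0 < \<epsilon>"
    let ?w = "y - (2 * \<epsilon>) *\<^sub>R ?z"
    have "0 \<le> ip (Q ?w) ?w" using Q(3) y z by (auto simp: positive_def intro: H_diff H_scaleR)
    also have "\<dots> = (2 * \<epsilon> * (2 * \<epsilon>)) *\<^sub>R ip (Q ?z) ?z - ((2 * \<epsilon>) *\<^sub>R ip (Q ?z) y + (2 * \<epsilon>) *\<^sub>R N ?z)"
      using y z by (simp add: A_linear_diff[OF Q(1)] A_linear_scaleR[OF Q(1)] H_scaleR QH ip_diff ip_diff_right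
          H_diff ext_scaleR H_mult scaleR_right_diff_distrib del: scaleR_left_commute)
    also have "ip (Q ?z) y = N ?z" using Q(2) y z by (simp add: symmetric_def)
    finally have "(2 * \<epsilon>) *\<^sub>R N ?z + (2 * \<epsilon>) *\<^sub>R N ?z \<le> (2 * \<epsilon> * (2 * \<epsilon>)) *\<^sub>R ip (Q ?z) ?z" by simp
    then have "(4 * \<epsilon>) *\<^sub>R N ?z \<le> (2 * \<epsilon> * (2 * \<epsilon>)) *\<^sub>R ip (Q ?z) ?z" by (simp flip: scaleR_left_distrib)
    then have "(1 / (4 * \<epsilon>)) *\<^sub>R (4 * \<epsilon>) *\<^sub>R N ?z \<le> (1 / (4 * \<epsilon>)) *\<^sub>R (2 * \<epsilon> * (2 * \<epsilon>)) *\<^sub>R ip (Q ?z) ?z"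
      using e by (intro scaleR_left_mono) auto
    then show "N ?z \<le> \<epsilon> *\<^sub>R ip (Q ?z) ?z" using e by simp
  qed
  then show "N ?z = 0" using N_nonneg[OF z] by (rule antisym)
qed

text \<open>Another root \<open>Q\<close> commutes with \<open>Q^2 = S^2\<close>, hence with
  \<open>C\<close>. For \<open>y = Q x - C x\<close> this gives
  \<open>(Q + C) y = Q^2 x - C^2 x = 0\<close>, so positivity of both operators forces
  \<open>Q y = C y = 0\<close>, and symmetry gives
  \<open>N y = \<langle>x, Q y - C y\<rangle> = 0\<close>.\<close>

lemma sqrt_ex1:
  assumes S: "A_linear S" "symmetric S" "strongly_bounded S"
  shows "\<exists>C. A_linear C \<and> strongly_bounded C \<and> symmetric C \<and> positive C \<and> (\<forall>x\<in>H. C (C x) = S (S x)) \<and>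
    (\<forall>Q. A_linear Q \<longrightarrow> strongly_bounded Q \<longrightarrow> symmetric Q \<longrightarrow> positive Q \<longrightarrow> (\<forall>x\<in>H. Q (Q x) = S (S x)) \<longrightarrow>
      (\<forall>x\<in>H. Q x = C x))"
proof -
  obtain C where C: "A_linear C" "strongly_bounded C" "symmetric C" "positive C" "\<And>x. x \<in> H \<Longrightarrow> C (C x) = S (S x)"
    "\<And>Q. A_linear Q \<Longrightarrow> strongly_bounded Q \<Longrightarrow> (\<And>x. x \<in> H \<Longrightarrow> Q (S (S x)) = S (S (Q x))) \<Longrightarrow> (\<forall>x\<in>H. Q (C x) = C (Q x))"
    using sqrt_ex[OF S] by blast
  note CH = A_linear_H[OF C(1)]
  have "Q x = C x" if Q: "A_linear Q" "strongly_bounded Q" "symmetric Q" "positive Q"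
    and QQ: "\<And>x. x \<in> H \<Longrightarrow> Q (Q x) = S (S x)" and x: "x \<in> H" for Q x
  proof -
    note QH = A_linear_H[OF Q(1)]
    have "Q (S (S x)) = S (S (Q x))" if "x \<in> H" for x using QQ[OF that] QQ[OF QH[OF that]] by simp
    then have comm: "Q (C x) = C (Q x)" if "x \<in> H" for x using C(6)[OF Q(1,2)] that by blast
    define y where "y = Q x - C x"
    have y: "y \<in> H" using x by (simp add: y_def H_diff QH CH)
    have "Q y + C y = 0"
      using x by (simp add: y_def A_linear_diff[OF Q(1)] A_linear_diff[OF C(1)] QH CH QQ C(5) comm)
    then have "ip (Q y) y + ip (C y) y = 0"
      using y by (simp add: ip_add[symmetric] QH CH ext_zero)
    moreover have "0 \<le> ip (Q y) y" "0 \<le> ip (C y) y" using Q(4) C(4) y by (auto simp: positive_def)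
    ultimately have "ip (Q y) y = 0" "ip (C y) y = 0" using add_nonneg_eq_0_iff by blast+
    then have zero: "Q y = 0" "C y = 0" using positive_ip_zero Q C y by blast+
    have "N y = ip (Q x) y - ip (C x) y" using x y ip_diff[of "Q x" "C x" y] by (simp add: y_def QH CH)
    also have "\<dots> = ip x (Q y) - ip x (C y)" using Q(3) C(3) x y by (simp add: symmetric_def)
    finally have "N y = 0" by (simp add: zero)
    then have "y = 0" by (rule N_eq_zero[OF y])
    then show ?thesis by (simp add: y_def)
  qed
  then show ?thesis using C(1-5) by blast
qed

end

section \<open>The order modulus\<close>

text \<open>The lattice form of \<open>|a| + |b| = max |a + b| |a - b|\<close>. It turns bounds on
  \<open>|S (u + v)|\<close> and \<open>|S (u - v)|\<close> into one on
  \<open>|S u| + |S v|\<close>.\<close>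

lemma abs_add_abs_le:
  fixes a b c :: "'u::lattice_ab_group_add_abs"
  assumes "\<bar>a + b\<bar> \<le> c" "\<bar>a - b\<bar> \<le> c"
  shows "\<bar>a\<bar> + \<bar>b\<bar> \<le> c"
proof -
  note le = abs_le_D1[OF assms(1)] abs_le_D2[OF assms(1)] abs_le_D1[OF assms(2)] abs_le_D2[OF assms(2)]
  have "\<bar>b\<bar> \<le> c - a" using le(1,3) by (intro abs_leI) (simp_all add: le_diff_eq add.commute)
  moreover have "\<bar>b\<bar> \<le> c + a"
    using add_right_mono[OF le(2), of a] add_right_mono[OF le(4), of a] by (intro abs_leI) simp_all
  ultimately have "\<bar>a\<bar> \<le> c - \<bar>b\<bar>" by (intro abs_leI) (auto simp: algebra_simps)
  then show ?thesis by (simp add: algebra_simps)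
qed

lemma abs_diff_nonneg_le:
  fixes p q y :: "'u::lattice_ab_group_add_abs"
  assumes "0 \<le> p" "0 \<le> q" "p \<le> y" "q \<le> y"
  shows "\<bar>p - q\<bar> \<le> y"
  using assms by (intro abs_leI) (auto simp: diff_le_eq intro: add_increasing2)

text \<open>\<open>v\<close> is \<open>u\<close> truncated to the interval from \<open>- x\<close>
  to \<open>x\<close>, and \<open>w = (u - x)^+ - (- u - x)^+\<close> is the overshoot on the two
  sides.\<close>

lemma abs_riesz_decomposition:
  fixes u x y :: "'u::lattice_ab_group_add_abs"
  assumes "\<bar>u\<bar> \<le> x + y" "0 \<le> x" "0 \<le> y"
  obtains v w where "u = v + w" "\<bar>v\<bar> \<le> x" "\<bar>w\<bar> \<le> y"
proof
  let ?w = "pprt (u - x) - pprt (- u - x)"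
  show "u = (u - ?w) + ?w" by simp
  have "u - x \<le> y" "- u - x \<le> y" using assms(1) by (auto simp: abs_le_iff diff_le_eq ac_simps)
  then show "\<bar>?w\<bar> \<le> y" using assms(3) by (intro abs_diff_nonneg_le pprt_le_self) auto
  have *: "inf u x + pprt (- u - x) \<le> x" for u :: 'u
  proof -
    have "inf u x + (- u - x) \<le> u + (- u - x)" by (intro add_right_mono) simp
    also have "\<dots> \<le> x" using assms(2) by (simp add: minus_le_self_iff)
    finally show ?thesis by (simp add: pprt_def add_sup_distrib_left)
  qed
  have e: "u - ?w = inf u x + pprt (- u - x)" "- (u - ?w) = inf (- u) x + pprt (u - x)"
    using minus_inf_eq_pprt[of u x] minus_inf_eq_pprt[of "- u" x] by (simp_all add: algebra_simps)
  have "u - ?w \<le> x" unfolding e(1) by (rule *)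
  moreover have "- (u - ?w) \<le> x" unfolding e(2) using *[of "- u"] by simp
  ultimately show "\<bar>u - ?w\<bar> \<le> x" by (rule abs_leI)
qed

context cond_exp
begin

lemma B_T_iff: "S \<in> B_T E T \<longleftrightarrow> S \<in> extensional H \<and> A_linear S \<and> strongly_bounded S"
proof -
  have "(\<exists>k\<in>A. 0 \<le> k \<and> (\<forall>x\<in>H. T_norm E T (S x) \<le> k * T_norm E T x)) \<longleftrightarrow> strongly_bounded S"
    if "\<forall>x\<in>H. S x \<in> H"
    unfolding strongly_bounded_def using that by (intro bex_cong conj_cong ball_cong refl) (auto simp: T_norm_le_iff)
  then show ?thesis by (auto simp: B_T_def A_linear_def PiE_def Pi_iff)
qed

lemma self_adjoint_iff: "self_adjoint E T S \<longleftrightarrow> S \<in> B_T E T \<and> symmetric S"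
  by (simp add: self_adjoint_def is_adjoint_def symmetric_def T_inner_def)

lemma inner_positive_iff: "inner_positive E T S \<longleftrightarrow> positive S"
  by (simp add: inner_positive_def positive_def T_inner_def)

lemma eq_zero_if_orthogonal:
  assumes "y \<in> H" "\<And>x. x \<in> H \<Longrightarrow> ip x y = 0"
  shows "y = 0"
  using assms by (intro N_eq_zero[OF assms(1)]) simp

lemma adjoint_self_adjoint:
  assumes "self_adjoint E T S"
  shows "adjoint_op E T S = S"
  unfolding adjoint_op_def
proof (rule the_equality)
  show "is_adjoint E T S S" using assms by (simp add: self_adjoint_def)
  fix R assume R: "is_adjoint E T S R"
  have S: "is_adjoint E T S S" using assms by (simp add: self_adjoint_def)
  have BT: "R \<in> B_T E T" "S \<in> B_T E T" using R S by (auto simp: is_adjoint_def)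
  then have H: "R x \<in> H" "S x \<in> H" if "x \<in> H" for x using that by (auto simp: B_T_iff A_linear_H)
  show "R = S"
  proof (rule extensionalityI)
    show "R \<in> extensional H" "S \<in> extensional H" using BT by (auto simp: B_T_iff)
    fix y assume y: "y \<in> H"
    have "R y - S y = 0"
    proof (rule eq_zero_if_orthogonal)
      show "R y - S y \<in> H" using H y by (intro H_diff)
      fix x assume x: "x \<in> H"
      have "ip x (R y) = ip x (S y)" using R S x y unfolding is_adjoint_def T_inner_def by metis
      then show "ip x (R y - S y) = 0" using H x y by (simp add: ip_diff_right)
    qed
    then show "R y = S y" by simp
  qed
qed

lemma order_positive_mono:
  assumes "A_linear U" "\<And>x. x \<in> H \<Longrightarrow> 0 \<le> x \<Longrightarrow> 0 \<le> U x" "x \<in> H" "y \<in> H" "x \<le> y"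
  shows "U x \<le> U y"
  using assms(2)[of "y - x"] assms by (simp add: H_diff A_linear_diff)

lemma strongly_bounded_add:
  assumes "A_linear U" "A_linear V" "strongly_bounded U" "strongly_bounded V"
  shows "strongly_bounded (\<lambda>x. U x + V x)"
proof -
  obtain k where k: "k \<in> A" "0 \<le> k" "\<And>x. x \<in> H \<Longrightarrow> N (U x) \<le> (k * k) * N x"
    using assms(3) by (auto simp: strongly_bounded_def)
  obtain l where l: "l \<in> A" "0 \<le> l" "\<And>x. x \<in> H \<Longrightarrow> N (V x) \<le> (l * l) * N x"
    using assms(4) by (auto simp: strongly_bounded_def)
  \<comment> \<open>Any \<open>m\<close> in \<open>A\<close> with
    \<open>2 (k^2 + l^2) \<le> m^2\<close> would do; this choice avoids a root.\<close>
  let ?m = "2 *\<^sub>R (k + l)"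
  have "N (U x + V x) \<le> (?m * ?m) * N x" if x: "x \<in> H" for x
  proof -
    have "N (U x + V x) \<le> 2 *\<^sub>R (N (U x) + N (V x))" by (rule N_add_le[OF A_linear_H[OF assms(1) x] A_linear_H[OF assms(2) x]])
    also have "\<dots> \<le> 2 *\<^sub>R ((k * k) * N x + (l * l) * N x)" using x by (intro scaleR_left_mono add_mono k l) auto
    also have "\<dots> = (2 *\<^sub>R (k * k + l * l)) * N x" by (simp add: distrib_right)
    also have "\<dots> \<le> (?m * ?m) * N x"
    proof (rule mult_right_mono[OF _ N_nonneg[OF x]])
      have "0 \<le> 2 *\<^sub>R (k * k + l * l) + 8 *\<^sub>R (k * l)"
        using k l by (intro add_nonneg_nonneg scaleR_nonneg_nonneg) auto
      also have "\<dots> = ?m * ?m - 2 *\<^sub>R (k * k + l * l)"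
        using scaleR_left_distrib[of 2 2 "k * k"] scaleR_left_distrib[of 2 2 "l * l"]
          scaleR_left_distrib[of 4 4 "k * l"] by (simp add: algebra_simps)
      finally show "2 *\<^sub>R (k * k + l * l) \<le> ?m * ?m" by simp
    qed
    finally show ?thesis .
  qed
  moreover have "?m \<in> A" "0 \<le> ?m" using k l by (auto intro: A_scaleR A_add scaleR_nonneg_nonneg)
  ultimately show ?thesis unfolding strongly_bounded_def by blast
qed

section \<open>The Riesz-Kantorovich modulus of a dominated operator\<close>

context
  fixes S U :: "'u \<Rightarrow> 'u"
  assumes S: "A_linear S" and U: "A_linear U" "strongly_bounded U"
    and U_pos: "\<And>x. x \<in> H \<Longrightarrow> 0 \<le> x \<Longrightarrow> 0 \<le> U x"
    and dom: "\<And>u. u \<in> H \<Longrightarrow> \<bar>S u\<bar> \<le> U \<bar>u\<bar>"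
begin

abbreviation "rk \<equiv> rk_sup E T S"
abbreviation "M \<equiv> ord_modulus E T S"

text \<open>The supremum is taken in the whole type first; it lies below \<open>U x\<close>, so it
  falls into the ideal \<open>H\<close> and is the supremum there too.\<close>

lemma
  assumes x: "x \<in> H" "0 \<le> x"
  shows rk_lub: "lub_in UNIV {\<bar>S u\<bar> | u. u \<in> H \<and> \<bar>u\<bar> \<le> x} (rk x)"
    and rk_H: "rk x \<in> H" and rk_nonneg: "0 \<le> rk x" and rk_le: "rk x \<le> U x"
proof -
  let ?D = "{\<bar>S u\<bar> | u. u \<in> H \<and> \<bar>u\<bar> \<le> x}"
  have DU: "d \<le> U x" if d: "d \<in> ?D" for d
  proof -
    obtain u where u: "u \<in> H" "\<bar>u\<bar> \<le> x" "d = \<bar>S u\<bar>" using d by blast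
    have "U \<bar>u\<bar> \<le> U x" by (rule order_positive_mono[OF U(1) U_pos H_abs[OF u(1)] x(1) u(2)])
    then show ?thesis using order_trans[OF dom[OF u(1)]] u(3) by blast
  qed
  have D0: "0 \<in> ?D" using H_zero x A_linear_zero[OF S] by (auto intro!: exI[of _ 0])
  then have "?D \<noteq> {}" by blast
  from lub_ex[OF this DU] obtain s where s: "lub_in UNIV ?D s" by blast
  have s0: "0 \<le> s" by (rule lub_upper[OF s D0])
  have sU: "s \<le> U x" by (rule lub_least[OF s DU])
  have sH: "s \<in> H" using H_ideal[OF A_linear_H[OF U(1) x(1)], of s] s0 sU by (simp add: abs_of_nonneg order_trans[OF s0 sU])
  have "rk x = s"
    unfolding rk_sup_def
  proof (rule the_equality)
    show sH': "lub_in H ?D s" using s sH by (auto simp: lub_in_def)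
    show "t = s" if "lub_in H ?D t" for t using lub_unique[OF that sH'] .
  qed
  then show "lub_in UNIV ?D (rk x)" "rk x \<in> H" "0 \<le> rk x" "rk x \<le> U x" using s sH s0 sU by auto
qed

lemma rk_upper: "x \<in> H \<Longrightarrow> u \<in> H \<Longrightarrow> \<bar>u\<bar> \<le> x \<Longrightarrow> \<bar>S u\<bar> \<le> rk x"
  using lub_upper[OF rk_lub, of x "\<bar>S u\<bar>"] order_trans[OF abs_ge_zero, of u x] by blast

lemma rk_least: "x \<in> H \<Longrightarrow> 0 \<le> x \<Longrightarrow> (\<And>u. u \<in> H \<Longrightarrow> \<bar>u\<bar> \<le> x \<Longrightarrow> \<bar>S u\<bar> \<le> b) \<Longrightarrow> rk x \<le> b"
  by (rule lub_least[OF rk_lub]) auto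

text \<open>Subadditivity splits \<open>u\<close> into parts bounded by \<open>x\<close> and
  \<open>y\<close>. For the reverse, both \<open>u + v\<close> and \<open>u - v\<close> compete in
  the supremum at \<open>x + y\<close>, which bounds \<open>|S u| + |S v|\<close>.\<close>

lemma rk_add:
  assumes x: "x \<in> H" "0 \<le> x" and y: "y \<in> H" "0 \<le> y"
  shows "rk (x + y) = rk x + rk y"
proof (rule antisym)
  have xy: "x + y \<in> H" "0 \<le> x + y" using x y by (auto intro: H_add)
  show "rk (x + y) \<le> rk x + rk y"
  proof (rule rk_least[OF xy])
    fix u assume u: "u \<in> H" "\<bar>u\<bar> \<le> x + y"
    obtain v w where vw: "u = v + w" "\<bar>v\<bar> \<le> x" "\<bar>w\<bar> \<le> y" by (rule abs_riesz_decomposition[OF u(2) x(2) y(2)])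
    have H: "v \<in> H" "w \<in> H"
      using H_ideal[OF x(1), of v] H_ideal[OF y(1), of w] vw x y by (simp_all add: abs_of_nonneg)
    have "\<bar>S u\<bar> \<le> \<bar>S v\<bar> + \<bar>S w\<bar>"
      unfolding vw(1) A_linear_add[OF S H] by (rule abs_triangle_ineq)
    also have "\<dots> \<le> rk x + rk y" using H vw x y by (intro add_mono rk_upper)
    finally show "\<bar>S u\<bar> \<le> rk x + rk y" .
  qed
  have "\<bar>S u\<bar> + \<bar>S v\<bar> \<le> rk (x + y)" if "u \<in> H" "\<bar>u\<bar> \<le> x" "v \<in> H" "\<bar>v\<bar> \<le> y" for u v
  proof (rule abs_add_abs_le)
    have "\<bar>u + v\<bar> \<le> x + y" "\<bar>u - v\<bar> \<le> x + y"
      using order_trans[OF abs_triangle_ineq add_mono[OF that(2,4)]]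
        order_trans[OF abs_triangle_ineq4 add_mono[OF that(2,4)]] by auto
    then show "\<bar>S u + S v\<bar> \<le> rk (x + y)" "\<bar>S u - S v\<bar> \<le> rk (x + y)"
      using rk_upper[OF xy(1) H_add[OF that(1,3)]] rk_upper[OF xy(1) H_diff[OF that(1,3)]] that
      by (simp_all add: A_linear_add[OF S] A_linear_diff[OF S])
  qed
  then have "rk x \<le> rk (x + y) - \<bar>S v\<bar>" if "v \<in> H" "\<bar>v\<bar> \<le> y" for v
    using that by (intro rk_least[OF x]) (simp add: algebra_simps)
  then have "rk y \<le> rk (x + y) - rk x" by (intro rk_least[OF y]) (simp add: algebra_simps)
  then show "rk x + rk y \<le> rk (x + y)" by (simp add: algebra_simps)
qed

lemma rk_mult_ge:
  assumes a: "a \<in> A" "0 \<le> a" and x: "x \<in> H" "0 \<le> x"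
  shows "a * rk x \<le> rk (a * x)"
proof (rule lub_least[OF lub_mult[OF rk_lub[OF x] a(2)]])
  fix z assume "z \<in> (*) a ` {\<bar>S u\<bar> | u. u \<in> H \<and> \<bar>u\<bar> \<le> x}"
  then obtain u where u: "u \<in> H" "\<bar>u\<bar> \<le> x" "z = a * \<bar>S u\<bar>" by blast
  have "z = \<bar>S (a * u)\<bar>" using u a by (simp add: abs_pos_mult A_linear_mult[OF S])
  also have "\<dots> \<le> rk (a * x)"
    using u a x by (intro rk_upper H_A) (auto simp: abs_pos_mult intro: mult_left_mono)
  finally show "z \<le> rk (a * x)" .
qed

text \<open>The reverse of the previous inequality follows by dividing by \<open>1 + a\<close>.\<close>

lemma rk_mult:
  assumes a: "a \<in> A" "0 \<le> a" and x: "x \<in> H" "0 \<le> x"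
  shows "rk (a * x) = a * rk x"
proof -
  let ?u = "1 + a"
  have u: "?u \<in> A" "1 \<le> ?u" "0 \<le> ?u" using a by (auto intro: A_add A_one)
  obtain v where v: "v \<in> A" "0 \<le> v" "?u * v = 1" using A_inverse[OF u(1,2)] by blast
  have ux: "?u * x \<in> H" "0 \<le> ?u * x" using u x by (auto intro: H_A)
  have ax: "a * x \<in> H" "0 \<le> a * x" using a x by (auto intro: H_A)
  have e: "v * (?u * x) = x" using v(3) by (simp add: mult.commute[of v] flip: mult.assoc)
  have "?u * (v * rk (?u * x)) \<le> ?u * rk x"
    using rk_mult_ge[OF v(1,2) ux] u(3) unfolding e by (intro mult_left_mono)
  then have "rk (?u * x) \<le> ?u * rk x" using v(3) by (simp flip: mult.assoc)
  moreover have "rk (?u * x) = rk x + rk (a * x)" using rk_add[OF x ax] by (simp add: distrib_right)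
  ultimately have "rk (a * x) \<le> a * rk x" by (simp add: distrib_right)
  then show ?thesis using rk_mult_ge[OF a x] by (rule antisym)
qed

lemma M_eq: "x \<in> H \<Longrightarrow> M x = rk (pprt x) - rk (pprt (- x))"
  by (simp add: ord_modulus_def pprt_def)

text \<open>Additivity on the cone permits any decomposition into positive elements, so linearity
  need not follow positive parts through sums.\<close>

lemma M_diff_eq:
  assumes f: "f \<in> H" "0 \<le> f" and g: "g \<in> H" "0 \<le> g"
  shows "M (f - g) = rk f - rk g"
proof -
  let ?x = "f - g"
  have x: "?x \<in> H" using f g by (intro H_diff)
  have p: "pprt ?x \<in> H" "0 \<le> pprt ?x" "pprt (- ?x) \<in> H" "0 \<le> pprt (- ?x)"
    using H_pprt[OF x] H_pprt[OF H_minus[OF x]] by auto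
  have "pprt ?x + g = f + pprt (- ?x)" using pprt_minus_pprt[of ?x] by (simp add: algebra_simps)
  then have "rk (pprt ?x) + rk g = rk f + rk (pprt (- ?x))" using rk_add p f g by metis
  then show ?thesis by (simp add: M_eq[OF x] algebra_simps)
qed

lemma rk_zero: "rk 0 = 0"
  using rk_add[OF H_zero order_refl H_zero order_refl] by simp

lemma M_pos: "x \<in> H \<Longrightarrow> 0 \<le> x \<Longrightarrow> M x = rk x"
  using M_diff_eq[OF _ _ H_zero order_refl] by (simp add: rk_zero)

lemma M_linear: "A_linear M"
proof -
  have split: "pprt x \<in> H" "0 \<le> pprt x" if "x \<in> H" for x using that H_pprt by auto
  have MH: "M x \<in> H" if "x \<in> H" for x
    unfolding M_eq[OF that] using that by (intro H_diff rk_H split H_minus)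
  have add: "M (x + y) = M x + M y" if x: "x \<in> H" and y: "y \<in> H" for x y
  proof -
    have e: "x + y = (pprt x + pprt y) - (pprt (- x) + pprt (- y))"
      using pprt_minus_pprt[of x] pprt_minus_pprt[of y] by (simp add: algebra_simps)
    have "M (x + y) = rk (pprt x + pprt y) - rk (pprt (- x) + pprt (- y))"
      unfolding e by (rule M_diff_eq) (use x y in \<open>auto intro!: H_add H_pprt H_minus\<close>)
    also have "\<dots> = M x + M y"
      using split[OF x] split[OF y] split[OF H_minus[OF x]] split[OF H_minus[OF y]]
      by (simp add: rk_add M_eq x y)
    finally show ?thesis .
  qed
  have pos: "M (a * x) = a * M x" if a: "a \<in> A" "0 \<le> a" and x: "x \<in> H" for a x
  proof -
    have e: "a * x = a * pprt x - a * pprt (- x)" by (simp add: pprt_minus_pprt flip: right_diff_distrib)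
    have "M (a * x) = rk (a * pprt x) - rk (a * pprt (- x))"
      unfolding e by (rule M_diff_eq) (use a x in \<open>auto intro!: H_A H_pprt H_minus\<close>)
    also have "\<dots> = a * M x"
      using split[OF x] split[OF H_minus[OF x]] a by (simp add: rk_mult M_eq x right_diff_distrib)
    finally show ?thesis .
  qed
  have mult: "M (a * x) = a * M x" if a: "a \<in> A" and x: "x \<in> H" for a x
  proof -
    have e: "a * z = pprt a * z - pprt (- a) * z" for z by (simp add: pprt_minus_pprt flip: left_diff_distrib)
    have H: "pprt a * x \<in> H" "pprt (- a) * x \<in> H" using a x by (auto intro!: H_A A_pprt A_minus)
    have "M (a * x) + M (pprt (- a) * x) = M (pprt a * x)"
      using add[OF H_A[OF a x] H(2)] by (simp add: e[of x])
    then have "M (a * x) = M (pprt a * x) - M (pprt (- a) * x)" by (simp add: eq_diff_eq)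
    also have "\<dots> = a * M x" using a x by (simp add: pos A_pprt A_minus e[of "M x"])
    finally show ?thesis .
  qed
  show ?thesis using MH add mult by (simp add: A_linear_def)
qed

lemma M_dom: "x \<in> H \<Longrightarrow> \<bar>M x\<bar> \<le> U \<bar>x\<bar>"
proof -
  assume x: "x \<in> H"
  have p: "pprt x \<in> H" "0 \<le> pprt x" "pprt (- x) \<in> H" "0 \<le> pprt (- x)"
    using H_pprt[OF x] H_pprt[OF H_minus[OF x]] by auto
  have "\<bar>M x\<bar> \<le> rk (pprt x) + rk (pprt (- x))"
    unfolding M_eq[OF x] using rk_nonneg p by (intro abs_leI) (auto simp: algebra_simps intro: add_increasing add_increasing2 add_nonneg_nonneg)
  also have "\<dots> = rk \<bar>x\<bar>" using p by (simp add: rk_add abs_eq_pprt)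
  also have "\<dots> \<le> U \<bar>x\<bar>" using x by (intro rk_le H_abs) auto
  finally show "\<bar>M x\<bar> \<le> U \<bar>x\<bar>" .
qed

lemma M_bounded: "strongly_bounded M"
proof -
  obtain k where k: "k \<in> A" "0 \<le> k" "\<And>x. x \<in> H \<Longrightarrow> N (U x) \<le> (k * k) * N x"
    using U(2) by (auto simp: strongly_bounded_def)
  have "N (M x) \<le> (k * k) * N x" if x: "x \<in> H" for x
  proof -
    have "N (M x) \<le> N (U \<bar>x\<bar>)"
      using M_dom[OF x] x by (intro N_mono A_linear_H[OF U(1)] H_abs order_trans[OF M_dom[OF x] abs_ge_self])
    also have "\<dots> \<le> (k * k) * N \<bar>x\<bar>" using x by (intro k H_abs)
    finally show ?thesis by (simp only: N_abs)
  qed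
  then show ?thesis unfolding strongly_bounded_def using k by blast
qed

lemma S_abs_le_M: "x \<in> H \<Longrightarrow> 0 \<le> x \<Longrightarrow> \<bar>S x\<bar> \<le> M x"
  using rk_upper[of x x] M_pos[of x] by (simp add: abs_of_nonneg)

text \<open>The elements \<open>g\<close> with \<open>\<langle>g, y\<rangle> \<le> \<langle>x, |S| y\<rangle>\<close> for all \<open>y \<ge> 0\<close> are closed under
  finite suprema, since a component of \<open>1\<close> splits \<open>y\<close> into the parts where either of two such
  elements is the larger one, and contain all \<open>|S u|\<close> with \<open>|u| \<le> x\<close>.\<close>

lemma M_symmetric_le:
  assumes Ssym: "symmetric S" and x: "x \<in> H" "0 \<le> x" and y: "y \<in> H" "0 \<le> y"
  shows "ip (M x) y \<le> ip x (M y)"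
proof -
  note MH = A_linear_H[OF M_linear]
  \<comment> \<open>The bound by \<open>rk x\<close> keeps the elements in \<open>H\<close> and the
    supremum of the enlarged set equal to \<open>rk x\<close>.\<close>
  define G where "G = {g. 0 \<le> g \<and> g \<le> rk x \<and> (\<forall>y\<in>H. 0 \<le> y \<longrightarrow> ip g y \<le> ip x (M y))}"
  have GH: "g \<in> H" if "g \<in> G" for g
    using that rk_nonneg[OF x] by (intro H_ideal[OF rk_H[OF x]]) (auto simp: G_def abs_of_nonneg)
  have qH: "q * y \<in> H \<and> 0 \<le> q * y \<and> (1 - q) * y \<in> H \<and> 0 \<le> (1 - q) * y"
    if "0 \<le> q" "q \<le> 1" "y \<in> H" "0 \<le> y" for q y
  proof -
    have "q * y \<le> 1 * y" "(1 - q) * y \<le> 1 * y" using that by (intro mult_right_mono; simp)+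
    then show ?thesis using that by (auto intro!: H_ideal[OF that(3)] simp: abs_of_nonneg)
  qed
  have sup: "sup g h \<in> G" if g: "g \<in> G" and h: "h \<in> G" for g h
  proof -
    obtain q where q: "0 \<le> q" "q \<le> 1" "q * q = q" "q * (g - h) = pprt (g - h)" by (rule component_ex)
    have "sup g h = h + pprt (g - h)" by (simp add: pprt_def add_sup_distrib_left)
    then have e: "sup g h = q * g + (1 - q) * h" by (simp add: q(4)[symmetric] algebra_simps)
    have "ip (sup g h) y \<le> ip x (M y)" if y: "y \<in> H" "0 \<le> y" for y
    proof -
      note H = qH[OF q(1,2) y]
      have "sup g h * y = g * (q * y) + h * ((1 - q) * y)" unfolding e by (simp add: algebra_simps)
      then have "ip (sup g h) y = ip g (q * y) + ip h ((1 - q) * y)"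
        using H GH[OF g] GH[OF h] by (simp only: ext_add H_mult)
      also have "\<dots> \<le> ip x (M (q * y)) + ip x (M ((1 - q) * y))"
        using g h H by (intro add_mono) (auto simp: G_def)
      also have "\<dots> = ip x (M (q * y + (1 - q) * y))"
        using H x by (simp only: A_linear_add[OF M_linear] ip_add_right MH)
      also have "q * y + (1 - q) * y = y" by (simp add: algebra_simps)
      finally show ?thesis .
    qed
    moreover have "0 \<le> sup g h" using g by (auto simp: G_def intro: le_supI1)
    ultimately show ?thesis using g h by (simp add: G_def)
  qed
  have DG: "\<bar>S u\<bar> \<in> G" if u: "u \<in> H" "\<bar>u\<bar> \<le> x" for u
  proof -
    obtain q where q: "0 \<le> q" "q \<le> 1" "q * q = q" "q * S u = pprt (S u)" by (rule component_ex)
    have e: "\<bar>S u\<bar> = q * S u - (1 - q) * S u"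
      using pprt_minus_pprt[of "S u"] by (simp add: abs_eq_pprt q(4) left_diff_distrib algebra_simps)
    have "ip \<bar>S u\<bar> y \<le> ip x (M y)" if y: "y \<in> H" "0 \<le> y" for y
    proof -
      note H = qH[OF q(1,2) y]
      \<comment> \<open>The sign of \<open>S u\<close> is moved onto \<open>y\<close>:
        \<open>|S u| y = S u ?y\<close> with \<open>|?y| \<le> y\<close>, after which the symmetry
        of \<open>S\<close> applies.\<close>
      let ?y = "q * y - (1 - q) * y"
      have yH: "?y \<in> H" using H by (intro H_diff) auto
      have "q * y + (1 - q) * y = y" by (simp add: algebra_simps)
      then have "q * y \<le> y" "(1 - q) * y \<le> y" using H by (metis le_add_same_cancel1, metis le_add_same_cancel2)
      then have yy: "\<bar>?y\<bar> \<le> y" using H by (intro abs_diff_nonneg_le) auto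
      have "\<bar>S u\<bar> * y = S u * ?y" unfolding e by (simp add: algebra_simps)
      then have "ip \<bar>S u\<bar> y = ip u (S ?y)" using Ssym u yH by (simp add: symmetric_def)
      also have "\<dots> \<le> ip x (M y)"
      proof (rule ext_mono)
        have "u * S ?y \<le> \<bar>u\<bar> * \<bar>S ?y\<bar>" using abs_le_mult[of u "S ?y"] abs_ge_self order_trans by blast
        also have "\<dots> \<le> x * M y"
          using u x y yH yy rk_upper[OF y(1) yH yy] by (intro mult_mono) (auto simp: M_pos)
        finally show "u * S ?y \<le> x * M y" .
      qed (use u x y yH in \<open>auto intro!: H_mult MH A_linear_H[OF S]\<close>)
      finally show ?thesis .
    qed
    then show ?thesis using rk_upper[OF x(1) u] by (simp add: G_def)
  qed
  have rkG: "lub_in UNIV G (rk x)"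
  proof (rule lubI)
    show "g \<le> rk x" if "g \<in> G" for g using that by (simp add: G_def)
    show "rk x \<le> b" if "\<And>g. g \<in> G \<Longrightarrow> g \<le> b" for b
      by (rule rk_least[OF x]) (use that DG in blast)
  qed
  \<comment> \<open>Closure of \<open>G\<close> under suprema makes the products with
    \<open>y\<close> directed, so \<open>\<tau>\<close> may be exchanged with their
    supremum.\<close>
  let ?D = "(*) y ` G"
  have D: "up_directed ?D"
    unfolding up_directed_def
  proof (intro conjI ballI)
    show "?D \<noteq> {}" using DG[OF H_zero] x by auto
    fix p r assume "p \<in> ?D" "r \<in> ?D"
    then obtain g h where "g \<in> G" "h \<in> G" "p = y * g" "r = y * h" by blast
    then show "\<exists>z\<in>?D. p \<le> z \<and> r \<le> z"
      using sup y by (intro bexI[of _ "y * sup g h"]) (auto intro: mult_left_mono)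
  qed
  have "\<tau> (y * rk x) \<le> ip x (M y)"
  proof (rule ext_directed(2)[OF D _ lub_mult[OF rkG y(2)]])
    fix d assume "d \<in> ?D"
    then obtain g where g: "g \<in> G" "d = y * g" by blast
    then show "d \<in> P" using y GH[OF g(1)] by (intro L_P) (auto intro: H_mult simp: G_def)
    show "\<tau> d \<le> ip x (M y)" using g y by (auto simp: G_def mult.commute)
  qed
  then show ?thesis using x by (simp add: M_pos mult.commute)
qed

text \<open>On the cone the one-sided estimate becomes an equality when the roles of
  \<open>x\<close> and \<open>y\<close> are exchanged; linearity in each variable does the
  rest.\<close>

lemma M_symmetric:
  assumes Ssym: "symmetric S"
  shows "symmetric M"
  unfolding symmetric_def
proof (intro ballI)
  note MH = A_linear_H[OF M_linear]
  have pos: "ip (M x) y = ip x (M y)" if "x \<in> H" "0 \<le> x" "y \<in> H" "0 \<le> y" for x y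
    using M_symmetric_le[OF Ssym that] M_symmetric_le[OF Ssym that(3,4,1,2)]
    by (simp add: ip_commute antisym)
  have pos': "ip (M x) y = ip x (M y)" if x: "x \<in> H" "0 \<le> x" and y: "y \<in> H" for x y
  proof -
    have H: "pprt y \<in> H" "pprt (- y) \<in> H" using y by (auto intro: H_pprt H_minus)
    have "ip (M x) (pprt y - pprt (- y)) = ip x (M (pprt y - pprt (- y)))"
      using H x by (simp add: ip_diff_right MH A_linear_diff[OF M_linear] pos)
    then show ?thesis by (simp add: pprt_minus_pprt)
  qed
  fix x y assume x: "x \<in> H" and y: "y \<in> H"
  have H: "pprt x \<in> H" "pprt (- x) \<in> H" using x by (auto intro: H_pprt H_minus)
  have "ip (M (pprt x - pprt (- x))) y = ip (pprt x - pprt (- x)) (M y)"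
    using H y by (simp add: ip_diff MH A_linear_diff[OF M_linear] pos')
  then show "ip (M x) y = ip x (M y)" by (simp add: pprt_minus_pprt)
qed

end

section \<open>The spectral modulus and the equivalence\<close>

lemma
  assumes S: "self_adjoint E T S"
  shows spectral_modulus_square: "x \<in> H \<Longrightarrow> spectral_modulus E T S (spectral_modulus E T S x) = S (S x)"
    and spectral_modulus_unique: "R \<in> B_T E T \<Longrightarrow> symmetric R \<Longrightarrow> positive R \<Longrightarrow> (\<And>x. x \<in> H \<Longrightarrow> R (R x) = S (S x)) \<Longrightarrow>
      R = spectral_modulus E T S"
proof -
  let ?Q = "spectral_modulus E T S"
  have S': "A_linear S" "symmetric S" "strongly_bounded S" using S by (auto simp: self_adjoint_iff B_T_iff)
  obtain C where C: "A_linear C" "strongly_bounded C" "symmetric C" "positive C" "\<And>x. x \<in> H \<Longrightarrow> C (C x) = S (S x)"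
    "\<And>Q x. A_linear Q \<Longrightarrow> strongly_bounded Q \<Longrightarrow> symmetric Q \<Longrightarrow> positive Q \<Longrightarrow> (\<And>x. x \<in> H \<Longrightarrow> Q (Q x) = S (S x)) \<Longrightarrow>
      x \<in> H \<Longrightarrow> Q x = C x"
    using sqrt_ex1[OF S'] by blast
  \<comment> \<open>The root found so far is arbitrary outside \<open>H\<close>; members of
    \<open>B_T\<close> have to be extensional.\<close>
  let ?C = "restrict C H"
  have comp_eq: "compose H Q Q = compose H (adjoint_op E T S) S \<longleftrightarrow> (\<forall>x\<in>H. Q (Q x) = S (S x))" for Q
    unfolding adjoint_self_adjoint[OF S] compose_def by (auto simp: fun_eq_iff restrict_def)
  have CB: "?C \<in> B_T E T"
    using C(1,2) by (auto simp: B_T_iff A_linear_def strongly_bounded_def H_add H_A)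
  have Cs: "symmetric ?C" "positive ?C" "\<forall>x\<in>H. ?C (?C x) = S (S x)"
    using C(3-5) by (auto simp: symmetric_def positive_def A_linear_H[OF C(1)])
  have uniq: "R = ?C" if "R \<in> B_T E T" "symmetric R" "positive R" "\<And>x. x \<in> H \<Longrightarrow> R (R x) = S (S x)" for R
  proof (rule extensionalityI)
    show "R \<in> extensional H" using that by (simp add: B_T_iff)
    show "R x = ?C x" if "x \<in> H" for x
      using C(6)[of R x] \<open>R \<in> B_T E T\<close> \<open>symmetric R\<close> \<open>positive R\<close> \<open>\<And>x. x \<in> H \<Longrightarrow> R (R x) = S (S x)\<close> that
      by (auto simp: B_T_iff)
  qed simp
  have Q: "?Q = ?C"
    unfolding spectral_modulus_def self_adjoint_iff inner_positive_iff comp_eq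
  proof (rule the_equality)
    show "R = ?C" if "R \<in> B_T E T \<and> (R \<in> B_T E T \<and> symmetric R) \<and> positive R \<and> (\<forall>x\<in>H. R (R x) = S (S x))" for R
      by (rule uniq) (use that in blast)+
  qed (use CB Cs in blast)
  show "?Q (?Q x) = S (S x)" if "x \<in> H" unfolding Q using Cs(3) that by blast
  show "R = ?Q" if "R \<in> B_T E T" "symmetric R" "positive R" "\<And>x. x \<in> H \<Longrightarrow> R (R x) = S (S x)"
    unfolding Q by (rule uniq[OF that])
qed

lemma ord_modulus_eq_spectral_modulus_iff:
  assumes reg: "S \<in> B_T_regular E T" and sa: "self_adjoint E T S"
    and ipos: "inner_positive E T (ord_modulus E T S)"
  shows "(ord_modulus E T S = spectral_modulus E T S \<longleftrightarrow>
            compose H (pos_part_op E T S) (neg_part_op E T S) = op_zero E T) \<and>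
         (ord_modulus E T S = spectral_modulus E T S \<longleftrightarrow>
            op_add E T (compose H (pos_part_op E T S) (neg_part_op E T S))
                       (compose H (neg_part_op E T S) (pos_part_op E T S)) = op_zero E T)"
proof -
  let ?M = "ord_modulus E T S"
  let ?P = "pos_part_op E T S" and ?N = "neg_part_op E T S"
  obtain U V where UV: "S = op_diff E T U V" "U \<in> B_T_pos E T" "V \<in> B_T_pos E T"
    using reg by (auto simp: B_T_regular_def)
  have U: "A_linear U" "strongly_bounded U" "\<And>x. x \<in> H \<Longrightarrow> 0 \<le> x \<Longrightarrow> 0 \<le> U x"
    and V: "A_linear V" "strongly_bounded V" "\<And>x. x \<in> H \<Longrightarrow> 0 \<le> x \<Longrightarrow> 0 \<le> V x"
    using UV by (auto simp: B_T_pos_def B_T_iff)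
  have S: "A_linear S" "symmetric S" using sa by (auto simp: self_adjoint_iff B_T_iff)
  note SH = A_linear_H[OF S(1)]
  \<comment> \<open>For \<open>S = U - V\<close> with order positive parts, \<open>U + V\<close> is
    the dominating operator that the modulus construction needs.\<close>
  let ?W = "\<lambda>x. U x + V x"
  have W: "A_linear ?W"
    using U(1) V(1) unfolding A_linear_def by (auto simp: H_add distrib_left)
  have absle: "\<bar>R u\<bar> \<le> R \<bar>u\<bar>" if R: "A_linear R" "\<And>x. x \<in> H \<Longrightarrow> 0 \<le> x \<Longrightarrow> 0 \<le> R x" and u: "u \<in> H" for R u
  proof (rule abs_leI)
    show "R u \<le> R \<bar>u\<bar>" by (rule order_positive_mono[OF R u H_abs[OF u] abs_ge_self])
    show "- R u \<le> R \<bar>u\<bar>"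
      using order_positive_mono[OF R H_minus[OF u] H_abs[OF u] abs_ge_minus_self] by (simp add: A_linear_minus[OF R(1) u])
  qed
  have dom: "\<bar>S u\<bar> \<le> ?W \<bar>u\<bar>" if u: "u \<in> H" for u
  proof -
    have "\<bar>S u\<bar> \<le> \<bar>U u\<bar> + \<bar>V u\<bar>" using u by (simp add: UV(1) op_diff_def abs_triangle_ineq4)
    also have "\<dots> \<le> ?W \<bar>u\<bar>" using absle[OF U(1,3) u] absle[OF V(1,3) u] by (rule add_mono)
    finally show ?thesis .
  qed
  have Wpos: "0 \<le> ?W x" if "x \<in> H" "0 \<le> x" for x using U(3) V(3) that by auto
  note mod = S(1) W strongly_bounded_add[OF U(1) V(1) U(2) V(2)] Wpos dom
  have M: "A_linear ?M" by (rule M_linear[OF mod])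
  note MH = A_linear_H[OF M]
  have Mb: "strongly_bounded ?M" by (rule M_bounded[OF mod])
  have Ms: "symmetric ?M" by (rule M_symmetric[OF mod S(2)])
  have MS: "\<bar>S x\<bar> \<le> ?M x" if "x \<in> H" "0 \<le> x" for x by (rule S_abs_le_M[OF mod that])
  have MB: "?M \<in> B_T E T" using M Mb by (simp add: B_T_iff ord_modulus_def)
  have Pe: "?P x = (1/2) *\<^sub>R (?M x + S x)" and Ne: "?N x = (1/2) *\<^sub>R (?M x - S x)" if "x \<in> H" for x
    using that by (simp_all add: pos_part_op_def neg_part_op_def op_scale_def op_add_def op_diff_def)
  have PH: "?P x \<in> H" and NH: "?N x \<in> H" if "x \<in> H" for x
    using that by (simp_all add: Pe Ne H_scaleR H_add H_diff MH SH)
  have Ppos: "0 \<le> ?P x" and Npos: "0 \<le> ?N x" if "x \<in> H" "0 \<le> x" for x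
  proof -
    have "S x \<le> ?M x" "- S x \<le> ?M x" using MS[OF that] by (auto simp: abs_le_iff)
    then have "0 \<le> ?M x + S x" "0 \<le> ?M x - S x" by (auto simp: minus_le_iff le_diff_eq diff_le_eq neg_le_iff_le algebra_simps) (metis add.commute add.right_inverse add_le_cancel_left)
    then show "0 \<le> ?P x" "0 \<le> ?N x" using that by (simp_all add: Pe Ne scaleR_nonneg_nonneg)
  qed
  have PN: "?P (?N x) + ?N (?P x) = (1/2) *\<^sub>R (?M (?M x) - S (S x))" if x: "x \<in> H" for x
  proof -
    have h: "?M x + S x \<in> H" "?M x - S x \<in> H" using x by (auto intro!: H_add H_diff MH SH)
    \<comment> \<open>The mixed terms cancel in the symmetric sum although the modulus and
      \<open>S\<close> need not commute.\<close>
    have "?P (?N x) + ?N (?P x) =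
      (1/4) *\<^sub>R ((?M (?M x) - ?M (S x) + (S (?M x) - S (S x))) + (?M (?M x) + ?M (S x) - (S (?M x) + S (S x))))"
      using x h by (simp add: Pe Ne H_scaleR A_linear_scaleR[OF M] A_linear_scaleR[OF S(1)] A_linear_add[OF M]
          A_linear_add[OF S(1)] A_linear_diff[OF M] A_linear_diff[OF S(1)] MH SH
          flip: scaleR_right_distrib scaleR_right_diff_distrib)
    also have "\<dots> = (1/4) *\<^sub>R (2 *\<^sub>R (?M (?M x) - S (S x)))" by (simp add: scaleR_2)
    finally show ?thesis by simp
  qed
  have A: "?M = spectral_modulus E T S \<longleftrightarrow> (\<forall>x\<in>H. ?M (?M x) = S (S x))"
    using spectral_modulus_square[OF sa] spectral_modulus_unique[OF sa MB Ms] ipos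
    by (metis inner_positive_iff)
  have B: "(\<forall>x\<in>H. ?M (?M x) = S (S x)) \<longleftrightarrow> (\<forall>x\<in>H. ?P (?N x) + ?N (?P x) = 0)"
    by (simp add: PN)
  have C: "(\<forall>x\<in>H. ?P (?N x) + ?N (?P x) = 0) \<longleftrightarrow> (\<forall>x\<in>H. ?P (?N x) = 0)"
  proof (intro iffI ballI)
    fix x assume sum: "\<forall>x\<in>H. ?P (?N x) + ?N (?P x) = 0" and x: "x \<in> H"
    \<comment> \<open>Vanishing of both summands is available on the cone only; additivity then
      extends it to differences.\<close>
    have pos: "?P (?N x) = 0" if "x \<in> H" "0 \<le> x" for x
      using sum that add_nonneg_eq_0_iff[of "?P (?N x)" "?N (?P x)"] Ppos Npos PH NH by auto
    have lin: "?P (?N (y - z)) = ?P (?N y) - ?P (?N z)" if "y \<in> H" "z \<in> H" for y z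
    proof -
      have "?N (y - z) = ?N y - ?N z"
        using that by (simp add: Ne H_diff A_linear_diff[OF M] A_linear_diff[OF S(1)] flip: scaleR_right_diff_distrib)
      moreover have "?P (a - b) = ?P a - ?P b" if "a \<in> H" "b \<in> H" for a b
        using that by (simp add: Pe H_diff A_linear_diff[OF M] A_linear_diff[OF S(1)] flip: scaleR_right_diff_distrib)
      ultimately show ?thesis using that NH by simp
    qed
    have "?P (?N (pprt x - pprt (- x))) = 0"
      using x by (simp add: lin pos H_pprt H_minus)
    then show "?P (?N x) = 0" by (simp add: pprt_minus_pprt)
  next
    fix x assume PN0: "\<forall>x\<in>H. ?P (?N x) = 0" and x: "x \<in> H"
    have symm: "ip (?P y) z = ip y (?P z)" "ip (?N y) z = ip y (?N z)" if "y \<in> H" "z \<in> H" for y z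
      using Ms S(2) that by (simp_all add: symmetric_def Pe Ne ip_add ip_add_right ip_diff ip_diff_right
          MH SH ext_scaleR H_mult H_add H_diff)
    have "?N (?P x) = 0"
    proof (rule eq_zero_if_orthogonal)
      show "?N (?P x) \<in> H" using x PH NH by simp
      fix y assume y: "y \<in> H"
      have "ip y (?N (?P x)) = ip (?P (?N y)) x" using x y PH NH by (simp add: symm)
      then show "ip y (?N (?P x)) = 0" using PN0 y by (simp add: ext_zero)
    qed
    then show "?P (?N x) + ?N (?P x) = 0" using PN0 x by simp
  qed
  have z1: "compose H ?P ?N = op_zero E T \<longleftrightarrow> (\<forall>x\<in>H. ?P (?N x) = 0)"
    unfolding op_zero_def compose_def by (auto simp: fun_eq_iff restrict_def)
  have z2: "op_add E T (compose H ?P ?N) (compose H ?N ?P) = op_zero E T \<longleftrightarrow> (\<forall>x\<in>H. ?P (?N x) + ?N (?P x) = 0)"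
    unfolding op_zero_def op_add_def compose_def by (auto simp: fun_eq_iff restrict_def)
  show ?thesis using A B C z1 z2 by simp
qed

end

theorem theorem11p6:
  fixes E :: "'u::universally_complete_falgebra set"
    and T S :: "'u \<Rightarrow> 'u"
  assumes "conditional_expectation E T"
    and "S \<in> B_T_regular E T"
    and "self_adjoint E T S"
    and "inner_positive E T (ord_modulus E T S)"
  shows "(ord_modulus E T S = spectral_modulus E T S \<longleftrightarrow>
            compose (L2 E T) (pos_part_op E T S) (neg_part_op E T S) = op_zero E T) \<and>
         (ord_modulus E T S = spectral_modulus E T S \<longleftrightarrow>
            op_add E T (compose (L2 E T) (pos_part_op E T S) (neg_part_op E T S))
                       (compose (L2 E T) (neg_part_op E T S) (pos_part_op E T S)) = op_zero E T)"
proof -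
  interpret cond_exp E T by (rule cond_exp.intro) (rule assms(1))
  show ?thesis using assms(2-4) by (rule ord_modulus_eq_spectral_modulus_iff)
qed

end
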